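(* Let $\mathbf{C}$ be a regular Mal'cev category. Then $\mathbf{Rel}(\mathbf{C})$ satisfies the Heisenberg uncertainty principle for any quantum structure and any (not necessarily commutative) special dagger Frobenius structure. That is: for any quantum structure $(B,\mu_B,\eta_B)$ in $\mathbf{Rel}(\mathbf{C})$, any special dagger Frobenius structure $(C,\mu_C,\eta_C)$ in $\mathbf{Rel}(\mathbf{C})$, and any completely positive morphism $M\colon B\to B\otimes C$, if $$(\mathrm{id}_B\otimes\eta_C^\dagger)\circ M=\mathrm{id}_B,$$ then there exists $\psi\colon I\to C$ in $\mathbf{Rel}(\mathbf{C})$ such that $$(\eta_B^\dagger\otimes\mathrm{id}_C)\circ M=\psi\circ\eta_B^\dagger.$$
   Context: A category is regular when it has finite limits, coequalizers of kernel pairs, and regular epimorphisms are stable under pullback. A category with finite limits is Mal'cev if every reflexive relation $R\rightarrowtail A\times A$ is an equivalence relation. For $\mathbf{C}$ regular, $\mathbf{Rel}(\mathbf{C})$ has the same objects as $\mathbf{C}$; a morphism $R\colon A\to B$ is a subobject $R\rightarrowtail A\times B$; identities are diagonals; $S\circ R$ is the image of $R\times_B S\to A\times C$, i.e. $\{(a,c)\mid (\exists b)\,R(a,b)\wedge S(b,c)\}$ in the internal regular logic. $\mathbf{Rel}(\mathbf{C})$ is a compact dagger category with $\otimes=\times$, $I=1$, $R^\dagger(b,a)\Leftrightarrow R(a,b)$; every object is self-dual ($A^*=A$) with cup $I\to A\otimes A$ the diagonal $\{(a,b)\mid a=b\}$. A special dagger Frobenius structure in a dagger monoidal category is an object $A$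 with $\mu\colon A\otimes A\to A$, $\eta\colon I\to A$ satisfying $\mu(\mathrm{id}\otimes\eta)=\mathrm{id}_A=\mu(\eta\otimes\mathrm{id})$, $\mu(\mu\otimes\mathrm{id})=\mu(\mathrm{id}\otimes\mu)$, $\mu\circ\mu^\dagger=\mathrm{id}_A$, and $(\mu\otimes\mathrm{id})(\mathrm{id}\otimes\mu^\dagger)=(\mathrm{id}\otimes\mu)(\mu^\dagger\otimes\mathrm{id})$. A quantum structure in a compact dagger category is a special dagger Frobenius structure on an object $A^*\otimes A$ whose multiplication is $d\cdot(\mathrm{id}_{A^*}\otimes\mathrm{cap}_A\otimes\mathrm{id}_A)$ and whose unit is $d^{-1}\cdot\mathrm{cup}_A$, for an object $A$ and an invertible scalar $d\colon I\to I$. In $\mathbf{Rel}(\mathbf{C})$ these are the indiscrete groupoids on objects $A$: $B=A\times A$, with $\mu_B((a,b),(b',c),(a',c'))\Leftrightarrow a=a'\wedge b=b'\wedge c=c'$ and $\eta_B=\{(a,a')\mid a=a'\}$. The tensor product $B\otimes C$ of special dagger Frobenius structures has multiplication $(\mu_B\otimes\mu_C)\circ(\mathrm{id}_B\otimes\sigma\otimes\mathrm{id}_C)$ ($\sigma$ the swap) and unit $\eta_B\otimes\eta_C$. A morphism $f\colon A\to B$ between special dagger Frobenius structures $(A,\mu_A),(B,\mu_B)$ is completely positive if its Choi matrix $(\mathrm{id}_A\otimes\mu_B)\circ(\mathrm{id}_A\otimes f\otimes\mathrm{id}_B)\circ(\mu_A^\dagger\otimes\mathrm{id}_B)\colon A\otimes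 B\to A\otimes B$ equals $g^\dagger\circ g$ for some morphism $g\colon A\otimes B\to X$. *)

theory Defs
  imports Main
begin

section \<open>Categories\<close>

text \<open>Composition is written in application order: \<open>g \<cdot> f\<close> is \<open>g\<close> after \<open>f\<close>.\<close>

record ('o, 'm) category =
  Ob :: "'o set"
  Ar :: "'m set"
  Dom :: "'m \<Rightarrow> 'o"
  Cod :: "'m \<Rightarrow> 'o"
  Id :: "'o \<Rightarrow> 'm"
  Comp :: "'m \<Rightarrow> 'm \<Rightarrow> 'm"  (infixr "\<cdot>\<index>" 70)

definition hom :: "('o, 'm, 'x) category_scheme \<Rightarrow> 'o \<Rightarrow> 'o \<Rightarrow> 'm set" where
  "hom C A B = {f \<in> Ar C. Dom C f = A \<and> Cod C f = B}"

locale category =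
  fixes C :: "('o, 'm, 'x) category_scheme" (structure)
  assumes Dom_in_Ob: "f \<in> Ar C \<Longrightarrow> Dom C f \<in> Ob C"
    and Cod_in_Ob: "f \<in> Ar C \<Longrightarrow> Cod C f \<in> Ob C"
    and Id_in_hom: "A \<in> Ob C \<Longrightarrow> Id C A \<in> hom C A A"
    and Comp_in_hom: "f \<in> hom C A B \<Longrightarrow> g \<in> hom C B D \<Longrightarrow> g \<cdot> f \<in> hom C A D"
    and Comp_Id: "f \<in> hom C A B \<Longrightarrow> f \<cdot> Id C A = f"
    and Id_Comp: "f \<in> hom C A B \<Longrightarrow> Id C B \<cdot> f = f"
    and Comp_assoc: "f \<in> hom C A B \<Longrightarrow> g \<in> hom C B D \<Longrightarrow> h \<in> hom C D E
          \<Longrightarrow> h \<cdot> (g \<cdot> f) = (h \<cdot> g) \<cdot> f"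

definition is_functor ::
  "('i, 'a, 'x) category_scheme \<Rightarrow> ('o, 'm, 'y) category_scheme \<Rightarrow> ('i \<Rightarrow> 'o) \<Rightarrow> ('a \<Rightarrow> 'm) \<Rightarrow> bool" where
  "is_functor J C Fo Fm \<longleftrightarrow>
     (\<forall>i\<in>Ob J. Fo i \<in> Ob C) \<and>
     (\<forall>u\<in>Ar J. Fm u \<in> hom C (Fo (Dom J u)) (Fo (Cod J u))) \<and>
     (\<forall>i\<in>Ob J. Fm (Id J i) = Id C (Fo i)) \<and>
     (\<forall>u\<in>Ar J. \<forall>v\<in>Ar J. Cod J u = Dom J v \<longrightarrow> Fm (v \<cdot>\<^bsub>J\<^esub> u) = Fm v \<cdot>\<^bsub>C\<^esub> Fm u)"

definition is_cone ::
  "('i, 'a, 'x) category_scheme \<Rightarrow> ('o, 'm, 'y) category_scheme \<Rightarrow> ('i \<Rightarrow> 'o) \<Rightarrow> ('a \<Rightarrow> 'm)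
    \<Rightarrow> 'o \<Rightarrow> ('i \<Rightarrow> 'm) \<Rightarrow> bool" where
  "is_cone J C Fo Fm L c \<longleftrightarrow>
     L \<in> Ob C \<and> (\<forall>i\<in>Ob J. c i \<in> hom C L (Fo i)) \<and>
     (\<forall>u\<in>Ar J. Fm u \<cdot>\<^bsub>C\<^esub> c (Dom J u) = c (Cod J u))"

definition is_limit ::
  "('i, 'a, 'x) category_scheme \<Rightarrow> ('o, 'm, 'y) category_scheme \<Rightarrow> ('i \<Rightarrow> 'o) \<Rightarrow> ('a \<Rightarrow> 'm)
    \<Rightarrow> 'o \<Rightarrow> ('i \<Rightarrow> 'm) \<Rightarrow> bool" where
  "is_limit J C Fo Fm L c \<longleftrightarrow>
     is_cone J C Fo Fm L c \<and>
     (\<forall>X c'. is_cone J C Fo Fm X c' \<longrightarrow>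
        (\<exists>!h. h \<in> hom C X L \<and> (\<forall>i\<in>Ob J. c i \<cdot>\<^bsub>C\<^esub> h = c' i)))"

text \<open>Every finite category is isomorphic to one whose objects and morphisms are natural
  numbers, so these suffice as index categories.\<close>

definition has_finite_limits :: "('o, 'm, 'x) category_scheme \<Rightarrow> bool" where
  "has_finite_limits C \<longleftrightarrow>
     (\<forall>(J :: (nat, nat) category) Fo Fm.
        category J \<and> finite (Ob J) \<and> finite (Ar J) \<and> is_functor J C Fo Fm \<longrightarrow>
        (\<exists>L c. is_limit J C Fo Fm L c))"

context
  fixes C :: "('o, 'm, 'x) category_scheme" (structure)
begin

definition monic :: "'m \<Rightarrow> bool" where
  "monic m \<longleftrightarrow> m \<in> Ar C \<and>
     (\<forall>X. \<forall>f \<in> hom C X (Dom C m). \<forall>g \<in> hom C X (Dom C m). m \<cdot> f = m \<cdot> g \<longrightarrow> f = g)"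

definition is_coequalizer :: "'m \<Rightarrow> 'm \<Rightarrow> 'm \<Rightarrow> bool" where
  "is_coequalizer f g e \<longleftrightarrow>
     f \<in> Ar C \<and> g \<in> hom C (Dom C f) (Cod C f) \<and> e \<in> Ar C \<and> Dom C e = Cod C f \<and>
     e \<cdot> f = e \<cdot> g \<and>
     (\<forall>h \<in> Ar C. Dom C h = Cod C f \<and> h \<cdot> f = h \<cdot> g \<longrightarrow>
        (\<exists>!k. k \<in> hom C (Cod C e) (Cod C h) \<and> k \<cdot> e = h))"

definition regular_epi :: "'m \<Rightarrow> bool" where
  "regular_epi e \<longleftrightarrow> (\<exists>f g. is_coequalizer f g e)"

definition is_pullback :: "'m \<Rightarrow> 'm \<Rightarrow> 'm \<Rightarrow> 'm \<Rightarrow> bool" where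
  "is_pullback f g p q \<longleftrightarrow>
     f \<in> Ar C \<and> g \<in> Ar C \<and> Cod C f = Cod C g \<and>
     p \<in> Ar C \<and> Cod C p = Dom C f \<and> q \<in> hom C (Dom C p) (Dom C g) \<and>
     f \<cdot> p = g \<cdot> q \<and>
     (\<forall>X. \<forall>x \<in> hom C X (Dom C f). \<forall>y \<in> hom C X (Dom C g). f \<cdot> x = g \<cdot> y \<longrightarrow>
        (\<exists>!h. h \<in> hom C X (Dom C p) \<and> p \<cdot> h = x \<and> q \<cdot> h = y))"

definition is_terminal :: "'o \<Rightarrow> bool" where
  "is_terminal T \<longleftrightarrow> T \<in> Ob C \<and> (\<forall>A \<in> Ob C. \<exists>!f. f \<in> hom C A T)"

definition is_product :: "'o \<Rightarrow> 'o \<Rightarrow> 'o \<Rightarrow> 'm \<Rightarrow> 'm \<Rightarrow> bool" where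
  "is_product A B P p q \<longleftrightarrow>
     P \<in> Ob C \<and> p \<in> hom C P A \<and> q \<in> hom C P B \<and>
     (\<forall>X. \<forall>x \<in> hom C X A. \<forall>y \<in> hom C X B. \<exists>!h. h \<in> hom C X P \<and> p \<cdot> h = x \<and> q \<cdot> h = y)"

definition regular_category :: bool where
  "regular_category \<longleftrightarrow>
     category C \<and> has_finite_limits C \<and>
     (\<forall>f p q. is_pullback f f p q \<longrightarrow> (\<exists>e. is_coequalizer p q e)) \<and>
     (\<forall>f g p q. is_pullback f g p q \<and> regular_epi f \<longrightarrow> regular_epi q)"

subsection \<open>Chosen finite products\<close>

definition One :: 'o where
  "One = (SOME T. is_terminal T)"

definition Bang :: "'o \<Rightarrow> 'm" where
  "Bang A = (THE f. f \<in> hom C A One)"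

definition chosen_product :: "'o \<Rightarrow> 'o \<Rightarrow> 'o \<times> 'm \<times> 'm" where
  "chosen_product A B = (SOME (P, p, q). is_product A B P p q)"

definition Prd :: "'o \<Rightarrow> 'o \<Rightarrow> 'o" where
  "Prd A B = fst (chosen_product A B)"

definition Pr1 :: "'o \<Rightarrow> 'o \<Rightarrow> 'm" where
  "Pr1 A B = fst (snd (chosen_product A B))"

definition Pr2 :: "'o \<Rightarrow> 'o \<Rightarrow> 'm" where
  "Pr2 A B = snd (snd (chosen_product A B))"

definition Pair_ar :: "'m \<Rightarrow> 'm \<Rightarrow> 'm" where
  "Pair_ar f g = (THE h. h \<in> hom C (Dom C f) (Prd (Cod C f) (Cod C g)) \<and>
     Pr1 (Cod C f) (Cod C g) \<cdot> h = f \<and> Pr2 (Cod C f) (Cod C g) \<cdot> h = g)"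

subsection \<open>Internal relations and the Mal'cev condition\<close>

text \<open>The relation on \<open>X\<close>-indexed generalised elements of \<open>A\<close> induced by a monomorphism
  \<open>r\<close> into \<open>A \<times> A\<close>. As usual, an internal relation is reflexive, or an equivalence relation,
  when all the relations it induces on generalised elements are.\<close>

definition elem_rel :: "'o \<Rightarrow> 'm \<Rightarrow> 'o \<Rightarrow> ('m \<times> 'm) set" where
  "elem_rel A r X = {(x, y). x \<in> hom C X A \<and> y \<in> hom C X A \<and>
     (\<exists>h \<in> hom C X (Dom C r). r \<cdot> h = Pair_ar x y)}"

definition internal_reflexive :: "'o \<Rightarrow> 'm \<Rightarrow> bool" where
  "internal_reflexive A r \<longleftrightarrow> (\<forall>X \<in> Ob C. refl_on (hom C X A) (elem_rel A r X))"

definition internal_equivalence :: "'o \<Rightarrow> 'm \<Rightarrow> bool" where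
  "internal_equivalence A r \<longleftrightarrow> (\<forall>X \<in> Ob C. equiv (hom C X A) (elem_rel A r X))"

definition malcev_category :: bool where
  "malcev_category \<longleftrightarrow>
     category C \<and> has_finite_limits C \<and>
     (\<forall>A \<in> Ob C. \<forall>r. monic r \<and> Cod C r = Prd A A \<and> internal_reflexive A r \<longrightarrow>
        internal_equivalence A r)"

subsection \<open>Subobjects and images\<close>

text \<open>A subobject is a class of monomorphisms with a common codomain that factor through
  each other.\<close>

definition subobj :: "'m \<Rightarrow> 'm set" where
  "subobj m = {n. monic n \<and> Cod C n = Cod C m \<and>
     (\<exists>h \<in> hom C (Dom C n) (Dom C m). m \<cdot> h = n) \<and>
     (\<exists>k \<in> hom C (Dom C m) (Dom C n). n \<cdot> k = m)}"

definition subobjects :: "'o \<Rightarrow> 'm set set" where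
  "subobjects X = {subobj m | m. monic m \<and> Cod C m = X}"

text \<open>The image of \<open>f\<close>, as a class of monomorphisms: the monic parts of the factorizations
  of \<open>f\<close> as a regular epimorphism followed by a monomorphism. In a regular category this is a
  subobject of the codomain of \<open>f\<close>.\<close>

definition image_subobj :: "'m \<Rightarrow> 'm set" where
  "image_subobj f = {m. monic m \<and> (\<exists>e. regular_epi e \<and> Cod C e = Dom C m \<and> m \<cdot> e = f)}"

end

section \<open>Frobenius structures in compact dagger categories\<close>

text \<open>The data of a compact dagger category: \<open>\<boxtimes>\<close> is the tensor on objects, \<open>\<otimes>\<close> on morphisms,
  and the structural morphisms are
  \<open>assoc A B C : (A \<boxtimes> B) \<boxtimes> C \<rightarrow> A \<boxtimes> (B \<boxtimes> C)\<close>, \<open>lunit A : \<one> \<boxtimes> A \<rightarrow> A\<close>, \<open>runit A : A \<boxtimes> \<one> \<rightarrow> A\<close>,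
  \<open>braid A B : A \<boxtimes> B \<rightarrow> B \<boxtimes> A\<close> and \<open>cup A : \<one> \<rightarrow> dual A \<boxtimes> A\<close>. In a monoidal dagger category the
  structural isomorphisms are unitary, so their inverses are written as daggers below.\<close>

record ('o, 'm) compact_dagger = "('o, 'm) category" +
  tensor_ob :: "'o \<Rightarrow> 'o \<Rightarrow> 'o"  (infixr "\<boxtimes>\<index>" 75)
  tensor_ar :: "'m \<Rightarrow> 'm \<Rightarrow> 'm"  (infixr "\<otimes>\<index>" 75)
  unit_ob :: 'o  ("\<one>\<index>")
  assoc :: "'o \<Rightarrow> 'o \<Rightarrow> 'o \<Rightarrow> 'm"
  lunit :: "'o \<Rightarrow> 'm"
  runit :: "'o \<Rightarrow> 'm"
  braid :: "'o \<Rightarrow> 'o \<Rightarrow> 'm"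
  dagger :: "'m \<Rightarrow> 'm"  ("(_\<dagger>\<index>)" [1000] 1000)
  dual :: "'o \<Rightarrow> 'o"
  cup :: "'o \<Rightarrow> 'm"

context
  fixes D :: "('o, 'm, 'x) compact_dagger_scheme" (structure)
begin

definition special_dagger_frobenius :: "'o \<Rightarrow> 'm \<Rightarrow> 'm \<Rightarrow> bool" where
  "special_dagger_frobenius A \<mu> \<eta> \<longleftrightarrow>
     A \<in> Ob D \<and> \<mu> \<in> hom D (A \<boxtimes> A) A \<and> \<eta> \<in> hom D \<one> A \<and>
     \<mu> \<cdot> (Id D A \<otimes> \<eta>) \<cdot> (runit D A)\<dagger> = Id D A \<and>
     \<mu> \<cdot> (\<eta> \<otimes> Id D A) \<cdot> (lunit D A)\<dagger> = Id D A \<and>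
     \<mu> \<cdot> (\<mu> \<otimes> Id D A) = \<mu> \<cdot> (Id D A \<otimes> \<mu>) \<cdot> assoc D A A A \<and>
     \<mu> \<cdot> \<mu>\<dagger> = Id D A \<and>
     (\<mu> \<otimes> Id D A) \<cdot> (assoc D A A A)\<dagger> \<cdot> (Id D A \<otimes> \<mu>\<dagger>)
       = (Id D A \<otimes> \<mu>) \<cdot> assoc D A A A \<cdot> (\<mu>\<dagger> \<otimes> Id D A)"

text \<open>\<open>cap A : A \<boxtimes> dual A \<rightarrow> \<one>\<close>\<close>

definition cap :: "'o \<Rightarrow> 'm" where
  "cap A = (cup D A)\<dagger> \<cdot> braid D A (dual D A)"

definition scalar_mult :: "'m \<Rightarrow> 'm \<Rightarrow> 'm" where
  "scalar_mult d f = lunit D (Cod D f) \<cdot> (d \<otimes> f) \<cdot> (lunit D (Dom D f))\<dagger>"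

text \<open>\<open>id \<otimes> cap \<otimes> id : (dual A \<boxtimes> A) \<boxtimes> (dual A \<boxtimes> A) \<rightarrow> dual A \<boxtimes> A\<close>\<close>

definition pants :: "'o \<Rightarrow> 'm" where
  "pants A =
     (Id D (dual D A) \<otimes>
        (lunit D A \<cdot> (cap A \<otimes> Id D A) \<cdot> (assoc D A (dual D A) A)\<dagger>))
     \<cdot> assoc D (dual D A) A (dual D A \<boxtimes> A)"

text \<open>Below \<open>d'\<close> is the inverse of the scalar \<open>d\<close>.\<close>

definition quantum_structure :: "'o \<Rightarrow> 'm \<Rightarrow> 'm \<Rightarrow> bool" where
  "quantum_structure B \<mu> \<eta> \<longleftrightarrow>
     special_dagger_frobenius B \<mu> \<eta> \<and>
     (\<exists>A d d'. A \<in> Ob D \<and> d \<in> hom D \<one> \<one> \<and> d' \<in> hom D \<one> \<one> \<and>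
        d \<cdot> d' = Id D \<one> \<and> d' \<cdot> d = Id D \<one> \<and>
        B = dual D A \<boxtimes> A \<and>
        \<mu> = scalar_mult d (pants A) \<and>
        \<eta> = scalar_mult d' (cup D A))"

text \<open>\<open>id \<otimes> \<sigma> \<otimes> id : (A \<boxtimes> B) \<boxtimes> (A' \<boxtimes> B') \<rightarrow> (A \<boxtimes> A') \<boxtimes> (B \<boxtimes> B')\<close>, where \<open>\<sigma>\<close> swaps \<open>B\<close>
  and \<open>A'\<close>\<close>

definition interchange :: "'o \<Rightarrow> 'o \<Rightarrow> 'o \<Rightarrow> 'o \<Rightarrow> 'm" where
  "interchange A B A' B' =
     (assoc D A A' (B \<boxtimes> B'))\<dagger>
     \<cdot> (Id D A \<otimes> (assoc D A' B B' \<cdot> (braid D B A' \<otimes> Id D B') \<cdot> (assoc D B A' B')\<dagger>))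
     \<cdot> assoc D A B (A' \<boxtimes> B')"

definition tensor_mult :: "'o \<Rightarrow> 'm \<Rightarrow> 'o \<Rightarrow> 'm \<Rightarrow> 'm" where
  "tensor_mult B \<mu>B C \<mu>C = (\<mu>B \<otimes> \<mu>C) \<cdot> interchange B C B C"

definition choi :: "'o \<Rightarrow> 'm \<Rightarrow> 'o \<Rightarrow> 'm \<Rightarrow> 'm \<Rightarrow> 'm" where
  "choi A \<mu>A B \<mu>B f =
     (Id D A \<otimes> \<mu>B) \<cdot> (Id D A \<otimes> (f \<otimes> Id D B)) \<cdot> assoc D A A B \<cdot> (\<mu>A\<dagger> \<otimes> Id D B)"

definition completely_positive :: "'o \<Rightarrow> 'm \<Rightarrow> 'o \<Rightarrow> 'm \<Rightarrow> 'm \<Rightarrow> bool" where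
  "completely_positive A \<mu>A B \<mu>B f \<longleftrightarrow>
     f \<in> hom D A B \<and>
     (\<exists>X g. g \<in> hom D (A \<boxtimes> B) X \<and> choi A \<mu>A B \<mu>B f = g\<dagger> \<cdot> g)"

end

section \<open>The category of relations\<close>

text \<open>A morphism of \<open>Rel C\<close> from \<open>A\<close> to \<open>B\<close> is a triple \<open>(A, R, B)\<close> where \<open>R\<close> is a subobject of
  \<open>A \<times> B\<close>; the endpoints are recorded because different pairs of objects may have the same
  chosen product.\<close>

type_synonym ('o, 'm) rel_ar = "'o \<times> 'm set \<times> 'o"

context
  fixes C :: "('o, 'm, 'x) category_scheme" (structure)
begin

definition rel_graph :: "'m \<Rightarrow> ('o, 'm) rel_ar" where
  "rel_graph f = (Dom C f, subobj C (Pair_ar C (Id C (Dom C f)) f), Cod C f)"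

text \<open>\<open>rel_comp S R\<close> is \<open>S\<close> after \<open>R\<close>: the image of \<open>R \<times>\<^sub>B S \<rightarrow> A \<times> E\<close>, independently of the choice of
  representatives \<open>r\<close>, \<open>s\<close> and of the pullback \<open>(p, q)\<close>.\<close>

definition rel_comp :: "('o, 'm) rel_ar \<Rightarrow> ('o, 'm) rel_ar \<Rightarrow> ('o, 'm) rel_ar" where
  "rel_comp = (\<lambda>(B', S, E) (A, R, B).
     (A, {m. \<exists>r\<in>R. \<exists>s\<in>S. \<exists>p q.
            is_pullback C (Pr2 C A B \<cdot> r) (Pr1 C B' E \<cdot> s) p q \<and>
            m \<in> image_subobj C (Pair_ar C (Pr1 C A B \<cdot> r \<cdot> p) (Pr2 C B' E \<cdot> s \<cdot> q))}, E))"

definition rel_dagger :: "('o, 'm) rel_ar \<Rightarrow> ('o, 'm) rel_ar" where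
  "rel_dagger = (\<lambda>(A, R, B).
     (B, {m. \<exists>r\<in>R. m \<in> subobj C (Pair_ar C (Pr2 C A B \<cdot> r) (Pr1 C A B \<cdot> r))}, A))"

text \<open>\<open>R \<times> S\<close> as a subobject of \<open>(A \<times> A') \<times> (B \<times> B')\<close>, for \<open>R\<close> from \<open>A\<close> to \<open>B\<close> and \<open>S\<close> from
  \<open>A'\<close> to \<open>B'\<close>\<close>

definition rel_tensor :: "('o, 'm) rel_ar \<Rightarrow> ('o, 'm) rel_ar \<Rightarrow> ('o, 'm) rel_ar" where
  "rel_tensor = (\<lambda>(A, R, B) (A', S, B').
     (Prd C A A',
      {m. \<exists>r\<in>R. \<exists>s\<in>S.
         let p = Pr1 C (Dom C r) (Dom C s); q = Pr2 C (Dom C r) (Dom C s) in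
         m \<in> subobj C
           (Pair_ar C
             (Pair_ar C (Pr1 C A B \<cdot> r \<cdot> p) (Pr1 C A' B' \<cdot> s \<cdot> q))
             (Pair_ar C (Pr2 C A B \<cdot> r \<cdot> p) (Pr2 C A' B' \<cdot> s \<cdot> q)))},
      Prd C B B'))"

definition prod_assoc :: "'o \<Rightarrow> 'o \<Rightarrow> 'o \<Rightarrow> 'm" where
  "prod_assoc A B E =
     Pair_ar C (Pr1 C A B \<cdot> Pr1 C (Prd C A B) E)
       (Pair_ar C (Pr2 C A B \<cdot> Pr1 C (Prd C A B) E) (Pr2 C (Prd C A B) E))"

definition Rel :: "('o, ('o, 'm) rel_ar) compact_dagger" where
  "Rel = \<lparr>
     Ob = Ob C,
     Ar = {(A, R, B). A \<in> Ob C \<and> B \<in> Ob C \<and> R \<in> subobjects C (Prd C A B)},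
     Dom = (\<lambda>(A, R, B). A),
     Cod = (\<lambda>(A, R, B). B),
     Id = (\<lambda>A. rel_graph (Id C A)),
     Comp = rel_comp,
     tensor_ob = Prd C,
     tensor_ar = rel_tensor,
     unit_ob = One C,
     assoc = (\<lambda>A B E. rel_graph (prod_assoc A B E)),
     lunit = (\<lambda>A. rel_graph (Pr2 C (One C) A)),
     runit = (\<lambda>A. rel_graph (Pr1 C A (One C))),
     braid = (\<lambda>A B. rel_graph (Pair_ar C (Pr2 C A B) (Pr1 C A B))),
     dagger = rel_dagger,
     dual = (\<lambda>A. A),
     cup = (\<lambda>A. (One C,
              subobj C (Pair_ar C (Bang C A) (Pair_ar C (Id C A) (Id C A))),
              Prd C A A)) \<rparr>"

end

end

theory Submission
  imports Defs
begin

text \<open>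
  Relations in a regular category are handled through generalised elements. For a relation \<open>R\<close> from
  \<open>A\<close> to \<open>B\<close> and arrows \<open>a : X \<rightarrow> A\<close>, \<open>b : X \<rightarrow> B\<close>, the predicate \<open>sat R X a b\<close> says that \<open>(a, b)\<close>
  factors through \<open>R\<close>. This is the Kripke--Joyal reading of regular logic: a relation is determined
  by its elements (\<open>rel_eqI\<close>), truth is stable under restriction along any \<open>Y \<rightarrow> X\<close> and local for
  covers, that is, regular epimorphisms (\<open>sat_local\<close>), and the existential quantifier in a composite
  is witnessed after passing to a cover (\<open>sat_Comp\<close>). In this language the argument is elementary.

  A quantum structure is the multiplication of composable pairs \<open>(a, b) (b, c) = (a, c)\<close> on
  \<open>B = A \<times> A\<close>, because an invertible scalar of \<open>Rel C\<close> is the identity (\<open>scalar_inverse_Id\<close>).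
  Hence the Choi matrix of \<open>M\<close> relates \<open>((a, b), (d, f), k)\<close> to \<open>((a, b'), (c, f), k')\<close> exactly
  when some \<open>l\<close> satisfies \<open>M (b', b) ((c, d), l)\<close> and \<open>l k = k'\<close> in \<open>K\<close> (\<open>sat_choi_M_I\<close>,
  \<open>sat_choi_M_D\<close>). Being of the form \<open>g\<^sup>\<dagger> g\<close>, it is symmetric, and whenever it relates \<open>s\<close>
  to \<open>t\<close> it relates \<open>s\<close> to \<open>s\<close> and \<open>t\<close> to \<open>t\<close> (\<open>positive_rel\<close>). Write \<open>z \<in> \<eta>\<close> when \<open>z\<close> is a unit
  of \<open>K\<close>. The assumption on \<open>M\<close> says that \<open>M x (y, z)\<close> for some \<open>z \<in> \<eta>\<close> if and only if \<open>x = y\<close>.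

  Suppose \<open>M (b', b) ((c, d), l)\<close>, and let \<open>z \<in> \<eta>\<close> be a right unit of \<open>l\<close>. The Choi matrix relates
  \<open>s = ((b, b), (d, b), z)\<close> to \<open>t = ((b, b'), (c, b), l)\<close>. It then relates \<open>s\<close> to itself, which
  produces \<open>M (b, b) ((d, d), i)\<close> with \<open>i z = z\<close>, so \<open>i = z \<in> \<eta>\<close> and \<open>d = b\<close> by the assumption on
  \<open>M\<close> (\<open>sat_M_snd\<close>). By symmetry it relates \<open>t\<close> to \<open>s\<close>, and the same conclusion applied there gives
  \<open>c = b'\<close> (\<open>sat_M_fst\<close>). So \<open>M\<close> leaves \<open>B\<close> alone, and the relation to be factored holds of \<open>(a, b)\<close>
  and \<open>k\<close> precisely when \<open>a = b\<close> and \<open>M (a, a) ((a, a), k)\<close> (\<open>sat_readout\<close>).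

  It remains to see that \<open>M (a, a) ((a, a), k)\<close> does not depend on \<open>a\<close> (\<open>sat_M_transport\<close>), and here
  the Mal'cev condition enters, through difunctionality (\<open>difunctional\<close>). Given a further \<open>b : A\<close>,
  the assumption yields \<open>z \<in> \<eta>\<close> with \<open>M (a, b) ((a, b), z)\<close>, and positivity of the Choi matrix turns
  this into \<open>M (a, a) ((a, a), z)\<close> and \<open>M (b, b) ((b, b), z)\<close> (\<open>sat_M_endpoints\<close>). Thus \<open>a\<close> is
  related to \<open>k\<close> and to \<open>z\<close>, and \<open>b\<close> is related to \<open>z\<close>; difunctionality relates \<open>b\<close> to \<open>k\<close>.
\<close>

locale regular =
  fixes C :: "('o, 'm, 'x) category_scheme" (structure)
  assumes regular: "regular_category C"
begin

sublocale category C
  using regular by (simp add: regular_category_def)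

lemma finite_limits: "has_finite_limits C"
  using regular by (simp add: regular_category_def)

lemma Ob_simps [simp]: "f \<in> Ar C \<Longrightarrow> Dom C f \<in> Ob C" "f \<in> Ar C \<Longrightarrow> Cod C f \<in> Ob C"
  by (simp_all add: Dom_in_Ob Cod_in_Ob)

lemma Id_simps [simp]:
  assumes "A \<in> Ob C"
  shows "Id C A \<in> Ar C" "Dom C (Id C A) = A" "Cod C (Id C A) = A"
  using Id_in_hom[OF assms] by (simp_all add: hom_def)

lemma Comp_simps [simp]:
  assumes "f \<in> Ar C" "g \<in> Ar C" "Cod C f = Dom C g"
  shows "g \<cdot> f \<in> Ar C" "Dom C (g \<cdot> f) = Dom C f" "Cod C (g \<cdot> f) = Cod C g"
  using Comp_in_hom[of f "Dom C f" "Dom C g" g "Cod C g"] assms by (simp_all add: hom_def)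

lemma Id_laws [simp]:
  "f \<in> Ar C \<Longrightarrow> Dom C f = A \<Longrightarrow> f \<cdot> Id C A = f"
  "f \<in> Ar C \<Longrightarrow> Cod C f = A \<Longrightarrow> Id C A \<cdot> f = f"
  using Comp_Id[of f "Dom C f" "Cod C f"] Id_Comp[of f "Dom C f" "Cod C f"]
  by (auto simp: hom_def)

lemma assoc [simp]:
  "f \<in> Ar C \<Longrightarrow> g \<in> Ar C \<Longrightarrow> h \<in> Ar C \<Longrightarrow> Cod C f = Dom C g \<Longrightarrow> Cod C g = Dom C h \<Longrightarrow>
    (h \<cdot> g) \<cdot> f = h \<cdot> (g \<cdot> f)"
  using Comp_assoc[of f "Dom C f" "Dom C g" g "Dom C h" h "Cod C h"] by (auto simp: hom_def)

lemma hom_Ob: "f \<in> hom C X A \<Longrightarrow> X \<in> Ob C \<and> A \<in> Ob C"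
  by (auto simp: hom_def)

section \<open>Terminal object, products and pullbacks\<close>

lemma terminal_exists: "\<exists>T. is_terminal C T"
proof -
  define J :: "(nat, nat) category" where
    "J = \<lparr>Ob = {}, Ar = {}, Dom = \<lambda>_. 0, Cod = \<lambda>_. 0, Id = \<lambda>_. 0, Comp = \<lambda>_ _. 0\<rparr>"
  have "category J"
    by unfold_locales (auto simp: J_def hom_def)
  moreover have "is_functor J C undefined undefined"
    by (simp add: is_functor_def J_def)
  ultimately obtain L c where "is_limit J C undefined undefined L c"
    using finite_limits unfolding has_finite_limits_def
    by (metis J_def category.select_convs(1,2) finite.emptyI)
  then show ?thesis
    unfolding is_limit_def is_cone_def is_terminal_def by (intro exI[of _ L]) (simp add: J_def)
qed

lemma product_exists:
  assumes "A \<in> Ob C" "B \<in> Ob C"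
  shows "\<exists>P p q. is_product C A B P p q"
proof -
  define J :: "(nat, nat) category" where
    "J = \<lparr>Ob = {0, 1}, Ar = {0, 1}, Dom = id, Cod = id, Id = id, Comp = \<lambda>g f. f\<rparr>"
  define Fo where "Fo = (\<lambda>i::nat. if i = 0 then A else B)"
  have "category J"
    by unfold_locales (auto simp: J_def hom_def)
  moreover have "is_functor J C Fo (\<lambda>i. Id C (Fo i))"
    using assms by (auto simp: is_functor_def J_def Fo_def hom_def)
  moreover have "finite (Ob J)" "finite (Ar J)"
    by (simp_all add: J_def)
  ultimately obtain L c where L: "is_limit J C Fo (\<lambda>i. Id C (Fo i)) L c"
    using finite_limits unfolding has_finite_limits_def by blast
  have cone: "is_cone J C Fo (\<lambda>i. Id C (Fo i)) X c' \<longleftrightarrow> c' 0 \<in> hom C X A \<and> c' 1 \<in> hom C X B" for X c'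
    using assms by (auto simp: is_cone_def J_def Fo_def hom_def)
  have "is_product C A B L (c 0) (c 1)"
    unfolding is_product_def
  proof (intro conjI allI ballI)
    fix X x y assume "x \<in> hom C X A" "y \<in> hom C X B"
    then have "is_cone J C Fo (\<lambda>i. Id C (Fo i)) X (\<lambda>i. if i = 0 then x else y)"
      by (simp add: cone)
    then have "\<exists>!h. h \<in> hom C X L \<and> (\<forall>i\<in>Ob J. c i \<cdot> h = (if i = 0 then x else y))"
      using L by (auto simp: is_limit_def)
    then show "\<exists>!h. h \<in> hom C X L \<and> c 0 \<cdot> h = x \<and> c 1 \<cdot> h = y"
      by (simp add: J_def)
  next
    have "c 0 \<in> hom C L A \<and> c 1 \<in> hom C L B"
      using L cone by (simp add: is_limit_def)
    then show "L \<in> Ob C" "c 0 \<in> hom C L A" "c 1 \<in> hom C L B"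
      using hom_Ob by blast+
  qed
  then show ?thesis by blast
qed

lemma pullback_exists:
  assumes "f \<in> Ar C" "g \<in> Ar C" "Cod C f = Cod C g"
  shows "\<exists>p q. is_pullback C f g p q"
proof -
  \<comment> \<open>the cospan with arrows \<open>3 : 0 \<rightarrow> 2\<close> and \<open>4 : 1 \<rightarrow> 2\<close>\<close>
  define J :: "(nat, nat) category" where
    "J = \<lparr>Ob = {0, 1, 2}, Ar = {0, 1, 2, 3, 4},
          Dom = (\<lambda>a. if a = 3 then 0 else if a = 4 then 1 else a),
          Cod = (\<lambda>a. if a = 3 \<or> a = 4 then 2 else a), Id = id,
          Comp = (\<lambda>b a. if b = 3 \<or> b = 4 then b else a)\<rparr>"
  define Fo where
    "Fo = (\<lambda>i::nat. if i = 0 then Dom C f else if i = 1 then Dom C g else Cod C f)"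
  define Fm where
    "Fm = (\<lambda>a::nat. if a = 3 then f else if a = 4 then g else Id C (Fo a))"
  have "category J"
  proof unfold_locales
    fix f g :: nat and A B D
    assume "f \<in> hom J A B" "g \<in> hom J B D"
    then show "g \<cdot>\<^bsub>J\<^esub> f \<in> hom J A D"
      by (cases "g = 3"; cases "g = 4"; cases "f = 3"; cases "f = 4") (simp_all add: J_def hom_def)
  next
    fix f g h :: nat and A B D E
    show "h \<cdot>\<^bsub>J\<^esub> (g \<cdot>\<^bsub>J\<^esub> f) = (h \<cdot>\<^bsub>J\<^esub> g) \<cdot>\<^bsub>J\<^esub> f"
      by (simp add: J_def)
  qed (auto simp: J_def hom_def split: if_splits)
  moreover have "is_functor J C Fo Fm"
    using assms by (auto simp: is_functor_def J_def Fo_def Fm_def hom_def)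
  moreover have "finite (Ob J)" "finite (Ar J)"
    by (simp_all add: J_def)
  ultimately obtain L c where L: "is_limit J C Fo Fm L c"
    using finite_limits unfolding has_finite_limits_def by blast
  have cone: "is_cone J C Fo Fm X c' \<longleftrightarrow> c' 0 \<in> hom C X (Dom C f) \<and> c' 1 \<in> hom C X (Dom C g)
      \<and> c' 2 = f \<cdot> c' 0 \<and> g \<cdot> c' 1 = f \<cdot> c' 0" for X c'
    using assms by (auto simp: is_cone_def J_def Fo_def Fm_def hom_def)
  have c: "c 0 \<in> hom C L (Dom C f)" "c 1 \<in> hom C L (Dom C g)" "c 2 = f \<cdot> c 0" "g \<cdot> c 1 = f \<cdot> c 0"
    using L cone by (simp_all add: is_limit_def)
  have "is_pullback C f g (c 0) (c 1)"
    unfolding is_pullback_def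
  proof (intro conjI allI ballI impI)
    fix X x y
    assume xy: "x \<in> hom C X (Dom C f)" "y \<in> hom C X (Dom C g)" "f \<cdot> x = g \<cdot> y"
    let ?c = "\<lambda>i::nat. if i = 0 then x else if i = 1 then y else f \<cdot> x"
    have "is_cone J C Fo Fm X ?c"
      using xy by (simp add: cone)
    then have "\<exists>!h. h \<in> hom C X L \<and> (\<forall>i\<in>Ob J. c i \<cdot> h = ?c i)"
      using L by (auto simp: is_limit_def)
    moreover have "h \<in> hom C X L \<and> (\<forall>i\<in>Ob J. c i \<cdot> h = ?c i)
        \<longleftrightarrow> h \<in> hom C X L \<and> c 0 \<cdot> h = x \<and> c 1 \<cdot> h = y" for h
    proof -
      have "h \<in> hom C X L \<Longrightarrow> c 2 \<cdot> h = f \<cdot> c 0 \<cdot> h"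
        using c assms(1,2) by (simp add: hom_def)
      then show ?thesis by (auto simp: J_def)
    qed
    moreover have "Dom C (c 0) = L"
      using c by (simp add: hom_def)
    ultimately show "\<exists>!h. h \<in> hom C X (Dom C (c 0)) \<and> c 0 \<cdot> h = x \<and> c 1 \<cdot> h = y"
      by simp
  qed (use c assms in \<open>simp_all add: hom_def\<close>)
  then show ?thesis by blast
qed

lemma One_terminal: "is_terminal C (One C)"
  unfolding One_def using terminal_exists by (rule someI_ex)

lemma One_Ob [simp]: "One C \<in> Ob C"
  using One_terminal by (simp add: is_terminal_def)

lemma Bang_hom: "A \<in> Ob C \<Longrightarrow> Bang C A \<in> hom C A (One C)"
  unfolding Bang_def using One_terminal theI'[of "\<lambda>f. f \<in> hom C A (One C)"]
  by (simp add: is_terminal_def)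

lemma Bang_simps [simp]:
  assumes "A \<in> Ob C"
  shows "Bang C A \<in> Ar C" "Dom C (Bang C A) = A" "Cod C (Bang C A) = One C"
  using Bang_hom[OF assms] by (simp_all add: hom_def)

lemma to_One_eq: "f \<in> Ar C \<Longrightarrow> Cod C f = One C \<Longrightarrow> f = Bang C (Dom C f)"
  using One_terminal Bang_hom[of "Dom C f"] unfolding is_terminal_def
  by (metis (mono_tags, lifting) Dom_in_Ob hom_def mem_Collect_eq)

lemma Bang_Comp [simp]: "f \<in> Ar C \<Longrightarrow> Cod C f = A \<Longrightarrow> Bang C A \<cdot> f = Bang C (Dom C f)"
  using to_One_eq[of "Bang C A \<cdot> f"] by auto

abbreviation pairing ("\<langle>_, _\<rangle>") where "\<langle>f, g\<rangle> \<equiv> Pair_ar C f g"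

lemma Prd_is_product:
  assumes "A \<in> Ob C" "B \<in> Ob C"
  shows "is_product C A B (Prd C A B) (Pr1 C A B) (Pr2 C A B)"
proof -
  obtain P p q where "is_product C A B P p q"
    using product_exists[OF assms] by blast
  then have "(\<lambda>(P, p, q). is_product C A B P p q) (P, p, q)" by simp
  then have "(\<lambda>(P, p, q). is_product C A B P p q) (chosen_product C A B)"
    unfolding chosen_product_def by (rule someI)
  then show ?thesis
    by (simp add: Prd_def Pr1_def Pr2_def split_def)
qed

lemma Prd_simps [simp]:
  assumes "A \<in> Ob C" "B \<in> Ob C"
  shows "Prd C A B \<in> Ob C"
    "Pr1 C A B \<in> Ar C" "Dom C (Pr1 C A B) = Prd C A B" "Cod C (Pr1 C A B) = A"
    "Pr2 C A B \<in> Ar C" "Dom C (Pr2 C A B) = Prd C A B" "Cod C (Pr2 C A B) = B"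
  using Prd_is_product[OF assms] by (simp_all add: is_product_def hom_def)

lemma Pair_universal:
  assumes "f \<in> Ar C" "g \<in> Ar C" "Dom C g = Dom C f"
  shows "\<langle>f, g\<rangle> \<in> hom C (Dom C f) (Prd C (Cod C f) (Cod C g)) \<and>
     Pr1 C (Cod C f) (Cod C g) \<cdot> \<langle>f, g\<rangle> = f \<and> Pr2 C (Cod C f) (Cod C g) \<cdot> \<langle>f, g\<rangle> = g"
proof -
  have "\<exists>!h. h \<in> hom C (Dom C f) (Prd C (Cod C f) (Cod C g)) \<and>
     Pr1 C (Cod C f) (Cod C g) \<cdot> h = f \<and> Pr2 C (Cod C f) (Cod C g) \<cdot> h = g"
    using Prd_is_product[of "Cod C f" "Cod C g"] assms by (auto simp: is_product_def hom_def)
  then show ?thesis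
    unfolding Pair_ar_def by (rule theI')
qed

lemma Pair_simps [simp]:
  assumes "f \<in> Ar C" "g \<in> Ar C" "Dom C g = Dom C f"
  shows "\<langle>f, g\<rangle> \<in> Ar C" "Dom C \<langle>f, g\<rangle> = Dom C f" "Cod C \<langle>f, g\<rangle> = Prd C (Cod C f) (Cod C g)"
    "Cod C f = A \<Longrightarrow> Cod C g = B \<Longrightarrow> Pr1 C A B \<cdot> \<langle>f, g\<rangle> = f"
    "Cod C f = A \<Longrightarrow> Cod C g = B \<Longrightarrow> Pr2 C A B \<cdot> \<langle>f, g\<rangle> = g"
  using Pair_universal[OF assms] by (simp_all add: hom_def)

lemma Prd_ext:
  assumes "h \<in> hom C X (Prd C A B)" "k \<in> hom C X (Prd C A B)" "A \<in> Ob C" "B \<in> Ob C"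
    and "Pr1 C A B \<cdot> h = Pr1 C A B \<cdot> k" "Pr2 C A B \<cdot> h = Pr2 C A B \<cdot> k"
  shows "h = k"
proof -
  have "Pr1 C A B \<cdot> h \<in> hom C X A" "Pr2 C A B \<cdot> h \<in> hom C X B"
    using assms by (auto simp: hom_def)
  then show ?thesis
    using Prd_is_product[OF assms(3,4)] assms unfolding is_product_def by metis
qed

lemma Pair_eta [simp]:
  assumes "h \<in> Ar C" "Cod C h = Prd C A B" "A \<in> Ob C" "B \<in> Ob C"
  shows "\<langle>Pr1 C A B \<cdot> h, Pr2 C A B \<cdot> h\<rangle> = h"
  by (rule Prd_ext[of _ "Dom C h" A B]) (use assms in \<open>simp_all add: hom_def\<close>)

lemma Pair_Comp [simp]:
  assumes "f \<in> Ar C" "g \<in> Ar C" "Dom C g = Dom C f" "e \<in> Ar C" "Cod C e = Dom C f"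
  shows "\<langle>f, g\<rangle> \<cdot> e = \<langle>f \<cdot> e, g \<cdot> e\<rangle>"
proof (rule Prd_ext[of _ "Dom C e" "Cod C f" "Cod C g"])
  have "Pr1 C (Cod C f) (Cod C g) \<cdot> \<langle>f, g\<rangle> \<cdot> e = f \<cdot> e"
    "Pr2 C (Cod C f) (Cod C g) \<cdot> \<langle>f, g\<rangle> \<cdot> e = g \<cdot> e"
    by (subst assoc[symmetric]; use assms in simp)+
  then show "Pr1 C (Cod C f) (Cod C g) \<cdot> \<langle>f, g\<rangle> \<cdot> e = Pr1 C (Cod C f) (Cod C g) \<cdot> \<langle>f \<cdot> e, g \<cdot> e\<rangle>"
    "Pr2 C (Cod C f) (Cod C g) \<cdot> \<langle>f, g\<rangle> \<cdot> e = Pr2 C (Cod C f) (Cod C g) \<cdot> \<langle>f \<cdot> e, g \<cdot> e\<rangle>"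
    using assms by simp_all
qed (use assms in \<open>simp_all add: hom_def\<close>)

lemma Pair_inject [simp]:
  assumes "f \<in> Ar C" "g \<in> Ar C" "Dom C g = Dom C f" "f' \<in> Ar C" "g' \<in> Ar C" "Dom C g' = Dom C f'"
    "Cod C f = Cod C f'" "Cod C g = Cod C g'"
  shows "\<langle>f, g\<rangle> = \<langle>f', g'\<rangle> \<longleftrightarrow> f = f' \<and> g = g'"
proof
  assume eq: "\<langle>f, g\<rangle> = \<langle>f', g'\<rangle>"
  have "f = Pr1 C (Cod C f) (Cod C g) \<cdot> \<langle>f', g'\<rangle>" "g = Pr2 C (Cod C f) (Cod C g) \<cdot> \<langle>f', g'\<rangle>"
    unfolding eq[symmetric] using assms by simp_all
  then show "f = f' \<and> g = g'"
    using assms(4-8) by simp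
qed simp

lemma Pair_Pr [simp]: "A \<in> Ob C \<Longrightarrow> B \<in> Ob C \<Longrightarrow> \<langle>Pr1 C A B, Pr2 C A B\<rangle> = Id C (Prd C A B)"
  using Pair_eta[of "Id C (Prd C A B)" A B] by simp

lemma elem_Prd_cases:
  assumes "w \<in> hom C X (Prd C A B)" "A \<in> Ob C" "B \<in> Ob C"
  obtains a b where "a \<in> hom C X A" "b \<in> hom C X B" "w = \<langle>a, b\<rangle>"
  by (rule that[of "Pr1 C A B \<cdot> w" "Pr2 C A B \<cdot> w"]) (use assms in \<open>auto simp: hom_def\<close>)

lemma monic_cancel:
  assumes "monic C m" "f \<in> Ar C" "g \<in> Ar C" "Dom C f = Dom C g" "Cod C f = Dom C m" "Cod C g = Dom C m"
    and "m \<cdot> f = m \<cdot> g"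
  shows "f = g"
  using assms unfolding monic_def hom_def by blast

lemma monic_Ar: "monic C m \<Longrightarrow> m \<in> Ar C"
  by (simp add: monic_def)

section \<open>Regular epimorphisms and images\<close>

lemma pullback_universal:
  assumes "is_pullback C f g p q" "x \<in> Ar C" "y \<in> Ar C" "Dom C x = Dom C y"
    and "Cod C x = Dom C f" "Cod C y = Dom C g" "f \<cdot> x = g \<cdot> y"
  shows "\<exists>h \<in> hom C (Dom C y) (Dom C p). p \<cdot> h = x \<and> q \<cdot> h = y"
  using assms unfolding is_pullback_def hom_def by blast

lemma coequalizer_universal:
  assumes "is_coequalizer C f g e" "h \<in> Ar C" "Dom C h = Cod C f" "h \<cdot> f = h \<cdot> g"
  shows "\<exists>k \<in> hom C (Cod C e) (Cod C h). k \<cdot> e = h"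
  using assms unfolding is_coequalizer_def by blast

lemma coequalizer_unique:
  assumes "is_coequalizer C f g e" "h \<in> Ar C" "Dom C h = Cod C f" "h \<cdot> f = h \<cdot> g"
    and "j \<in> hom C (Cod C e) (Cod C h)" "j \<cdot> e = h" "k \<in> hom C (Cod C e) (Cod C h)" "k \<cdot> e = h"
  shows "j = k"
  using assms unfolding is_coequalizer_def by blast

lemma regular_epi_Ar: "regular_epi C e \<Longrightarrow> e \<in> Ar C"
  by (auto simp: regular_epi_def is_coequalizer_def)

lemma regular_epi_cancel:
  assumes "regular_epi C e" "h \<in> Ar C" "k \<in> Ar C" "Dom C h = Cod C e" "Dom C k = Cod C e"
    and eq: "h \<cdot> e = k \<cdot> e"
  shows "h = k"
proof -
  obtain f g where fg: "is_coequalizer C f g e"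
    using assms(1) by (auto simp: regular_epi_def)
  then have ar: "f \<in> Ar C" "g \<in> Ar C" "Cod C g = Cod C f" "e \<in> Ar C" "Dom C e = Cod C f" "e \<cdot> f = e \<cdot> g"
    by (auto simp: is_coequalizer_def hom_def)
  have cod: "Cod C h = Cod C k"
    using arg_cong[OF eq, of "Cod C"] assms(2-5) ar by simp
  have "(h \<cdot> e) \<cdot> f = (h \<cdot> e) \<cdot> g" "h \<cdot> e \<in> Ar C" "Dom C (h \<cdot> e) = Cod C f" "Cod C (h \<cdot> e) = Cod C h"
    using ar assms(2-5) by simp_all
  then show ?thesis
    by (intro coequalizer_unique[OF fg, of "h \<cdot> e" h k])
      (use assms(2-5) cod eq in \<open>simp_all add: hom_def\<close>)
qed

text \<open>Regular epimorphisms are left orthogonal to monomorphisms: if \<open>e\<close> coequalizes \<open>f\<close> and \<open>g\<close>, then so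
  does \<open>u\<close>, because \<open>m u = v e\<close> and \<open>m\<close> is monic. This is what makes membership in a subobject local.\<close>

lemma regular_epi_orthogonal:
  assumes "regular_epi C e" "monic C m" "u \<in> hom C (Dom C e) (Dom C m)" "v \<in> hom C (Cod C e) (Cod C m)"
    and eq: "m \<cdot> u = v \<cdot> e"
  shows "\<exists>d \<in> hom C (Cod C e) (Dom C m). m \<cdot> d = v"
proof -
  obtain f g where fg: "is_coequalizer C f g e"
    using assms(1) by (auto simp: regular_epi_def)
  then have ar: "f \<in> Ar C" "g \<in> Ar C" "Dom C g = Dom C f" "Cod C g = Cod C f" "e \<in> Ar C" "Dom C e = Cod C f"
      "e \<cdot> f = e \<cdot> g"
    by (auto simp: is_coequalizer_def hom_def)
  have m: "m \<in> Ar C" and uv: "u \<in> Ar C" "Dom C u = Cod C f" "Cod C u = Dom C m"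
      "v \<in> Ar C" "Dom C v = Cod C e" "Cod C v = Cod C m"
    using assms ar by (auto simp: hom_def monic_def)
  have "m \<cdot> (u \<cdot> f) = (v \<cdot> e) \<cdot> f"
    unfolding eq[symmetric] using ar m uv by simp
  also have "\<dots> = (v \<cdot> e) \<cdot> g"
    using ar m uv by simp
  also have "\<dots> = m \<cdot> (u \<cdot> g)"
    unfolding eq[symmetric] using ar m uv by simp
  finally have "u \<cdot> f = u \<cdot> g"
    using monic_cancel[OF assms(2), of "u \<cdot> f" "u \<cdot> g"] ar uv by simp
  then obtain d where d: "d \<in> hom C (Cod C e) (Dom C m)" "d \<cdot> e = u"
    using coequalizer_universal[OF fg uv(1,2)] uv(3) by auto
  have "(m \<cdot> d) \<cdot> e = v \<cdot> e"
    using d ar m by (simp add: hom_def eq)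
  then have "m \<cdot> d = v"
    using regular_epi_cancel[OF assms(1), of "m \<cdot> d" v] d m uv by (simp add: hom_def)
  with d show ?thesis by blast
qed

lemma regular_epi_pullback:
  assumes "regular_epi C e" "f \<in> Ar C" "Cod C f = Cod C e"
  shows "\<exists>e' f'. regular_epi C e' \<and> Cod C e' = Dom C f \<and> f' \<in> hom C (Dom C e') (Dom C e) \<and> e \<cdot> f' = f \<cdot> e'"
proof -
  obtain p q where pq: "is_pullback C e f p q"
    using pullback_exists[of e f] assms regular_epi_Ar by auto
  then have "regular_epi C q"
    using regular assms(1) unfolding regular_category_def by blast
  with pq show ?thesis
    unfolding is_pullback_def hom_def by (intro exI[of _ q] exI[of _ p]) simp
qed

text \<open>The coequalizer \<open>e\<close> of the kernel pair of \<open>f\<close> is the required regular epimorphism. To see that the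
  comparison \<open>m\<close> is monic, two arrows equalized by \<open>m\<close> are lifted along pullbacks of \<open>e\<close> to arrows
  into the domain of \<open>f\<close>; the lifts factor through the kernel pair, so \<open>e\<close> identifies them.\<close>

lemma image_factorization:
  assumes "f \<in> Ar C"
  shows "\<exists>m e. monic C m \<and> regular_epi C e \<and> Cod C e = Dom C m \<and> m \<cdot> e = f"
proof -
  obtain p q where pq: "is_pullback C f f p q"
    using pullback_exists[of f f] assms by auto
  then obtain e where e: "is_coequalizer C p q e"
    using regular unfolding regular_category_def by blast
  have re: "regular_epi C e"
    using e by (auto simp: regular_epi_def)
  have ar: "e \<in> Ar C" "Dom C e = Dom C f" "e \<cdot> p = e \<cdot> q"
      "p \<in> Ar C" "q \<in> Ar C" "Cod C p = Dom C f" "Cod C q = Dom C f" "Dom C q = Dom C p"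
    using pq e by (auto simp: is_pullback_def is_coequalizer_def hom_def)
  have "f \<cdot> p = f \<cdot> q"
    using pq by (simp add: is_pullback_def)
  then obtain m where m: "m \<in> hom C (Cod C e) (Cod C f)" "m \<cdot> e = f"
    using coequalizer_universal[OF e, of f] assms ar by auto
  have m_ar: "m \<in> Ar C" "Dom C m = Cod C e" "Cod C m = Cod C f"
    using m by (auto simp: hom_def)
  have "monic C m"
    unfolding monic_def
  proof (intro conjI allI ballI impI)
    fix Z g h
    assume "g \<in> hom C Z (Dom C m)" "h \<in> hom C Z (Dom C m)" and eq: "m \<cdot> g = m \<cdot> h"
    then have gh: "g \<in> Ar C" "h \<in> Ar C" "Dom C g = Z" "Dom C h = Z" "Cod C g = Cod C e" "Cod C h = Cod C e"
      using m_ar by (auto simp: hom_def)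
    obtain e1 g1 where 1: "regular_epi C e1" "Cod C e1 = Z" "g1 \<in> hom C (Dom C e1) (Dom C e)" "e \<cdot> g1 = g \<cdot> e1"
      using regular_epi_pullback[OF re, of g] gh by auto
    obtain e2 h2 where 2: "regular_epi C e2" "Cod C e2 = Dom C e1" "h2 \<in> hom C (Dom C e2) (Dom C e)"
        "e \<cdot> h2 = (h \<cdot> e1) \<cdot> e2"
      using regular_epi_pullback[OF re, of "h \<cdot> e1"] gh 1 regular_epi_Ar[of e1] by auto
    have ar12: "e1 \<in> Ar C" "e2 \<in> Ar C" "g1 \<in> Ar C" "h2 \<in> Ar C"
        "Dom C g1 = Dom C e1" "Cod C g1 = Dom C e" "Dom C h2 = Dom C e2" "Cod C h2 = Dom C e"
      using 1 2 regular_epi_Ar by (auto simp: hom_def)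
    have eg: "e \<cdot> (g1 \<cdot> e2) = g \<cdot> (e1 \<cdot> e2)"
      using 1(2,4) 2(2) ar ar12 gh assoc[of e2 g1 e] assoc[of e2 e1 g] by simp
    have eh: "e \<cdot> h2 = h \<cdot> (e1 \<cdot> e2)"
      using 2 1(2) ar12 gh by simp
    have "f \<cdot> (g1 \<cdot> e2) = m \<cdot> (e \<cdot> (g1 \<cdot> e2))"
      unfolding m(2)[symmetric] using m_ar ar ar12 2(2) by simp
    also have "\<dots> = (m \<cdot> g) \<cdot> (e1 \<cdot> e2)"
      unfolding eg using m_ar ar ar12 2(2) 1(2) gh by simp
    also have "\<dots> = m \<cdot> (e \<cdot> h2)"
      unfolding eh eq using m_ar ar ar12 2(2) 1(2) gh by simp
    also have "\<dots> = f \<cdot> h2"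
      unfolding m(2)[symmetric] using m_ar ar ar12 by simp
    finally obtain k where k: "k \<in> hom C (Dom C e2) (Dom C p)" "p \<cdot> k = g1 \<cdot> e2" "q \<cdot> k = h2"
      using pullback_universal[OF pq, of "g1 \<cdot> e2" h2] ar ar12 2(2) by auto
    have "e \<cdot> (p \<cdot> k) = (e \<cdot> p) \<cdot> k"
      using k(1) ar(1,2,4-8) by (simp add: hom_def)
    also have "\<dots> = e \<cdot> (q \<cdot> k)"
      unfolding ar(3) using k(1) ar(1,2,4-8) by (simp add: hom_def)
    finally have "e \<cdot> (g1 \<cdot> e2) = e \<cdot> h2"
      unfolding k(2,3) .
    then have "(g \<cdot> e1) \<cdot> e2 = (h \<cdot> e1) \<cdot> e2"
      using eg eh gh ar12 1(2) 2(2) by simp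
    then have "g \<cdot> e1 = h \<cdot> e1"
      using regular_epi_cancel[OF 2(1), of "g \<cdot> e1" "h \<cdot> e1"] gh ar12 1(2) 2(2) by simp
    then show "g = h"
      using regular_epi_cancel[OF 1(1), of g h] gh 1(2) by simp
  qed (fact m_ar)
  with re m(2) m_ar(2) show ?thesis
    by (intro exI[of _ m] exI[of _ e]) simp
qed

lemma regular_epi_Comp_iso:
  assumes "regular_epi C e" "m \<in> Ar C" "Dom C m = Cod C e" "k \<in> hom C (Cod C m) (Dom C m)"
    and "m \<cdot> k = Id C (Cod C m)" "k \<cdot> m = Id C (Dom C m)"
  shows "regular_epi C (m \<cdot> e)"
proof -
  obtain f g where fg: "is_coequalizer C f g e"
    using assms(1) by (auto simp: regular_epi_def)
  then have ar: "f \<in> Ar C" "g \<in> Ar C" "Dom C g = Dom C f" "Cod C g = Cod C f" "e \<in> Ar C" "Dom C e = Cod C f"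
      "e \<cdot> f = e \<cdot> g"
    by (auto simp: is_coequalizer_def hom_def)
  have k: "k \<in> Ar C" "Dom C k = Cod C m" "Cod C k = Cod C e"
    using assms by (auto simp: hom_def)
  have "is_coequalizer C f g (m \<cdot> e)"
    unfolding is_coequalizer_def
  proof (intro conjI ballI impI)
    fix h assume h: "h \<in> Ar C" "Dom C h = Cod C f \<and> h \<cdot> f = h \<cdot> g"
    then obtain j where j: "j \<in> hom C (Cod C e) (Cod C h)" "j \<cdot> e = h"
      using coequalizer_universal[OF fg, of h] by auto
    then have j': "j \<in> Ar C" "Dom C j = Cod C e" "Cod C j = Cod C h"
      by (auto simp: hom_def)
    show "\<exists>!j. j \<in> hom C (Cod C (m \<cdot> e)) (Cod C h) \<and> j \<cdot> m \<cdot> e = h"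
    proof (intro ex1I[of _ "j \<cdot> k"] conjI)
      have "(j \<cdot> k) \<cdot> m \<cdot> e = j \<cdot> (k \<cdot> m) \<cdot> e"
        using assms(2,3) j' k ar by (simp del: assms(6))
      then show "(j \<cdot> k) \<cdot> m \<cdot> e = h"
        using assms(3,6) ar j by simp
    next
      fix i assume "i \<in> hom C (Cod C (m \<cdot> e)) (Cod C h) \<and> i \<cdot> m \<cdot> e = h"
      then have i: "i \<in> Ar C" "Dom C i = Cod C m" "i \<cdot> m \<cdot> e = h"
        using assms(2,3) ar by (auto simp: hom_def)
      then have "i \<cdot> m = j"
        using regular_epi_cancel[OF assms(1), of "i \<cdot> m" j] j j' assms(2,3) ar by simp
      then have "j \<cdot> k = i \<cdot> (m \<cdot> k)"
        using i assms(2,3) k by auto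
      then show "i = j \<cdot> k"
        using assms(5) i by simp
    qed (use j' k assms ar in \<open>simp add: hom_def\<close>)
  qed (use assms(2,3) ar in \<open>simp_all add: hom_def\<close>)
  then show ?thesis
    by (auto simp: regular_epi_def)
qed

lemma regular_epi_Id:
  assumes "A \<in> Ob C"
  shows "regular_epi C (Id C A)"
proof -
  have "is_coequalizer C (Id C A) (Id C A) (Id C A)"
    unfolding is_coequalizer_def
  proof (intro conjI ballI impI)
    fix h assume "h \<in> Ar C" "Dom C h = Cod C (Id C A) \<and> h \<cdot> Id C A = h \<cdot> Id C A"
    then show "\<exists>!k. k \<in> hom C (Cod C (Id C A)) (Cod C h) \<and> k \<cdot> Id C A = h"
      using assms by (intro ex1I[of _ h]) (auto simp: hom_def)
  qed (use assms in \<open>simp_all add: hom_def\<close>)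
  then show ?thesis
    by (auto simp: regular_epi_def)
qed

text \<open>Orthogonality to monomorphisms is inherited by composites, and in the image factorization of an
  arrow with this property the monic part is invertible.\<close>

lemma regular_epi_Comp:
  assumes "regular_epi C e1" "regular_epi C e2" "Cod C e1 = Dom C e2"
  shows "regular_epi C (e2 \<cdot> e1)"
proof -
  have ar: "e1 \<in> Ar C" "e2 \<in> Ar C"
    using assms regular_epi_Ar by auto
  then obtain m e where me: "monic C m" "regular_epi C e" "Cod C e = Dom C m" "m \<cdot> e = e2 \<cdot> e1"
    using image_factorization[of "e2 \<cdot> e1"] assms(3) by auto
  have ar': "m \<in> Ar C" "e \<in> Ar C"
    using me monic_Ar regular_epi_Ar by auto
  have dc: "Dom C e = Dom C e1" "Cod C m = Cod C e2"
    using arg_cong[OF me(4), of "Dom C"] arg_cong[OF me(4), of "Cod C"] ar ar' me(3) assms(3) by simp_all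
  obtain d where d: "d \<in> hom C (Dom C e2) (Dom C m)" "m \<cdot> d = e2"
    using regular_epi_orthogonal[OF assms(1) me(1), of e e2] me ar ar' dc assms(3)
    by (auto simp: hom_def)
  obtain k where k: "k \<in> hom C (Cod C e2) (Dom C m)" "m \<cdot> k = Id C (Cod C e2)"
    using regular_epi_orthogonal[OF assms(2) me(1), of d "Id C (Cod C e2)"] d ar dc
    by (auto simp: hom_def)
  have "m \<cdot> (k \<cdot> m) = m"
    by (subst assoc[symmetric]) (use k ar' dc in \<open>simp_all add: hom_def\<close>)
  then have "k \<cdot> m = Id C (Dom C m)"
    using monic_cancel[OF me(1), of "k \<cdot> m" "Id C (Dom C m)"] k ar' dc by (simp add: hom_def)
  then show ?thesis
    using regular_epi_Comp_iso[OF me(2) ar'(1), of k] me(3,4) k dc by simp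
qed

section \<open>Generalised elements of subobjects\<close>

lemma pullback_square:
  assumes "is_pullback C f g p q"
  shows "p \<in> Ar C" "q \<in> Ar C" "Dom C q = Dom C p" "Cod C p = Dom C f" "Cod C q = Dom C g" "f \<cdot> p = g \<cdot> q"
  using assms unfolding is_pullback_def hom_def by simp_all

text \<open>The regular epimorphisms onto \<open>X\<close> serve as covers in the Kripke--Joyal sense: by the next three
  lemmas they contain identities and are closed under composition and pullback.\<close>

definition cover :: "'m \<Rightarrow> 'o \<Rightarrow> 'o \<Rightarrow> bool" where
  "cover e Y X \<longleftrightarrow> regular_epi C e \<and> e \<in> hom C Y X"

lemma cover_Id: "X \<in> Ob C \<Longrightarrow> cover (Id C X) X X"
  by (simp add: cover_def regular_epi_Id hom_def)

lemma cover_Comp: "cover e Y X \<Longrightarrow> cover e' Z Y \<Longrightarrow> cover (e \<cdot> e') Z X"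
  using regular_epi_Comp[of e' e] by (auto simp: cover_def hom_def)

lemma cover_pullback:
  assumes "cover e Y X" "f \<in> hom C Z X"
  obtains W e' f' where "cover e' W Z" "f' \<in> hom C W Y" "e \<cdot> f' = f \<cdot> e'"
proof -
  obtain e' f' where "regular_epi C e'" "Cod C e' = Dom C f" "f' \<in> hom C (Dom C e') (Dom C e)" "e \<cdot> f' = f \<cdot> e'"
    using regular_epi_pullback[of e f] assms by (auto simp: cover_def hom_def)
  then show ?thesis
    using assms regular_epi_Ar[of e'] by (intro that[of e' "Dom C e'" f']) (auto simp: cover_def hom_def)
qed

lemma cover_cancel:
  assumes "cover e Y X" "h \<in> hom C X A" "k \<in> hom C X B" "h \<cdot> e = k \<cdot> e"
  shows "h = k"
  using regular_epi_cancel[of e h k] assms by (simp add: cover_def hom_def)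

text \<open>Membership of the generalised element \<open>x\<close> in the subobject represented by \<open>m\<close>.\<close>

definition factors :: "'m \<Rightarrow> 'm \<Rightarrow> bool" where
  "factors m x \<longleftrightarrow> (\<exists>h \<in> hom C (Dom C x) (Dom C m). m \<cdot> h = x)"

lemma factorsI: "h \<in> hom C (Dom C x) (Dom C m) \<Longrightarrow> m \<cdot> h = x \<Longrightarrow> factors m x"
  by (auto simp: factors_def)

lemma factorsE:
  assumes "factors m x"
  obtains h where "h \<in> Ar C" "Dom C h = Dom C x" "Cod C h = Dom C m" "m \<cdot> h = x"
  using assms by (auto simp: factors_def hom_def)

lemma factors_refl: "m \<in> Ar C \<Longrightarrow> factors m m"
  by (rule factorsI[of "Id C (Dom C m)"]) (simp_all add: hom_def)

lemma factors_trans: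
  assumes "m \<in> Ar C" "factors m n" "factors n x"
  shows "factors m x"
proof -
  obtain k where k: "k \<in> Ar C" "Dom C k = Dom C n" "Cod C k = Dom C m" "m \<cdot> k = n"
    using assms(2) by (rule factorsE)
  obtain h where h: "h \<in> Ar C" "Dom C h = Dom C x" "Cod C h = Dom C n" "n \<cdot> h = x"
    using assms(3) by (rule factorsE)
  show ?thesis
    by (rule factorsI[of "k \<cdot> h"], use k h assms(1) in \<open>simp add: hom_def\<close>)
      (subst assoc[symmetric], use k h assms(1) in simp_all)
qed

lemma factors_Comp:
  assumes "m \<in> Ar C" "factors m x" "e \<in> Ar C" "Cod C e = Dom C x"
  shows "factors m (x \<cdot> e)"
proof -
  obtain h where h: "h \<in> Ar C" "Dom C h = Dom C x" "Cod C h = Dom C m" "x = m \<cdot> h"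
    using assms(2) by (metis factorsE)
  then show ?thesis
    using assms by (intro factorsI[of "h \<cdot> e"]) (simp_all add: hom_def)
qed

lemma factors_local:
  assumes "monic C m" "cover e Y X" "x \<in> hom C X (Cod C m)" "factors m (x \<cdot> e)"
  shows "factors m x"
proof -
  have e: "regular_epi C e" "e \<in> Ar C" "Cod C e = X" and x: "x \<in> Ar C" "Dom C x = X"
    using assms(2,3) by (auto simp: cover_def hom_def)
  obtain h where h: "h \<in> Ar C" "Dom C h = Dom C (x \<cdot> e)" "Cod C h = Dom C m" "m \<cdot> h = x \<cdot> e"
    using assms(4) by (rule factorsE)
  then show ?thesis
    using regular_epi_orthogonal[OF e(1) assms(1), of h x] assms(3) e x
    by (auto simp: hom_def factors_def)
qed

lemma subobj_iff: "n \<in> subobj C m \<longleftrightarrow> monic C n \<and> Cod C n = Cod C m \<and> factors m n \<and> factors n m"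
  by (simp add: subobj_def factors_def)

lemma subobj_refl: "monic C m \<Longrightarrow> m \<in> subobj C m"
  by (simp add: subobj_iff factors_refl monic_Ar)

lemma subobj_factors:
  assumes "monic C m" "n \<in> subobj C m"
  shows "factors n x \<longleftrightarrow> factors m x"
  using assms factors_trans[of n m x] factors_trans[of m n x] monic_Ar by (auto simp: subobj_iff)

lemma subobj_member_eq:
  assumes "monic C m" "n \<in> subobj C m"
  shows "subobj C n = subobj C m"
proof -
  have n: "monic C n" "Cod C n = Cod C m" "factors m n" "factors n m"
    using assms(2) by (auto simp: subobj_iff)
  have "k \<in> subobj C n \<longleftrightarrow> k \<in> subobj C m" for k
    unfolding subobj_iff
    using factors_trans[of m n k] factors_trans[of n m k] factors_trans[of k n m] factors_trans[of k m n]
      n assms(1) monic_Ar by auto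
  then show ?thesis by blast
qed

text \<open>It suffices to test the universal elements, namely the two representing monomorphisms themselves.\<close>

lemma subobj_eqI:
  assumes "monic C m" "monic C n" "Cod C m = Prd C A B" "Cod C n = Prd C A B" "A \<in> Ob C" "B \<in> Ob C"
    and eq: "\<And>X a b. a \<in> hom C X A \<Longrightarrow> b \<in> hom C X B \<Longrightarrow> factors m \<langle>a, b\<rangle> \<longleftrightarrow> factors n \<langle>a, b\<rangle>"
  shows "subobj C m = subobj C n"
proof -
  have eq': "factors m x \<longleftrightarrow> factors n x" if "x \<in> Ar C" "Cod C x = Prd C A B" for x
    using eq[of "Pr1 C A B \<cdot> x" "Dom C x" "Pr2 C A B \<cdot> x"] that assms(5,6) by (simp add: hom_def)
  then have mn: "factors m n" "factors n m"
    using assms(1-4) factors_refl[of m] factors_refl[of n] monic_Ar by auto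
  then have "n \<in> subobj C m"
    using assms(2-4) by (simp add: subobj_iff)
  then show ?thesis
    using subobj_member_eq[OF assms(1)] by simp
qed

section \<open>Relations and their generalised elements\<close>

text \<open>Any representative of the subobject may be used as a witness; by \<open>sat_subobj\<close> the choice does not
  matter.\<close>

definition sat :: "('o, 'm) rel_ar \<Rightarrow> 'o \<Rightarrow> 'm \<Rightarrow> 'm \<Rightarrow> bool" where
  "sat R X a b \<longleftrightarrow> a \<in> hom C X (fst R) \<and> b \<in> hom C X (snd (snd R)) \<and>
     (\<exists>r \<in> fst (snd R). factors r \<langle>a, b\<rangle>)"

lemma sat_subobj:
  assumes "monic C r"
  shows "sat (A, subobj C r, B) X a b \<longleftrightarrow> a \<in> hom C X A \<and> b \<in> hom C X B \<and> factors r \<langle>a, b\<rangle>"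
  using subobj_factors[OF assms] subobj_refl[OF assms] unfolding sat_def fst_conv snd_conv by blast

lemma Rel_simps [simp]:
  "Ob (Rel C) = Ob C" "Dom (Rel C) (A, V, B) = A" "Cod (Rel C) (A, V, B) = B"
  "Id (Rel C) A = rel_graph C (Id C A)" "S \<cdot>\<^bsub>Rel C\<^esub> R = rel_comp C S R"
  "A \<boxtimes>\<^bsub>Rel C\<^esub> B = Prd C A B" "R \<otimes>\<^bsub>Rel C\<^esub> S = rel_tensor C R S" "\<one>\<^bsub>Rel C\<^esub> = One C"
  "compact_dagger.assoc (Rel C) A B E = rel_graph C (prod_assoc C A B E)"
  "lunit (Rel C) A = rel_graph C (Pr2 C (One C) A)"
  "runit (Rel C) A = rel_graph C (Pr1 C A (One C))"
  "braid (Rel C) A B = rel_graph C \<langle>Pr2 C A B, Pr1 C A B\<rangle>"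
  "R\<dagger>\<^bsub>Rel C\<^esub> = rel_dagger C R" "dual (Rel C) A = A"
  by (simp_all add: Rel_def)

lemma relI:
  assumes "monic C r" "Cod C r = Prd C A B" "A \<in> Ob C" "B \<in> Ob C"
  shows "(A, subobj C r, B) \<in> hom (Rel C) A B"
  using assms by (auto simp: hom_def Rel_def subobjects_def)

lemma relE:
  assumes "R \<in> hom (Rel C) A B"
  obtains r where "R = (A, subobj C r, B)" "monic C r" "Cod C r = Prd C A B" "A \<in> Ob C" "B \<in> Ob C"
  using assms by (auto simp: hom_def Rel_def subobjects_def)

lemma rel_Ob: "R \<in> hom (Rel C) A B \<Longrightarrow> A \<in> Ob C \<and> B \<in> Ob C"
  by (erule relE) simp

lemma sat_hom: "R \<in> hom (Rel C) A B \<Longrightarrow> sat R X a b \<Longrightarrow> a \<in> hom C X A \<and> b \<in> hom C X B"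
  by (erule relE) (simp add: sat_subobj)

lemma sat_restrict:
  assumes "R \<in> hom (Rel C) A B" "sat R X a b" "e \<in> hom C Y X"
  shows "sat R Y (a \<cdot> e) (b \<cdot> e)"
proof -
  obtain r where r: "R = (A, subobj C r, B)" "monic C r" "Cod C r = Prd C A B" "A \<in> Ob C" "B \<in> Ob C"
    using assms(1) by (rule relE)
  show ?thesis
    using assms(2,3) r factors_Comp[of r "\<langle>a, b\<rangle>" e] monic_Ar[of r]
    by (simp add: sat_subobj hom_def)
qed

lemma sat_local:
  assumes "R \<in> hom (Rel C) A B" "cover e Y X" "a \<in> hom C X A" "b \<in> hom C X B" "sat R Y (a \<cdot> e) (b \<cdot> e)"
  shows "sat R X a b"
proof -
  obtain r where r: "R = (A, subobj C r, B)" "monic C r" "Cod C r = Prd C A B" "A \<in> Ob C" "B \<in> Ob C"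
    using assms(1) by (rule relE)
  show ?thesis
    using assms(2-5) r factors_local[of r e Y X "\<langle>a, b\<rangle>"]
    by (simp add: sat_subobj hom_def cover_def)
qed

lemma rel_eqI:
  assumes "R \<in> hom (Rel C) A B" "S \<in> hom (Rel C) A B"
    and eq: "\<And>X a b. a \<in> hom C X A \<Longrightarrow> b \<in> hom C X B \<Longrightarrow> sat R X a b \<longleftrightarrow> sat S X a b"
  shows "R = S"
proof -
  obtain r where r: "R = (A, subobj C r, B)" "monic C r" "Cod C r = Prd C A B" "A \<in> Ob C" "B \<in> Ob C"
    using assms(1) by (rule relE)
  obtain s where s: "S = (A, subobj C s, B)" "monic C s" "Cod C s = Prd C A B"
    using assms(2) by (rule relE)
  have "subobj C r = subobj C s"
    by (rule subobj_eqI[OF r(2) s(2) r(3) s(3) r(4,5)])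
      (use eq r(1,2) s(1,2) in \<open>simp add: sat_subobj\<close>)
  then show ?thesis
    using r s by simp
qed

section \<open>Composition of relations\<close>

text \<open>The relation presented by one choice of representatives, pullback and image. An element of the image
  lifts to the pullback only after pulling back the regular epimorphism onto the image, hence the cover
  on the right hand side; conversely, membership in the image may be checked on that cover.\<close>

lemma image_rel_iff:
  assumes R: "R = (A, subobj C r, B)" "monic C r" "Cod C r = Prd C A B" "A \<in> Ob C" "B \<in> Ob C"
    and S: "S = (B, subobj C s, D)" "monic C s" "Cod C s = Prd C B D" "D \<in> Ob C"
    and pq: "is_pullback C (Pr2 C A B \<cdot> r) (Pr1 C B D \<cdot> s) p q"
    and m: "m \<in> image_subobj C \<langle>Pr1 C A B \<cdot> r \<cdot> p, Pr2 C B D \<cdot> s \<cdot> q\<rangle>"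
    and ac: "a \<in> hom C X A" "c \<in> hom C X D"
  shows "factors m \<langle>a, c\<rangle> \<longleftrightarrow> (\<exists>Y e b. cover e Y X \<and> sat R Y (a \<cdot> e) b \<and> sat S Y b (c \<cdot> e))"
    and "monic C m" "Cod C m = Prd C A D"
proof -
  have ar: "r \<in> Ar C" "s \<in> Ar C" "a \<in> Ar C" "c \<in> Ar C" "Dom C a = X" "Dom C c = X" "Cod C a = A" "Cod C c = D"
    using R S ac monic_Ar by (auto simp: hom_def)
  have pq': "p \<in> Ar C" "q \<in> Ar C" "Dom C q = Dom C p" "Cod C p = Dom C r" "Cod C q = Dom C s"
      "Pr2 C A B \<cdot> r \<cdot> p = Pr1 C B D \<cdot> s \<cdot> q"
    using pullback_square[OF pq] ar R S by simp_all
  let ?f = "\<langle>Pr1 C A B \<cdot> r \<cdot> p, Pr2 C B D \<cdot> s \<cdot> q\<rangle>"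
  obtain e0 where e0: "regular_epi C e0" "Cod C e0 = Dom C m" "m \<cdot> e0 = ?f" and mono: "monic C m"
    using m by (auto simp: image_subobj_def)
  show "monic C m" by fact
  have m': "m \<in> Ar C" "e0 \<in> Ar C"
    using mono e0 monic_Ar regular_epi_Ar by auto
  have dc: "Dom C e0 = Dom C p" "Cod C m = Prd C A D"
    using arg_cong[OF e0(3), of "Dom C"] arg_cong[OF e0(3), of "Cod C"] e0(2) m' pq' ar R S by simp_all
  show "Cod C m = Prd C A D" by fact
  show "factors m \<langle>a, c\<rangle> \<longleftrightarrow> (\<exists>Y e b. cover e Y X \<and> sat R Y (a \<cdot> e) b \<and> sat S Y b (c \<cdot> e))" (is "_ \<longleftrightarrow> ?rhs")
  proof
    assume "factors m \<langle>a, c\<rangle>"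
    then obtain h where h: "h \<in> Ar C" "Dom C h = X" "Cod C h = Dom C m" "m \<cdot> h = \<langle>a, c\<rangle>"
      using ar by (metis Pair_simps(2) factorsE)
    obtain Y e y where e: "cover e Y X" "y \<in> hom C Y (Dom C e0)" "e0 \<cdot> y = h \<cdot> e"
      using cover_pullback[of e0 "Dom C e0" "Dom C m" h X] e0 m' h by (auto simp: cover_def hom_def)
    have e': "e \<in> Ar C" "Dom C e = Y" "Cod C e = X" "y \<in> Ar C" "Dom C y = Y" "Cod C y = Dom C p"
      using e dc by (auto simp: cover_def hom_def)
    have "\<langle>a \<cdot> e, c \<cdot> e\<rangle> = (m \<cdot> h) \<cdot> e"
      unfolding h(4) using ar e' by simp
    also have "\<dots> = m \<cdot> (e0 \<cdot> y)"
      unfolding e(3) using h(1-3) m' e' by simp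
    also have "\<dots> = ?f \<cdot> y"
      unfolding e0(3)[symmetric] using m' e' dc e0(2) by simp
    also have "\<dots> = \<langle>Pr1 C A B \<cdot> r \<cdot> p \<cdot> y, Pr2 C B D \<cdot> s \<cdot> q \<cdot> y\<rangle>"
      using pq'(1-5) e' ar R S by simp
    finally have ace: "a \<cdot> e = Pr1 C A B \<cdot> r \<cdot> p \<cdot> y" "c \<cdot> e = Pr2 C B D \<cdot> s \<cdot> q \<cdot> y"
      using pq'(1-5) e' ar R S by simp_all
    define b where "b = Pr2 C A B \<cdot> r \<cdot> p \<cdot> y"
    have b2: "b = Pr1 C B D \<cdot> s \<cdot> q \<cdot> y"
      using arg_cong[OF pq'(6), of "\<lambda>t. t \<cdot> y"] pq'(1-5) e' ar R S by (simp add: b_def)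
    have "sat R Y (a \<cdot> e) b"
      unfolding R(1) sat_subobj[OF R(2)] ace(1) b_def
      using pq'(1-5) e' ar R S by (auto intro!: factorsI[of "p \<cdot> y"] simp: hom_def)
    moreover have "sat S Y b (c \<cdot> e)"
      unfolding S(1) sat_subobj[OF S(2)] ace(2) b2
      using pq'(1-5) e' ar R S by (auto intro!: factorsI[of "q \<cdot> y"] simp: hom_def)
    ultimately show ?rhs
      using e(1) by blast
  next
    assume ?rhs
    then obtain Y e b where e: "cover e Y X" "sat R Y (a \<cdot> e) b" "sat S Y b (c \<cdot> e)"
      by blast
    have e': "e \<in> Ar C" "Dom C e = Y" "Cod C e = X"
      using e by (auto simp: cover_def hom_def)
    have b: "b \<in> Ar C" "Dom C b = Y" "Cod C b = B" "factors r \<langle>a \<cdot> e, b\<rangle>" "factors s \<langle>b, c \<cdot> e\<rangle>"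
      using e R S by (auto simp: sat_subobj hom_def)
    obtain h where h: "h \<in> Ar C" "Dom C h = Y" "Cod C h = Dom C r" "r \<cdot> h = \<langle>a \<cdot> e, b\<rangle>"
      using b(1-3) ar e' by (auto intro: factorsE[OF b(4)])
    obtain k where k: "k \<in> Ar C" "Dom C k = Y" "Cod C k = Dom C s" "s \<cdot> k = \<langle>b, c \<cdot> e\<rangle>"
      using b(1-3) ar e' by (auto intro: factorsE[OF b(5)])
    obtain j where j: "j \<in> hom C Y (Dom C p)" "p \<cdot> j = h" "q \<cdot> j = k"
      using pullback_universal[OF pq, of h k] b(1-3) h k ar e' R S by auto
    have "m \<cdot> (e0 \<cdot> j) = ?f \<cdot> j"
      unfolding e0(3)[symmetric] using m' dc j(1) e0(2) by (simp add: hom_def)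
    also have "\<dots> = \<langle>Pr1 C A B \<cdot> r \<cdot> p \<cdot> j, Pr2 C B D \<cdot> s \<cdot> q \<cdot> j\<rangle>"
      using pq'(1-5) j(1) ar R S by (simp add: hom_def)
    also have "\<dots> = \<langle>a, c\<rangle> \<cdot> e"
      unfolding j(2,3) using h k b(1-3) ar e' R S by simp
    finally have "factors m (\<langle>a, c\<rangle> \<cdot> e)"
      by (intro factorsI[of "e0 \<cdot> j"]) (use m' dc j(1) e0(2) ar e' in \<open>auto simp: hom_def\<close>)
    then show "factors m \<langle>a, c\<rangle>"
      using factors_local[OF mono e(1), of "\<langle>a, c\<rangle>"] ar dc by (auto simp: hom_def)
  qed
qed

text \<open>By \<open>image_rel_iff\<close> all choices yield monomorphisms with the same elements, so the set that defines
  the composite is contained in a single subobject. It is the whole of it, since the regular epimorphism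
  onto an image can be composed with an isomorphism.\<close>

lemma Comp_rel:
  assumes RS: "R \<in> hom (Rel C) A B" "S \<in> hom (Rel C) B D"
  shows Comp_rel_hom: "rel_comp C S R \<in> hom (Rel C) A D"
    and sat_Comp: "a \<in> hom C X A \<Longrightarrow> c \<in> hom C X D \<Longrightarrow> sat (rel_comp C S R) X a c \<longleftrightarrow>
      (\<exists>Y e b. cover e Y X \<and> sat R Y (a \<cdot> e) b \<and> sat S Y b (c \<cdot> e))"
proof -
  obtain r where r: "R = (A, subobj C r, B)" "monic C r" "Cod C r = Prd C A B" "A \<in> Ob C" "B \<in> Ob C"
    using RS(1) by (rule relE)
  obtain s where s: "S = (B, subobj C s, D)" "monic C s" "Cod C s = Prd C B D" "D \<in> Ob C"
    using RS(2) by (rule relE)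
  let ?V = "{m. \<exists>r\<in>subobj C r. \<exists>s\<in>subobj C s. \<exists>p q. is_pullback C (Pr2 C A B \<cdot> r) (Pr1 C B D \<cdot> s) p q \<and>
    m \<in> image_subobj C \<langle>Pr1 C A B \<cdot> r \<cdot> p, Pr2 C B D \<cdot> s \<cdot> q\<rangle>}"
  have comp: "rel_comp C S R = (A, ?V, D)"
    by (simp add: rel_comp_def r(1) s(1))
  have same: "factors m \<langle>a, c\<rangle> \<longleftrightarrow> (\<exists>Y e b. cover e Y X \<and> sat R Y (a \<cdot> e) b \<and> sat S Y b (c \<cdot> e))"
      "monic C m" "Cod C m = Prd C A D"
    if m: "m \<in> ?V" "a \<in> hom C X A" "c \<in> hom C X D" for m X a c
  proof -
    from m(1) obtain r' s' p q where *: "r' \<in> subobj C r" "s' \<in> subobj C s"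
      "is_pullback C (Pr2 C A B \<cdot> r') (Pr1 C B D \<cdot> s') p q"
      "m \<in> image_subobj C \<langle>Pr1 C A B \<cdot> r' \<cdot> p, Pr2 C B D \<cdot> s' \<cdot> q\<rangle>"
      by blast
    have r': "R = (A, subobj C r', B)" "monic C r'" "Cod C r' = Prd C A B"
      using subobj_member_eq[OF r(2) *(1)] *(1) r(1,3) by (simp_all add: subobj_iff)
    have s': "S = (B, subobj C s', D)" "monic C s'" "Cod C s' = Prd C B D"
      using subobj_member_eq[OF s(2) *(2)] *(2) s(1,3) by (simp_all add: subobj_iff)
    note im = image_rel_iff[OF r' r(4,5) s' s(4) *(3,4) m(2,3)]
    show "factors m \<langle>a, c\<rangle> \<longleftrightarrow> (\<exists>Y e b. cover e Y X \<and> sat R Y (a \<cdot> e) b \<and> sat S Y b (c \<cdot> e))"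
      "monic C m" "Cod C m = Prd C A D"
      by (fact im)+
  qed
  have ar: "r \<in> Ar C" "s \<in> Ar C"
    using r s monic_Ar by auto
  obtain p q where pq: "is_pullback C (Pr2 C A B \<cdot> r) (Pr1 C B D \<cdot> s) p q"
    using pullback_exists[of "Pr2 C A B \<cdot> r" "Pr1 C B D \<cdot> s"] ar r s by auto
  let ?f = "\<langle>Pr1 C A B \<cdot> r \<cdot> p, Pr2 C B D \<cdot> s \<cdot> q\<rangle>"
  have "?f \<in> Ar C"
    using pullback_square[OF pq] ar r s by simp
  then obtain m0 e0 where m0: "monic C m0" "regular_epi C e0" "Cod C e0 = Dom C m0" "m0 \<cdot> e0 = ?f"
    using image_factorization by blast
  have e0: "e0 \<in> Ar C"
    using m0 regular_epi_Ar by blast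
  have V_I: "n \<in> ?V" if "n \<in> image_subobj C ?f" for n
    using that pq subobj_refl[OF r(2)] subobj_refl[OF s(2)] by blast
  have m0V: "m0 \<in> ?V"
    using m0 by (intro V_I) (auto simp: image_subobj_def)
  have PrId: "Pr1 C A D \<in> hom C (Prd C A D) A" "Pr2 C A D \<in> hom C (Prd C A D) D"
    using r s by (simp_all add: hom_def)
  note m0' = same(2,3)[OF m0V PrId]
  \<comment> \<open>the choices of \<open>r\<close>, \<open>s\<close>, \<open>p\<close>, \<open>q\<close> and of the image all lead to the same subobject\<close>
  have "?V = subobj C m0"
  proof (intro equalityI subsetI)
    fix m assume mV: "m \<in> ?V"
    note m' = same(2,3)[OF mV PrId]
    have "subobj C m = subobj C m0"
      using subobj_eqI[OF m'(1) m0'(1) m'(2) m0'(2) r(4) s(4)] same(1)[OF mV] same(1)[OF m0V] by blast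
    then show "m \<in> subobj C m0"
      using subobj_refl[OF m'(1)] by simp
  next
    fix n assume "n \<in> subobj C m0"
    then have n: "monic C n" "Cod C n = Cod C m0" "factors m0 n" "factors n m0"
      by (auto simp: subobj_iff)
    obtain h where h: "h \<in> Ar C" "Dom C h = Dom C n" "Cod C h = Dom C m0" "m0 \<cdot> h = n"
      using n(3) by (rule factorsE)
    obtain k where k: "k \<in> Ar C" "Dom C k = Dom C m0" "Cod C k = Dom C n" "n \<cdot> k = m0"
      using n(4) by (rule factorsE)
    have ar': "n \<in> Ar C" "m0 \<in> Ar C"
      using n m0 monic_Ar by auto
    have "n \<cdot> (k \<cdot> h) = (n \<cdot> k) \<cdot> h" "m0 \<cdot> (h \<cdot> k) = (m0 \<cdot> h) \<cdot> k"
      by (rule assoc[symmetric]; use h(1-3) k(1-3) ar' in simp)+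
    then have "k \<cdot> h = Id C (Dom C n)" "h \<cdot> k = Id C (Dom C m0)"
      unfolding h(4) k(4)
      using h(1-3) k(1-3) ar' by (auto intro: monic_cancel[OF n(1)] monic_cancel[OF m0(1)])
    then have "regular_epi C (k \<cdot> e0)"
      using regular_epi_Comp_iso[OF m0(2) k(1), of h] h(1-3) k(1-3) m0 by (simp add: hom_def)
    moreover have "n \<cdot> (k \<cdot> e0) = (n \<cdot> k) \<cdot> e0"
      by (rule assoc[symmetric]) (use k(1-3) ar' e0 m0(3) in simp_all)
    ultimately show "n \<in> ?V"
      using n(1) k m0 e0 by (intro V_I) (auto simp: image_subobj_def intro!: exI[of _ "k \<cdot> e0"])
  qed
  then have comp': "rel_comp C S R = (A, subobj C m0, D)"
    using comp by simp
  show "rel_comp C S R \<in> hom (Rel C) A D"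
    unfolding comp' by (rule relI) (use m0' r s in auto)
  show "sat (rel_comp C S R) X a c \<longleftrightarrow> (\<exists>Y e b. cover e Y X \<and> sat R Y (a \<cdot> e) b \<and> sat S Y b (c \<cdot> e))"
    if "a \<in> hom C X A" "c \<in> hom C X D"
    unfolding comp' sat_subobj[OF m0(1)] using same(1)[OF m0V that] that by simp
qed

section \<open>Converse and product of relations\<close>

lemma monicI:
  assumes "m \<in> Ar C"
    and "\<And>f g. f \<in> Ar C \<Longrightarrow> g \<in> Ar C \<Longrightarrow> Dom C g = Dom C f \<Longrightarrow> Cod C f = Dom C m \<Longrightarrow> Cod C g = Dom C m
      \<Longrightarrow> m \<cdot> f = m \<cdot> g \<Longrightarrow> f = g"
  shows "monic C m"
  unfolding monic_def using assms(1) by (auto simp: hom_def intro: assms(2))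

text \<open>Elements of a relation are determined by their two components.\<close>

lemma monic_Prd_cancel:
  assumes "monic C r" "Cod C r = Prd C A B" "A \<in> Ob C" "B \<in> Ob C"
    and "f \<in> Ar C" "g \<in> Ar C" "Dom C g = Dom C f" "Cod C f = Dom C r" "Cod C g = Dom C r"
    and "Pr1 C A B \<cdot> r \<cdot> f = Pr1 C A B \<cdot> r \<cdot> g" "Pr2 C A B \<cdot> r \<cdot> f = Pr2 C A B \<cdot> r \<cdot> g"
  shows "f = g"
proof (rule monic_cancel[OF assms(1)])
  show "r \<cdot> f = r \<cdot> g"
    by (rule Prd_ext[of _ "Dom C f" A B])
      (use assms(2-) monic_Ar[OF assms(1)] in \<open>simp_all add: hom_def\<close>)
qed (use assms(5-9) in simp_all)

lemma factors_Pair_iff: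
  assumes "r \<in> Ar C" "Cod C r = Prd C A B" "a \<in> hom C X A" "b \<in> hom C X B"
  shows "factors r \<langle>a, b\<rangle> \<longleftrightarrow>
    (\<exists>h \<in> hom C X (Dom C r). Pr1 C A B \<cdot> r \<cdot> h = a \<and> Pr2 C A B \<cdot> r \<cdot> h = b)"
proof -
  have ab: "a \<in> Ar C" "b \<in> Ar C" "Dom C a = X" "Dom C b = X" "Cod C a = A" "Cod C b = B" "A \<in> Ob C" "B \<in> Ob C"
    using assms(3,4) by (auto simp: hom_def)
  have eq: "r \<cdot> h = \<langle>a, b\<rangle> \<longleftrightarrow> Pr1 C A B \<cdot> r \<cdot> h = a \<and> Pr2 C A B \<cdot> r \<cdot> h = b"
    if h: "h \<in> hom C X (Dom C r)" for h
  proof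
    assume eq: "Pr1 C A B \<cdot> r \<cdot> h = a \<and> Pr2 C A B \<cdot> r \<cdot> h = b"
    have "\<langle>Pr1 C A B \<cdot> r \<cdot> h, Pr2 C A B \<cdot> r \<cdot> h\<rangle> = r \<cdot> h"
      by (rule Pair_eta) (use h assms(1,2) ab in \<open>simp_all add: hom_def\<close>)
    then show "r \<cdot> h = \<langle>a, b\<rangle>"
      by (simp only: eq)
  qed (use ab in simp)
  have "Dom C \<langle>a, b\<rangle> = X"
    using ab by simp
  then show ?thesis
    unfolding factors_def by (simp only:) (rule bex_cong[OF refl eq])
qed

text \<open>All representatives of \<open>R\<close> have the same elements, so exchanging their components gives equivalent
  monomorphisms, and the union over the representatives is a single subobject. The same applies to
  \<open>tensor_rel\<close> below.\<close>

lemma dagger_rel: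
  assumes "R \<in> hom (Rel C) A B"
  shows dagger_rel_hom: "rel_dagger C R \<in> hom (Rel C) B A"
    and sat_dagger: "sat (rel_dagger C R) X b a \<longleftrightarrow> sat R X a b"
proof -
  obtain r where r: "R = (A, subobj C r, B)" "monic C r" "Cod C r = Prd C A B" "A \<in> Ob C" "B \<in> Ob C"
    using assms by (rule relE)
  let ?s = "\<lambda>r. \<langle>Pr2 C A B \<cdot> r, Pr1 C A B \<cdot> r\<rangle>"
  have s: "monic C (?s r')" "Cod C (?s r') = Prd C B A"
    "\<And>X a b. a \<in> hom C X A \<Longrightarrow> b \<in> hom C X B \<Longrightarrow> factors (?s r') \<langle>b, a\<rangle> \<longleftrightarrow> factors r' \<langle>a, b\<rangle>"
    if r': "monic C r'" "Cod C r' = Prd C A B" for r'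
  proof -
    have ar: "r' \<in> Ar C" using r' monic_Ar by simp
    then show cod: "Cod C (?s r') = Prd C B A"
      using r' r(4,5) by simp
    show "monic C (?s r')"
    proof (rule monicI)
      fix f g
      assume fg: "f \<in> Ar C" "g \<in> Ar C" "Dom C g = Dom C f" "Cod C f = Dom C (?s r')" "Cod C g = Dom C (?s r')"
        "?s r' \<cdot> f = ?s r' \<cdot> g"
      then show "f = g"
        using ar r' r(4,5) by (intro monic_Prd_cancel[OF r' r(4,5), of f g]) simp_all
    qed (use ar r' r(4,5) in simp)
    fix X a b assume "a \<in> hom C X A" "b \<in> hom C X B"
    then show "factors (?s r') \<langle>b, a\<rangle> \<longleftrightarrow> factors r' \<langle>a, b\<rangle>"
      using factors_Pair_iff[of "?s r'" B A b X a] factors_Pair_iff[of r' A B a X b] cod ar r' r(4,5)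
      by (auto simp: hom_def)
  qed
  have "subobj C (?s r') = subobj C (?s r)" if "r' \<in> subobj C r" for r'
  proof -
    have r': "monic C r'" "Cod C r' = Prd C A B"
      using that r(3) by (auto simp: subobj_iff)
    show ?thesis
      by (rule subobj_eqI[OF s(1)[OF r'] s(1)[OF r(2,3)] s(2)[OF r'] s(2)[OF r(2,3)] r(5,4)])
        (simp add: s(3)[OF r'] s(3)[OF r(2,3)] subobj_factors[OF r(2) that])
  qed
  then have "{m. \<exists>r\<in>subobj C r. m \<in> subobj C (?s r)} = subobj C (?s r)"
    using subobj_refl[OF r(2)] by blast
  then have dag: "rel_dagger C R = (B, subobj C (?s r), A)"
    by (simp add: rel_dagger_def r(1))
  show "rel_dagger C R \<in> hom (Rel C) B A"
    unfolding dag by (rule relI) (use s[OF r(2,3)] r in auto)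
  show "sat (rel_dagger C R) X b a \<longleftrightarrow> sat R X a b"
    unfolding dag sat_subobj[OF s(1)[OF r(2,3)]] unfolding r(1) sat_subobj[OF r(2)]
    using s(3)[OF r(2,3), of a X b] by blast
qed

lemma tensor_rel:
  assumes "R \<in> hom (Rel C) A B" "S \<in> hom (Rel C) A' B'"
  shows tensor_rel_hom: "rel_tensor C R S \<in> hom (Rel C) (Prd C A A') (Prd C B B')"
    and sat_tensor: "a \<in> hom C X A \<Longrightarrow> a' \<in> hom C X A' \<Longrightarrow> b \<in> hom C X B \<Longrightarrow> b' \<in> hom C X B' \<Longrightarrow>
      sat (rel_tensor C R S) X \<langle>a, a'\<rangle> \<langle>b, b'\<rangle> \<longleftrightarrow> sat R X a b \<and> sat S X a' b'"
proof -
  obtain r where r: "R = (A, subobj C r, B)" "monic C r" "Cod C r = Prd C A B" "A \<in> Ob C" "B \<in> Ob C"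
    using assms(1) by (rule relE)
  obtain s where s: "S = (A', subobj C s, B')" "monic C s" "Cod C s = Prd C A' B'" "A' \<in> Ob C" "B' \<in> Ob C"
    using assms(2) by (rule relE)
  let ?t = "\<lambda>r s. \<langle>\<langle>Pr1 C A B \<cdot> r \<cdot> Pr1 C (Dom C r) (Dom C s), Pr1 C A' B' \<cdot> s \<cdot> Pr2 C (Dom C r) (Dom C s)\<rangle>,
    \<langle>Pr2 C A B \<cdot> r \<cdot> Pr1 C (Dom C r) (Dom C s), Pr2 C A' B' \<cdot> s \<cdot> Pr2 C (Dom C r) (Dom C s)\<rangle>\<rangle>"
  have t: "monic C (?t r' s')" "Cod C (?t r' s') = Prd C (Prd C A A') (Prd C B B')"
    "\<And>X a b a' b'. a \<in> hom C X A \<Longrightarrow> b \<in> hom C X B \<Longrightarrow> a' \<in> hom C X A' \<Longrightarrow> b' \<in> hom C X B' \<Longrightarrow>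
      factors (?t r' s') \<langle>\<langle>a, a'\<rangle>, \<langle>b, b'\<rangle>\<rangle> \<longleftrightarrow> factors r' \<langle>a, b\<rangle> \<and> factors s' \<langle>a', b'\<rangle>"
    if r': "monic C r'" "Cod C r' = Prd C A B" and s': "monic C s'" "Cod C s' = Prd C A' B'" for r' s'
  proof -
    have ar: "r' \<in> Ar C" "s' \<in> Ar C" using r' s' monic_Ar by auto
    then show cod: "Cod C (?t r' s') = Prd C (Prd C A A') (Prd C B B')"
      using r' s' r(4,5) s(4,5) by simp
    have tdom: "?t r' s' \<in> Ar C" "Dom C (?t r' s') = Prd C (Dom C r') (Dom C s')"
      using ar r' s' r(4,5) s(4,5) by simp_all
    show "monic C (?t r' s')"
    proof (rule monicI)
      fix f g
      assume fg: "f \<in> Ar C" "g \<in> Ar C" "Dom C g = Dom C f" "Cod C f = Dom C (?t r' s')" "Cod C g = Dom C (?t r' s')"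
        and eq: "?t r' s' \<cdot> f = ?t r' s' \<cdot> g"
      have fg': "Cod C f = Prd C (Dom C r') (Dom C s')" "Cod C g = Prd C (Dom C r') (Dom C s')"
        using fg tdom by auto
      let ?p = "Pr1 C (Dom C r') (Dom C s')" and ?q = "Pr2 C (Dom C r') (Dom C s')"
      have pq: "Pr1 C A B \<cdot> r' \<cdot> ?p \<cdot> f = Pr1 C A B \<cdot> r' \<cdot> ?p \<cdot> g"
        "Pr2 C A B \<cdot> r' \<cdot> ?p \<cdot> f = Pr2 C A B \<cdot> r' \<cdot> ?p \<cdot> g"
        "Pr1 C A' B' \<cdot> s' \<cdot> ?q \<cdot> f = Pr1 C A' B' \<cdot> s' \<cdot> ?q \<cdot> g"
        "Pr2 C A' B' \<cdot> s' \<cdot> ?q \<cdot> f = Pr2 C A' B' \<cdot> s' \<cdot> ?q \<cdot> g"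
        using eq ar r' s' r(4,5) s(4,5) fg(1-3) fg' by simp_all
      have "?p \<cdot> f = ?p \<cdot> g" "?q \<cdot> f = ?q \<cdot> g"
        by (rule monic_Prd_cancel[OF r' r(4,5)]; use pq ar fg(1-3) fg' in simp)
          (rule monic_Prd_cancel[OF s' s(4,5)]; use pq ar fg(1-3) fg' in simp)
      then show "f = g"
        using fg(1-3) fg' ar by (intro Prd_ext[of f "Dom C f" "Dom C r'" "Dom C s'"]) (simp_all add: hom_def)
    qed (fact tdom)
    fix X a b a' b'
    assume el: "a \<in> hom C X A" "b \<in> hom C X B" "a' \<in> hom C X A'" "b' \<in> hom C X B'"
    show "factors (?t r' s') \<langle>\<langle>a, a'\<rangle>, \<langle>b, b'\<rangle>\<rangle> \<longleftrightarrow> factors r' \<langle>a, b\<rangle> \<and> factors s' \<langle>a', b'\<rangle>"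
    proof
      assume "factors (?t r' s') \<langle>\<langle>a, a'\<rangle>, \<langle>b, b'\<rangle>\<rangle>"
      then obtain h where h: "h \<in> Ar C" "Dom C h = Dom C \<langle>\<langle>a, a'\<rangle>, \<langle>b, b'\<rangle>\<rangle>" "Cod C h = Dom C (?t r' s')"
          "?t r' s' \<cdot> h = \<langle>\<langle>a, a'\<rangle>, \<langle>b, b'\<rangle>\<rangle>"
        by (rule factorsE)
      have h': "Dom C h = X" "Cod C h = Prd C (Dom C r') (Dom C s')"
        using h(2,3) el tdom by (simp_all add: hom_def)
      show "factors r' \<langle>a, b\<rangle> \<and> factors s' \<langle>a', b'\<rangle>"
        unfolding factors_Pair_iff[OF ar(1) r'(2) el(1,2)] factors_Pair_iff[OF ar(2) s'(2) el(3,4)]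
        using h(1,4) h' el ar r' s' r(4,5) s(4,5)
        by (intro conjI bexI[of _ "Pr1 C (Dom C r') (Dom C s') \<cdot> h"] bexI[of _ "Pr2 C (Dom C r') (Dom C s') \<cdot> h"])
          (simp_all add: hom_def)
    next
      assume "factors r' \<langle>a, b\<rangle> \<and> factors s' \<langle>a', b'\<rangle>"
      then obtain h k where hk: "h \<in> hom C X (Dom C r')" "Pr1 C A B \<cdot> r' \<cdot> h = a" "Pr2 C A B \<cdot> r' \<cdot> h = b"
          "k \<in> hom C X (Dom C s')" "Pr1 C A' B' \<cdot> s' \<cdot> k = a'" "Pr2 C A' B' \<cdot> s' \<cdot> k = b'"
        unfolding factors_Pair_iff[OF ar(1) r'(2) el(1,2)] factors_Pair_iff[OF ar(2) s'(2) el(3,4)]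
        by blast
      have "?t r' s' \<cdot> \<langle>h, k\<rangle> = \<langle>\<langle>a, a'\<rangle>, \<langle>b, b'\<rangle>\<rangle>"
        using hk ar r' s' r(4,5) s(4,5) by (simp add: hom_def)
      then show "factors (?t r' s') \<langle>\<langle>a, a'\<rangle>, \<langle>b, b'\<rangle>\<rangle>"
        using hk(1,4) el tdom by (intro factorsI[of "\<langle>h, k\<rangle>"]) (simp_all add: hom_def)
    qed
  qed
  have "subobj C (?t r' s') = subobj C (?t r s)" if "r' \<in> subobj C r" "s' \<in> subobj C s" for r' s'
  proof -
    have r': "monic C r'" "Cod C r' = Prd C A B" and s': "monic C s'" "Cod C s' = Prd C A' B'"
      using that r(3) s(3) by (auto simp: subobj_iff)
    have ob: "Prd C A A' \<in> Ob C" "Prd C B B' \<in> Ob C"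
      using r s by simp_all
    show ?thesis
    proof (rule subobj_eqI[OF t(1)[OF r' s'] t(1)[OF r(2,3) s(2,3)] t(2)[OF r' s'] t(2)[OF r(2,3) s(2,3)] ob])
      fix X x y
      assume xy: "x \<in> hom C X (Prd C A A')" "y \<in> hom C X (Prd C B B')"
      obtain a a' where a: "a \<in> hom C X A" "a' \<in> hom C X A'" "x = \<langle>a, a'\<rangle>"
        using elem_Prd_cases[OF xy(1) r(4) s(4)] .
      obtain b b' where b: "b \<in> hom C X B" "b' \<in> hom C X B'" "y = \<langle>b, b'\<rangle>"
        using elem_Prd_cases[OF xy(2) r(5) s(5)] .
      show "factors (?t r' s') \<langle>x, y\<rangle> \<longleftrightarrow> factors (?t r s) \<langle>x, y\<rangle>"
        unfolding a(3) b(3) t(3)[OF r' s' a(1) b(1) a(2) b(2)] t(3)[OF r(2,3) s(2,3) a(1) b(1) a(2) b(2)]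
          subobj_factors[OF r(2) that(1)] subobj_factors[OF s(2) that(2)] ..
    qed
  qed
  then have "{m. \<exists>r\<in>subobj C r. \<exists>s\<in>subobj C s. m \<in> subobj C (?t r s)} = subobj C (?t r s)"
    using subobj_refl[OF r(2)] subobj_refl[OF s(2)] by blast
  then have ten: "rel_tensor C R S = (Prd C A A', subobj C (?t r s), Prd C B B')"
    by (simp add: rel_tensor_def r(1) s(1) Let_def)
  show "rel_tensor C R S \<in> hom (Rel C) (Prd C A A') (Prd C B B')"
    unfolding ten by (rule relI) (use t(1,2)[OF r(2,3) s(2,3)] r s in auto)
  show "sat (rel_tensor C R S) X \<langle>a, a'\<rangle> \<langle>b, b'\<rangle> \<longleftrightarrow> sat R X a b \<and> sat S X a' b'"
    if el: "a \<in> hom C X A" "a' \<in> hom C X A'" "b \<in> hom C X B" "b' \<in> hom C X B'"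
    unfolding ten sat_subobj[OF t(1)[OF r(2,3) s(2,3)]] unfolding r(1) s(1) sat_subobj[OF r(2)] sat_subobj[OF s(2)]
      t(3)[OF r(2,3) s(2,3) el(1,3,2,4)]
    using el by (auto simp: hom_def)
qed

section \<open>Graphs and cups\<close>

lemma graph_rel:
  assumes "f \<in> hom C A B"
  shows graph_hom: "rel_graph C f \<in> hom (Rel C) A B"
    and sat_graph: "sat (rel_graph C f) X a b \<longleftrightarrow> a \<in> hom C X A \<and> b = f \<cdot> a"
proof -
  have f: "f \<in> Ar C" "Dom C f = A" "Cod C f = B" "A \<in> Ob C" "B \<in> Ob C"
    using assms by (auto simp: hom_def)
  let ?r = "\<langle>Id C A, f\<rangle>"
  have r: "?r \<in> Ar C" "Dom C ?r = A" "Cod C ?r = Prd C A B"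
    using f by simp_all
  have mono: "monic C ?r"
  proof (rule monicI)
    fix g h
    assume "g \<in> Ar C" "h \<in> Ar C" "Dom C h = Dom C g" "Cod C g = Dom C ?r" "Cod C h = Dom C ?r" "?r \<cdot> g = ?r \<cdot> h"
    then show "g = h"
      using f r by simp
  qed (fact r)
  have graph: "rel_graph C f = (A, subobj C ?r, B)"
    by (simp add: rel_graph_def f)
  show "rel_graph C f \<in> hom (Rel C) A B"
    unfolding graph by (rule relI[OF mono r(3) f(4,5)])
  have "factors ?r \<langle>a, b\<rangle> \<longleftrightarrow> b = f \<cdot> a" if ab: "a \<in> hom C X A" "b \<in> hom C X B"
  proof -
    have "Pr1 C A B \<cdot> ?r \<cdot> h = h \<and> Pr2 C A B \<cdot> ?r \<cdot> h = f \<cdot> h" if "h \<in> hom C X A" for h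
      using that f by (simp add: hom_def)
    then show ?thesis
      unfolding factors_Pair_iff[OF r(1,3) ab] r(2) using ab by metis
  qed
  then show "sat (rel_graph C f) X a b \<longleftrightarrow> a \<in> hom C X A \<and> b = f \<cdot> a"
    unfolding graph sat_subobj[OF mono] using Comp_in_hom[OF _ assms] by blast
qed

lemma cup_rel:
  assumes "A \<in> Ob C"
  shows cup_hom: "cup (Rel C) A \<in> hom (Rel C) (One C) (Prd C A A)"
    and sat_cup: "u \<in> hom C X (One C) \<Longrightarrow> a \<in> hom C X A \<Longrightarrow> b \<in> hom C X A \<Longrightarrow>
      sat (cup (Rel C) A) X u \<langle>a, b\<rangle> \<longleftrightarrow> a = b"
proof -
  let ?r = "\<langle>Bang C A, \<langle>Id C A, Id C A\<rangle>\<rangle>"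
  have r: "?r \<in> Ar C" "Dom C ?r = A" "Cod C ?r = Prd C (One C) (Prd C A A)"
    using assms by simp_all
  have mono: "monic C ?r"
  proof (rule monicI)
    fix g h
    assume "g \<in> Ar C" "h \<in> Ar C" "Dom C h = Dom C g" "Cod C g = Dom C ?r" "Cod C h = Dom C ?r" "?r \<cdot> g = ?r \<cdot> h"
    then show "g = h"
      using assms r by simp
  qed (fact r)
  have cup: "cup (Rel C) A = (One C, subobj C ?r, Prd C A A)"
    by (simp add: Rel_def)
  show "cup (Rel C) A \<in> hom (Rel C) (One C) (Prd C A A)"
    unfolding cup by (rule relI[OF mono r(3)]) (use assms in simp_all)
  show "sat (cup (Rel C) A) X u \<langle>a, b\<rangle> \<longleftrightarrow> a = b"
    if el: "u \<in> hom C X (One C)" "a \<in> hom C X A" "b \<in> hom C X A"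
  proof -
    have ab: "\<langle>a, b\<rangle> \<in> hom C X (Prd C A A)" and u: "u = Bang C X"
      using el to_One_eq[of u] by (auto simp: hom_def)
    have "Pr1 C (One C) (Prd C A A) \<cdot> ?r \<cdot> h = u \<and> Pr2 C (One C) (Prd C A A) \<cdot> ?r \<cdot> h = \<langle>h, h\<rangle>"
      if "h \<in> hom C X A" for h
      using that assms u hom_Ob[OF that] by (simp add: hom_def)
    moreover have "\<langle>h, h\<rangle> = \<langle>a, b\<rangle> \<longleftrightarrow> h = a \<and> h = b" if "h \<in> hom C X A" for h
      using that el by (simp add: hom_def)
    ultimately show ?thesis
      unfolding cup sat_subobj[OF mono] factors_Pair_iff[OF r(1,3) el(1) ab] r(2) using el ab by metis
  qed
qed

text \<open>Composition with a function needs no cover, because the intermediate element is \<open>f a\<close>.\<close>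

lemma sat_Comp_graph:
  assumes "f \<in> hom C A B" "R \<in> hom (Rel C) B D" "a \<in> hom C X A" "c \<in> hom C X D"
  shows "sat (rel_comp C R (rel_graph C f)) X a c \<longleftrightarrow> sat R X (f \<cdot> a) c"
proof
  assume "sat (rel_comp C R (rel_graph C f)) X a c"
  then obtain Y e where e: "cover e Y X" "sat R Y (f \<cdot> a \<cdot> e) (c \<cdot> e)"
    using sat_Comp[OF graph_hom[OF assms(1)] assms(2-4)] sat_graph[OF assms(1)] by auto
  then have "sat R Y ((f \<cdot> a) \<cdot> e) (c \<cdot> e)"
    using assms(1,3) by (simp add: hom_def cover_def)
  then show "sat R X (f \<cdot> a) c"
    using sat_local[OF assms(2) e(1) Comp_in_hom[OF assms(3,1)] assms(4)] by simp
next
  assume "sat R X (f \<cdot> a) c"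
  moreover have "X \<in> Ob C" "c \<cdot> Id C X = c" "a \<cdot> Id C X = a"
    using assms(3,4) by (auto simp: hom_def)
  ultimately show "sat (rel_comp C R (rel_graph C f)) X a c"
    using sat_Comp[OF graph_hom[OF assms(1)] assms(2-4)] sat_graph[OF assms(1)] cover_Id[of X] assms(3) by metis
qed

text \<open>Inverse isomorphisms between \<open>A\<close> and \<open>B\<close>. All structural arrows of \<open>Rel C\<close> are graphs of
  isomorphisms, and the converse of such a graph is the graph of the inverse.\<close>

definition inverse_ar :: "'m \<Rightarrow> 'm \<Rightarrow> 'o \<Rightarrow> 'o \<Rightarrow> bool" where
  "inverse_ar f g A B \<longleftrightarrow> f \<in> hom C A B \<and> g \<in> hom C B A \<and> g \<cdot> f = Id C A \<and> f \<cdot> g = Id C B"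

lemma inverse_ar_eq_iff:
  assumes "inverse_ar f g A B" "a \<in> hom C X A" "b \<in> hom C X B"
  shows "b = f \<cdot> a \<longleftrightarrow> a = g \<cdot> b"
proof -
  have *: "f \<in> Ar C" "g \<in> Ar C" "Dom C f = A" "Cod C f = B" "Dom C g = B" "Cod C g = A"
      "a \<in> Ar C" "b \<in> Ar C" "Cod C a = A" "Cod C b = B" "g \<cdot> f = Id C A" "f \<cdot> g = Id C B"
    using assms by (auto simp: inverse_ar_def hom_def)
  then have "g \<cdot> (f \<cdot> a) = a" "f \<cdot> (g \<cdot> b) = b"
    by (simp_all flip: assoc)
  then show ?thesis by auto
qed

lemma sat_graph_Comp:
  assumes fg: "inverse_ar f g B D" and "R \<in> hom (Rel C) A B" "a \<in> hom C X A" "c \<in> hom C X D"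
  shows "sat (rel_comp C (rel_graph C f) R) X a c \<longleftrightarrow> sat R X a (g \<cdot> c)"
proof -
  have f: "f \<in> hom C B D" and g: "g \<in> hom C D B"
    using fg by (auto simp: inverse_ar_def)
  have gc: "g \<cdot> c \<in> hom C X B"
    using Comp_in_hom[OF assms(4) g] .
  show ?thesis
  proof
    assume "sat (rel_comp C (rel_graph C f) R) X a c"
    then obtain Y e b where e: "cover e Y X" "sat R Y (a \<cdot> e) b" "c \<cdot> e = f \<cdot> b" "b \<in> hom C Y B"
      using sat_Comp[OF assms(2) graph_hom[OF f] assms(3,4)] sat_graph[OF f] by auto
    have ce: "c \<cdot> e \<in> hom C Y D"
      using e(1) Comp_in_hom[OF _ assms(4)] by (simp add: cover_def)
    have "b = g \<cdot> (c \<cdot> e)"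
      using inverse_ar_eq_iff[OF fg e(4) ce] e(3) by blast
    also have "\<dots> = (g \<cdot> c) \<cdot> e"
      using g assms(4) e(1) by (simp add: hom_def cover_def)
    finally show "sat R X a (g \<cdot> c)"
      using sat_local[OF assms(2) e(1) assms(3) gc] e(2) by simp
  next
    assume "sat R X a (g \<cdot> c)"
    moreover have "X \<in> Ob C" "c \<cdot> Id C X = c" "a \<cdot> Id C X = a"
      using assms(3,4) by (auto simp: hom_def)
    moreover have "c = f \<cdot> (g \<cdot> c)"
      using inverse_ar_eq_iff[OF fg gc assms(4)] by simp
    ultimately show "sat (rel_comp C (rel_graph C f) R) X a c"
      using sat_Comp[OF assms(2) graph_hom[OF f] assms(3,4)] sat_graph[OF f] cover_Id[of X] gc by metis
  qed
qed

lemma dagger_graph: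
  assumes "inverse_ar f g A B"
  shows "rel_dagger C (rel_graph C f) = rel_graph C g"
proof -
  have f: "f \<in> hom C A B" and g: "g \<in> hom C B A"
    using assms by (auto simp: inverse_ar_def)
  show ?thesis
    by (rule rel_eqI[OF dagger_rel_hom[OF graph_hom[OF f]] graph_hom[OF g]])
      (simp add: sat_dagger[OF graph_hom[OF f]] sat_graph[OF f] sat_graph[OF g] inverse_ar_eq_iff[OF assms])
qed

lemma graph_Comp:
  assumes "f \<in> hom C A B" "g \<in> hom C B D"
  shows "rel_comp C (rel_graph C g) (rel_graph C f) = rel_graph C (g \<cdot> f)"
proof (rule rel_eqI)
  show "rel_comp C (rel_graph C g) (rel_graph C f) \<in> hom (Rel C) A D"
    using assms by (intro Comp_rel_hom graph_hom)
  show "rel_graph C (g \<cdot> f) \<in> hom (Rel C) A D"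
    using assms by (intro graph_hom Comp_in_hom)
  fix X a c assume "a \<in> hom C X A" "c \<in> hom C X D"
  then show "sat (rel_comp C (rel_graph C g) (rel_graph C f)) X a c \<longleftrightarrow> sat (rel_graph C (g \<cdot> f)) X a c"
    using assms sat_Comp_graph[OF assms(1) graph_hom[OF assms(2)]]
    by (simp add: sat_graph[OF assms(2)] sat_graph[OF Comp_in_hom[OF assms]]) (simp add: hom_def)
qed

lemma graph_tensor:
  assumes f: "f \<in> hom C A B" and g: "g \<in> hom C A' B'"
  shows "rel_tensor C (rel_graph C f) (rel_graph C g) = rel_graph C \<langle>f \<cdot> Pr1 C A A', g \<cdot> Pr2 C A A'\<rangle>"
proof (rule rel_eqI)
  have ob: "A \<in> Ob C" "B \<in> Ob C" "A' \<in> Ob C" "B' \<in> Ob C"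
    using f g hom_Ob by auto
  have fg: "\<langle>f \<cdot> Pr1 C A A', g \<cdot> Pr2 C A A'\<rangle> \<in> hom C (Prd C A A') (Prd C B B')"
    using f g ob by (auto simp: hom_def)
  show "rel_tensor C (rel_graph C f) (rel_graph C g) \<in> hom (Rel C) (Prd C A A') (Prd C B B')"
    using f g by (intro tensor_rel_hom graph_hom)
  show "rel_graph C \<langle>f \<cdot> Pr1 C A A', g \<cdot> Pr2 C A A'\<rangle> \<in> hom (Rel C) (Prd C A A') (Prd C B B')"
    using fg by (rule graph_hom)
  fix X x y assume xy: "x \<in> hom C X (Prd C A A')" "y \<in> hom C X (Prd C B B')"
  obtain a a' where a: "a \<in> hom C X A" "a' \<in> hom C X A'" "x = \<langle>a, a'\<rangle>"
    using elem_Prd_cases[OF xy(1) ob(1,3)] .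
  obtain b b' where b: "b \<in> hom C X B" "b' \<in> hom C X B'" "y = \<langle>b, b'\<rangle>"
    using elem_Prd_cases[OF xy(2) ob(2,4)] .
  have "\<langle>f \<cdot> Pr1 C A A', g \<cdot> Pr2 C A A'\<rangle> \<cdot> x = \<langle>f \<cdot> a, g \<cdot> a'\<rangle>"
    using a(1,2) f g unfolding a(3) by (auto simp: hom_def)
  moreover have "y = \<langle>f \<cdot> a, g \<cdot> a'\<rangle> \<longleftrightarrow> b = f \<cdot> a \<and> b' = g \<cdot> a'"
    using a(1,2) b(1,2) f g unfolding b(3) by (auto simp: hom_def)
  ultimately show "sat (rel_tensor C (rel_graph C f) (rel_graph C g)) X x y \<longleftrightarrow>
      sat (rel_graph C \<langle>f \<cdot> Pr1 C A A', g \<cdot> Pr2 C A A'\<rangle>) X x y"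
    unfolding sat_graph[OF fg] using sat_tensor[OF graph_hom[OF f] graph_hom[OF g] a(1,2) b(1,2)] a b xy
    by (simp add: sat_graph[OF f] sat_graph[OF g])
qed

definition prod_assoc_inv :: "'o \<Rightarrow> 'o \<Rightarrow> 'o \<Rightarrow> 'm" where
  "prod_assoc_inv A B E =
     \<langle>\<langle>Pr1 C A (Prd C B E), Pr1 C B E \<cdot> Pr2 C A (Prd C B E)\<rangle>, Pr2 C B E \<cdot> Pr2 C A (Prd C B E)\<rangle>"

lemma prod_assoc_inverse:
  assumes "A \<in> Ob C" "B \<in> Ob C" "E \<in> Ob C"
  shows "inverse_ar (prod_assoc C A B E) (prod_assoc_inv A B E) (Prd C (Prd C A B) E) (Prd C A (Prd C B E))"
  using assms by (simp add: inverse_ar_def prod_assoc_def prod_assoc_inv_def hom_def)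

lemma runit_inverse: "A \<in> Ob C \<Longrightarrow> inverse_ar (Pr1 C A (One C)) \<langle>Id C A, Bang C A\<rangle> (Prd C A (One C)) A"
  using to_One_eq[of "Pr2 C A (One C)"] Pair_Pr[of A "One C"] by (simp add: inverse_ar_def hom_def)

lemma lunit_inverse: "A \<in> Ob C \<Longrightarrow> inverse_ar (Pr2 C (One C) A) \<langle>Bang C A, Id C A\<rangle> (Prd C (One C) A) A"
  using to_One_eq[of "Pr1 C (One C) A"] Pair_Pr[of "One C" A] by (simp add: inverse_ar_def hom_def)

lemma prod_assoc_app:
  assumes "a \<in> hom C X A" "b \<in> hom C X B" "c \<in> hom C X E"
  shows "prod_assoc C A B E \<cdot> \<langle>\<langle>a, b\<rangle>, c\<rangle> = \<langle>a, \<langle>b, c\<rangle>\<rangle>"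
    and "prod_assoc_inv A B E \<cdot> \<langle>a, \<langle>b, c\<rangle>\<rangle> = \<langle>\<langle>a, b\<rangle>, c\<rangle>"
  using assms by (auto simp: prod_assoc_def prod_assoc_inv_def hom_def)

section \<open>Choi matrices and tensor products of structures\<close>

lemma sat_CompI:
  assumes "R \<in> hom (Rel C) A B" "S \<in> hom (Rel C) B D" "sat R X a b" "sat S X b c"
  shows "sat (rel_comp C S R) X a c"
proof -
  have ac: "a \<in> hom C X A" "c \<in> hom C X D"
    using sat_hom[OF assms(1,3)] sat_hom[OF assms(2,4)] by auto
  then have "X \<in> Ob C" "a \<cdot> Id C X = a" "c \<cdot> Id C X = c"
    by (auto simp: hom_def)
  then show ?thesis
    using sat_Comp[OF assms(1,2) ac] cover_Id[of X] assms(3,4) by metis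
qed

lemma sat_CompE:
  assumes "sat (rel_comp C S R) X a c" "R \<in> hom (Rel C) A B" "S \<in> hom (Rel C) B D"
  obtains Y e b where "cover e Y X" "e \<in> hom C Y X" "b \<in> hom C Y B" "sat R Y (a \<cdot> e) b" "sat S Y b (c \<cdot> e)"
proof -
  have ac: "a \<in> hom C X A" "c \<in> hom C X D"
    using sat_hom[OF Comp_rel_hom[OF assms(2,3)] assms(1)] by auto
  obtain Y e b where e: "cover e Y X" "sat R Y (a \<cdot> e) b" "sat S Y b (c \<cdot> e)"
    using sat_Comp[OF assms(2,3) ac] assms(1) by blast
  show ?thesis
    by (rule that[OF e(1) _ _ e(2,3)]) (use e(1) sat_hom[OF assms(2) e(2)] in \<open>auto simp: cover_def\<close>)
qed

lemma Id_rel_hom: "A \<in> Ob C \<Longrightarrow> rel_graph C (Id C A) \<in> hom (Rel C) A A"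
  using graph_hom[OF Id_in_hom] .

lemma sat_Id: "A \<in> Ob C \<Longrightarrow> sat (rel_graph C (Id C A)) X a b \<longleftrightarrow> a \<in> hom C X A \<and> b = a"
  using sat_graph[OF Id_in_hom, of A X a b] by (auto simp: hom_def)

lemma Pair_in_hom: "a \<in> hom C X A \<Longrightarrow> b \<in> hom C X B \<Longrightarrow> \<langle>a, b\<rangle> \<in> hom C X (Prd C A B)"
  by (simp add: hom_def)

lemma Pair_hom_Comp: "a \<in> hom C X A \<Longrightarrow> b \<in> hom C X B \<Longrightarrow> e \<in> hom C Y X \<Longrightarrow> \<langle>a, b\<rangle> \<cdot> e = \<langle>a \<cdot> e, b \<cdot> e\<rangle>"
  by (simp add: hom_def)

lemma Pair_hom_eq_iff: "a \<in> hom C X A \<Longrightarrow> b \<in> hom C X B \<Longrightarrow> a' \<in> hom C X A \<Longrightarrow> b' \<in> hom C X B \<Longrightarrow>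
    \<langle>a, b\<rangle> = \<langle>a', b'\<rangle> \<longleftrightarrow> a = a' \<and> b = b'"
  by (simp add: hom_def)

text \<open>If \<open>z\<close> witnesses that \<open>s\<close> and \<open>t\<close> are related, so that \<open>g s z\<close> and \<open>g t z\<close>, then the same \<open>z\<close> relates
  any two of \<open>s\<close>, \<open>t\<close>.\<close>

lemma positive_rel:
  assumes "g \<in> hom (Rel C) A Z" "sat (rel_comp C (rel_dagger C g) g) X s t"
  shows "sat (rel_comp C (rel_dagger C g) g) X s s"
    and "sat (rel_comp C (rel_dagger C g) g) X t t"
    and "sat (rel_comp C (rel_dagger C g) g) X t s"
proof -
  note g = assms(1) dagger_rel_hom[OF assms(1)]
  have st: "s \<in> hom C X A" "t \<in> hom C X A"
    using sat_hom[OF Comp_rel_hom[OF g] assms(2)] by auto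
  obtain Y e z where e: "cover e Y X" "sat g Y (s \<cdot> e) z" "sat (rel_dagger C g) Y z (t \<cdot> e)"
    using sat_CompE[OF assms(2) g] .
  then show "sat (rel_comp C (rel_dagger C g) g) X s s" "sat (rel_comp C (rel_dagger C g) g) X t t"
     "sat (rel_comp C (rel_dagger C g) g) X t s"
    unfolding sat_Comp[OF g st(1) st(1)] sat_Comp[OF g st(2) st(2)] sat_Comp[OF g st(2) st(1)]
      sat_dagger[OF assms(1)] by blast+
qed

text \<open>In regular logic the Choi matrix relates \<open>(x, w)\<close> to \<open>(x', w')\<close> when there are \<open>u\<close> and \<open>n\<close> with
  \<open>x' u = x\<close>, \<open>f u n\<close> and \<open>n w = w'\<close>. The introduction rule takes witnesses at the present stage;
  the destruction rule finds them on a composite of two covers, one for each composition.\<close>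

lemma choi_rel:
  fixes f \<mu>A \<mu>B :: "('o, 'm) rel_ar"
  assumes mA: "\<mu>A \<in> hom (Rel C) (Prd C A A) A" and mB: "\<mu>B \<in> hom (Rel C) (Prd C B B) B"
    and f: "f \<in> hom (Rel C) A B"
    and el: "x \<in> hom C X A" "x' \<in> hom C X A" "w \<in> hom C X B" "w' \<in> hom C X B"
  shows sat_choiI: "u \<in> hom C X A \<Longrightarrow> n \<in> hom C X B \<Longrightarrow> sat \<mu>A X \<langle>x', u\<rangle> x \<Longrightarrow> sat f X u n \<Longrightarrow>
      sat \<mu>B X \<langle>n, w\<rangle> w' \<Longrightarrow> sat (choi (Rel C) A \<mu>A B \<mu>B f) X \<langle>x, w\<rangle> \<langle>x', w'\<rangle>"
    and sat_choiD: "sat (choi (Rel C) A \<mu>A B \<mu>B f) X \<langle>x, w\<rangle> \<langle>x', w'\<rangle> \<Longrightarrow>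
      \<exists>Y e u n. cover e Y X \<and> e \<in> hom C Y X \<and> u \<in> hom C Y A \<and> n \<in> hom C Y B \<and>
        sat \<mu>A Y \<langle>x' \<cdot> e, u\<rangle> (x \<cdot> e) \<and> sat f Y u n \<and> sat \<mu>B Y \<langle>n, w \<cdot> e\<rangle> (w' \<cdot> e)"
proof -
  have ob: "A \<in> Ob C" "B \<in> Ob C"
    using rel_Ob[OF f] by auto
  note IA = Id_rel_hom[OF ob(1)] and IB = Id_rel_hom[OF ob(2)]
  let ?P = "rel_tensor C (rel_dagger C \<mu>A) (rel_graph C (Id C B))"
  let ?Q = "rel_comp C (rel_graph C (prod_assoc C A A B)) ?P"
  let ?V = "rel_tensor C (rel_graph C (Id C A)) (rel_tensor C f (rel_graph C (Id C B)))"
  let ?W = "rel_tensor C (rel_graph C (Id C A)) \<mu>B"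
  note P = tensor_rel_hom[OF dagger_rel_hom[OF mA] IB]
  note assoc = prod_assoc_inverse[OF ob(1,1,2)]
  have assoc_hom: "prod_assoc C A A B \<in> hom C (Prd C (Prd C A A) B) (Prd C A (Prd C A B))"
    using assoc by (simp add: inverse_ar_def)
  note Q = Comp_rel_hom[OF P graph_hom[OF assoc_hom]]
  note V = tensor_rel_hom[OF IA tensor_rel_hom[OF f IB]]
  note W = tensor_rel_hom[OF IA mB]
  have choi: "choi (Rel C) A \<mu>A B \<mu>B f = rel_comp C ?W (rel_comp C ?V ?Q)"
    by (simp add: choi_def)
  have sat_Q: "sat ?Q Y \<langle>a, b\<rangle> \<langle>p, \<langle>q, b'\<rangle>\<rangle> \<longleftrightarrow> sat \<mu>A Y \<langle>p, q\<rangle> a \<and> b' = b"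
    if "a \<in> hom C Y A" "b \<in> hom C Y B" "p \<in> hom C Y A" "q \<in> hom C Y A" "b' \<in> hom C Y B" for Y a b p q b'
    using that sat_graph_Comp[OF assoc P, of "\<langle>a, b\<rangle>" Y "\<langle>p, \<langle>q, b'\<rangle>\<rangle>"]
      sat_tensor[OF dagger_rel_hom[OF mA] IB, of a Y b "\<langle>p, q\<rangle>" b']
    by (simp add: prod_assoc_app(2) Pair_in_hom sat_dagger[OF mA] sat_Id ob)
  have sat_V: "sat ?V Y \<langle>p, \<langle>q, b\<rangle>\<rangle> \<langle>p', \<langle>n, b'\<rangle>\<rangle> \<longleftrightarrow> p' = p \<and> sat f Y q n \<and> b' = b"
    if "p \<in> hom C Y A" "q \<in> hom C Y A" "b \<in> hom C Y B" "p' \<in> hom C Y A" "n \<in> hom C Y B" "b' \<in> hom C Y B"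
    for Y p q b p' n b'
    using that sat_tensor[OF IA tensor_rel_hom[OF f IB], of p Y "\<langle>q, b\<rangle>" p' "\<langle>n, b'\<rangle>"]
      sat_tensor[OF f IB, of q Y b n b']
    by (simp add: Pair_in_hom sat_Id ob)
  have sat_W: "sat ?W Y \<langle>p, \<langle>n, b\<rangle>\<rangle> \<langle>p', b'\<rangle> \<longleftrightarrow> p' = p \<and> sat \<mu>B Y \<langle>n, b\<rangle> b'"
    if "p \<in> hom C Y A" "n \<in> hom C Y B" "b \<in> hom C Y B" "p' \<in> hom C Y A" "b' \<in> hom C Y B" for Y p n b p' b'
    using that sat_tensor[OF IA mB, of p Y "\<langle>n, b\<rangle>" p' b'] by (simp add: Pair_in_hom sat_Id ob)
  show "sat (choi (Rel C) A \<mu>A B \<mu>B f) X \<langle>x, w\<rangle> \<langle>x', w'\<rangle>"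
    if "u \<in> hom C X A" "n \<in> hom C X B" "sat \<mu>A X \<langle>x', u\<rangle> x" "sat f X u n" "sat \<mu>B X \<langle>n, w\<rangle> w'"
    unfolding choi
  proof (rule sat_CompI[OF Comp_rel_hom[OF Q V] W])
    show "sat (rel_comp C ?V ?Q) X \<langle>x, w\<rangle> \<langle>x', \<langle>n, w\<rangle>\<rangle>"
      by (rule sat_CompI[OF Q V, of _ _ "\<langle>x', \<langle>u, w\<rangle>\<rangle>"]) (use that el in \<open>simp_all add: sat_Q sat_V\<close>)
    show "sat ?W X \<langle>x', \<langle>n, w\<rangle>\<rangle> \<langle>x', w'\<rangle>"
      using that el by (simp add: sat_W)
  qed
  assume "sat (choi (Rel C) A \<mu>A B \<mu>B f) X \<langle>x, w\<rangle> \<langle>x', w'\<rangle>"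
  then have "sat (rel_comp C ?W (rel_comp C ?V ?Q)) X \<langle>x, w\<rangle> \<langle>x', w'\<rangle>"
    by (simp only: choi)
  then obtain Y e m where 1: "cover e Y X" "e \<in> hom C Y X" "m \<in> hom C Y (Prd C A (Prd C B B))"
      "sat (rel_comp C ?V ?Q) Y (\<langle>x, w\<rangle> \<cdot> e) m" "sat ?W Y m (\<langle>x', w'\<rangle> \<cdot> e)"
    by (rule sat_CompE[OF _ Comp_rel_hom[OF Q V] W])
  obtain Z d v where 2: "cover d Z Y" "d \<in> hom C Z Y" "v \<in> hom C Z (Prd C A (Prd C A B))"
      "sat ?Q Z ((\<langle>x, w\<rangle> \<cdot> e) \<cdot> d) v" "sat ?V Z v (m \<cdot> d)"
    using sat_CompE[OF 1(4) Q V] .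
  let ?e = "e \<cdot> d"
  have e: "?e \<in> hom C Z X" "cover ?e Z X"
    using Comp_in_hom[OF 2(2) 1(2)] cover_Comp[OF 1(1) 2(1)] by auto
  have md: "m \<cdot> d \<in> hom C Z (Prd C A (Prd C B B))"
    using Comp_in_hom[OF 2(2) 1(3)] .
  have elr: "x \<cdot> ?e \<in> hom C Z A" "x' \<cdot> ?e \<in> hom C Z A" "w \<cdot> ?e \<in> hom C Z B" "w' \<cdot> ?e \<in> hom C Z B"
    using Comp_in_hom[OF e(1)] el by auto
  have xw: "(\<langle>x, w\<rangle> \<cdot> e) \<cdot> d = \<langle>x \<cdot> ?e, w \<cdot> ?e\<rangle>" "(\<langle>x', w'\<rangle> \<cdot> e) \<cdot> d = \<langle>x' \<cdot> ?e, w' \<cdot> ?e\<rangle>"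
    using el 1(2) 2(2) by (simp_all add: hom_def)
  obtain p v' where v': "p \<in> hom C Z A" "v' \<in> hom C Z (Prd C A B)" "v = \<langle>p, v'\<rangle>"
    using elem_Prd_cases[OF 2(3)] ob by auto
  obtain u b where u: "u \<in> hom C Z A" "b \<in> hom C Z B" "v' = \<langle>u, b\<rangle>"
    using elem_Prd_cases[OF v'(2)] ob by auto
  obtain p' m' where m': "p' \<in> hom C Z A" "m' \<in> hom C Z (Prd C B B)" "m \<cdot> d = \<langle>p', m'\<rangle>"
    using elem_Prd_cases[OF md] ob by auto
  obtain n b' where n: "n \<in> hom C Z B" "b' \<in> hom C Z B" "m' = \<langle>n, b'\<rangle>"
    using elem_Prd_cases[OF m'(2)] ob by auto
  have "sat ?W Z (m \<cdot> d) ((\<langle>x', w'\<rangle> \<cdot> e) \<cdot> d)"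
    using sat_restrict[OF W 1(5) 2(2)] .
  then have "x' \<cdot> ?e = p'" "sat \<mu>B Z \<langle>n, b'\<rangle> (w' \<cdot> ?e)"
    unfolding m'(3) n(3) xw using sat_W[OF m'(1) n(1,2) elr(2,4)] by auto
  moreover have "p' = p" "sat f Z u n" "b' = b"
    using 2(5) unfolding m'(3) n(3) v'(3) u(3) using sat_V[OF v'(1) u(1,2) m'(1) n(1,2)] by auto
  moreover have "sat \<mu>A Z \<langle>p, u\<rangle> (x \<cdot> ?e)" "b = w \<cdot> ?e"
    using 2(4) unfolding xw v'(3) u(3) using sat_Q[OF elr(1,3) v'(1) u(1,2)] by auto
  ultimately show "\<exists>Y e u n. cover e Y X \<and> e \<in> hom C Y X \<and> u \<in> hom C Y A \<and> n \<in> hom C Y B \<and>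
        sat \<mu>A Y \<langle>x' \<cdot> e, u\<rangle> (x \<cdot> e) \<and> sat f Y u n \<and> sat \<mu>B Y \<langle>n, w \<cdot> e\<rangle> (w' \<cdot> e)"
    using e u n by (intro exI[of _ Z] exI[of _ ?e] exI[of _ u] exI[of _ n]) simp
qed

definition middle_swap :: "'o \<Rightarrow> 'o \<Rightarrow> 'o \<Rightarrow> 'o \<Rightarrow> 'm" where
  "middle_swap A B A' B' =
     (let p = Pr1 C (Prd C A B) (Prd C A' B'); q = Pr2 C (Prd C A B) (Prd C A' B') in
      \<langle>\<langle>Pr1 C A B \<cdot> p, Pr1 C A' B' \<cdot> q\<rangle>, \<langle>Pr2 C A B \<cdot> p, Pr2 C A' B' \<cdot> q\<rangle>\<rangle>)"

lemma interchange_graph: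
  assumes ob: "A \<in> Ob C" "B \<in> Ob C" "A' \<in> Ob C" "B' \<in> Ob C"
  shows "interchange (Rel C) A B A' B' = rel_graph C (middle_swap A B A' B')"
proof -
  let ?sw = "\<langle>Pr2 C B A', Pr1 C B A'\<rangle>"
  have h: "prod_assoc_inv B A' B' \<in> hom C (Prd C B (Prd C A' B')) (Prd C (Prd C B A') B')"
    "prod_assoc C A' B B' \<in> hom C (Prd C (Prd C A' B) B') (Prd C A' (Prd C B B'))"
    "prod_assoc_inv A A' (Prd C B B') \<in> hom C (Prd C A (Prd C A' (Prd C B B'))) (Prd C (Prd C A A') (Prd C B B'))"
    "prod_assoc C A B (Prd C A' B') \<in> hom C (Prd C (Prd C A B) (Prd C A' B')) (Prd C A (Prd C B (Prd C A' B')))"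
    "?sw \<in> hom C (Prd C B A') (Prd C A' B)"
    using prod_assoc_inverse[of B A' B'] prod_assoc_inverse[of A' B B'] prod_assoc_inverse[of A A' "Prd C B B'"]
      prod_assoc_inverse[of A B "Prd C A' B'"] ob by (simp_all add: inverse_ar_def) (simp add: hom_def)
  note Id = Id_in_hom[OF ob(1)] Id_in_hom[OF ob(4)]
  let ?t = "\<langle>?sw \<cdot> Pr1 C (Prd C B A') B', Id C B' \<cdot> Pr2 C (Prd C B A') B'\<rangle>"
  have t: "?t \<in> hom C (Prd C (Prd C B A') B') (Prd C (Prd C A' B) B')"
    using ob by (simp add: hom_def)
  note t' = Comp_in_hom[OF h(1) t]
  note t'' = Comp_in_hom[OF t' h(2)]
  let ?u = "\<langle>Id C A \<cdot> Pr1 C A (Prd C B (Prd C A' B')),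
    (prod_assoc C A' B B' \<cdot> ?t \<cdot> prod_assoc_inv B A' B') \<cdot> Pr2 C A (Prd C B (Prd C A' B'))\<rangle>"
  have u: "?u \<in> hom C (Prd C A (Prd C B (Prd C A' B'))) (Prd C A (Prd C A' (Prd C B B')))"
    using ob t'' by (simp add: hom_def)
  have "interchange (Rel C) A B A' B' = rel_graph C (prod_assoc_inv A A' (Prd C B B') \<cdot> ?u \<cdot> prod_assoc C A B (Prd C A' B'))"
    unfolding interchange_def Rel_simps
      dagger_graph[OF prod_assoc_inverse[OF ob(2,3,4)]]
      dagger_graph[OF prod_assoc_inverse[OF ob(1,3) Prd_simps(1)[OF ob(2,4)]]]
      graph_tensor[OF h(5) Id(2)] graph_Comp[OF h(1) t] graph_Comp[OF t' h(2)]
      graph_tensor[OF Id(1) t''] graph_Comp[OF h(4) u] graph_Comp[OF Comp_in_hom[OF h(4) u] h(3)] ..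
  also have "prod_assoc_inv A A' (Prd C B B') \<cdot> ?u \<cdot> prod_assoc C A B (Prd C A' B') = middle_swap A B A' B'"
    using ob by (simp add: prod_assoc_def prod_assoc_inv_def middle_swap_def Let_def)
  finally show ?thesis .
qed

lemma tensor_mult_rel:
  fixes \<mu>B \<mu>K :: "('o, 'm) rel_ar"
  assumes mB: "\<mu>B \<in> hom (Rel C) (Prd C B B) B" and mK: "\<mu>K \<in> hom (Rel C) (Prd C K K) K"
  shows tensor_mult_hom: "tensor_mult (Rel C) B \<mu>B K \<mu>K \<in> hom (Rel C) (Prd C (Prd C B K) (Prd C B K)) (Prd C B K)"
    and sat_tensor_mult: "b \<in> hom C X B \<Longrightarrow> k \<in> hom C X K \<Longrightarrow> b' \<in> hom C X B \<Longrightarrow> k' \<in> hom C X K \<Longrightarrow>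
      b'' \<in> hom C X B \<Longrightarrow> k'' \<in> hom C X K \<Longrightarrow>
      sat (tensor_mult (Rel C) B \<mu>B K \<mu>K) X \<langle>\<langle>b, k\<rangle>, \<langle>b', k'\<rangle>\<rangle> \<langle>b'', k''\<rangle> \<longleftrightarrow>
        sat \<mu>B X \<langle>b, b'\<rangle> b'' \<and> sat \<mu>K X \<langle>k, k'\<rangle> k''"
proof -
  have ob: "B \<in> Ob C" "K \<in> Ob C"
    using rel_Ob[OF mB] rel_Ob[OF mK] by auto
  have tm: "tensor_mult (Rel C) B \<mu>B K \<mu>K = rel_comp C (rel_tensor C \<mu>B \<mu>K) (rel_graph C (middle_swap B K B K))"
    by (simp add: tensor_mult_def interchange_graph ob)
  have ms: "middle_swap B K B K \<in> hom C (Prd C (Prd C B K) (Prd C B K)) (Prd C (Prd C B B) (Prd C K K))"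
    using ob by (simp add: hom_def middle_swap_def Let_def)
  show "tensor_mult (Rel C) B \<mu>B K \<mu>K \<in> hom (Rel C) (Prd C (Prd C B K) (Prd C B K)) (Prd C B K)"
    unfolding tm using Comp_rel_hom[OF graph_hom[OF ms] tensor_rel_hom[OF mB mK]] .
  assume el: "b \<in> hom C X B" "k \<in> hom C X K" "b' \<in> hom C X B" "k' \<in> hom C X K" "b'' \<in> hom C X B" "k'' \<in> hom C X K"
  have "middle_swap B K B K \<cdot> \<langle>\<langle>b, k\<rangle>, \<langle>b', k'\<rangle>\<rangle> = \<langle>\<langle>b, b'\<rangle>, \<langle>k, k'\<rangle>\<rangle>"
    using el ob by (simp add: hom_def middle_swap_def Let_def)
  then show "sat (tensor_mult (Rel C) B \<mu>B K \<mu>K) X \<langle>\<langle>b, k\<rangle>, \<langle>b', k'\<rangle>\<rangle> \<langle>b'', k''\<rangle> \<longleftrightarrow>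
        sat \<mu>B X \<langle>b, b'\<rangle> b'' \<and> sat \<mu>K X \<langle>k, k'\<rangle> k''"
    using sat_Comp_graph[OF ms tensor_rel_hom[OF mB mK], of "\<langle>\<langle>b, k\<rangle>, \<langle>b', k'\<rangle>\<rangle>" X "\<langle>b'', k''\<rangle>"]
      sat_tensor[OF mB mK, of "\<langle>b, b'\<rangle>" X "\<langle>k, k'\<rangle>" b'' k''] el
    by (simp add: tm Pair_in_hom)
qed

section \<open>The Mal'cev condition\<close>

lemma pullback_unique:
  assumes "is_pullback C f g p q" "h \<in> hom C X (Dom C p)" "k \<in> hom C X (Dom C p)"
    and "p \<cdot> h = p \<cdot> k" "q \<cdot> h = q \<cdot> k"
  shows "h = k"
proof -
  note sq = pullback_square[OF assms(1)]
  have ar: "f \<in> Ar C" "g \<in> Ar C" "Cod C f = Cod C g"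
    using assms(1) by (auto simp: is_pullback_def)
  have "f \<cdot> (p \<cdot> h) = (f \<cdot> p) \<cdot> h" "(g \<cdot> q) \<cdot> h = g \<cdot> (q \<cdot> h)"
    using assms(2) sq(1-5) ar by (simp_all add: hom_def)
  then have "f \<cdot> (p \<cdot> h) = g \<cdot> (q \<cdot> h)"
    by (simp only: sq(6))
  moreover have "p \<cdot> h \<in> hom C X (Dom C f)" "q \<cdot> h \<in> hom C X (Dom C g)"
    using assms(2) sq(1-5) by (simp_all add: hom_def)
  ultimately have "\<exists>!j. j \<in> hom C X (Dom C p) \<and> p \<cdot> j = p \<cdot> h \<and> q \<cdot> j = q \<cdot> h"
    using assms(1) unfolding is_pullback_def by blast
  then show ?thesis
    using assms(2-5) by metis
qed

text \<open>Read \<open>t\<close> as a partial exchange of components, with \<open>t (x, x) = x\<close>. The relation on the object \<open>R\<close>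
  underlying \<open>r\<close> that relates \<open>x\<close> to \<open>y\<close> when \<open>t (x, y)\<close> belongs to the subobject \<open>r\<close> is reflexive; it is
  represented by the pullback \<open>w\<close> of \<open>r\<close> along \<open>t\<close>. The Mal'cev condition makes it symmetric.\<close>

lemma malcev_swap:
  assumes malcev: "malcev_category C" and r: "monic C r"
    and t: "t \<in> hom C (Prd C (Dom C r) (Dom C r)) (Cod C r)" "t \<cdot> \<langle>Id C (Dom C r), Id C (Dom C r)\<rangle> = r"
    and xy: "x \<in> hom C X (Dom C r)" "y \<in> hom C X (Dom C r)" "factors r (t \<cdot> \<langle>x, y\<rangle>)"
  shows "factors r (t \<cdot> \<langle>y, x\<rangle>)"
proof -
  let ?R = "Dom C r"
  have ar: "r \<in> Ar C" "t \<in> Ar C" "Dom C t = Prd C ?R ?R" "Cod C t = Cod C r"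
    using r t(1) monic_Ar by (auto simp: hom_def)
  obtain w v where wv: "is_pullback C t r w v"
    using pullback_exists[of t r] ar by auto
  note sq = pullback_square[OF wv]
  have w: "w \<in> Ar C" "v \<in> Ar C" "Dom C v = Dom C w" "Cod C w = Prd C ?R ?R" "Cod C v = ?R"
    using sq ar by auto
  have mono: "monic C w"
  proof (rule monicI)
    fix f g
    assume fg: "f \<in> Ar C" "g \<in> Ar C" "Dom C g = Dom C f" "Cod C f = Dom C w" "Cod C g = Dom C w" "w \<cdot> f = w \<cdot> g"
    have "r \<cdot> (v \<cdot> f) = (t \<cdot> w) \<cdot> f" "(t \<cdot> w) \<cdot> g = r \<cdot> (v \<cdot> g)"
      unfolding sq(6) using fg(1-5) w ar by simp_all
    moreover have "(t \<cdot> w) \<cdot> f = (t \<cdot> w) \<cdot> g"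
      using fg w ar by simp
    ultimately have "v \<cdot> f = v \<cdot> g"
      using monic_cancel[OF r, of "v \<cdot> f" "v \<cdot> g"] fg(1-5) w by simp
    then show "f = g"
      using pullback_unique[OF wv, of f "Dom C f" g] fg by (simp add: hom_def)
  qed (fact w)
  have rel: "(a, b) \<in> elem_rel C ?R w Z \<longleftrightarrow> factors r (t \<cdot> \<langle>a, b\<rangle>)"
    if ab: "a \<in> hom C Z ?R" "b \<in> hom C Z ?R" for a b Z
  proof -
    have p: "\<langle>a, b\<rangle> \<in> Ar C" "Dom C \<langle>a, b\<rangle> = Z" "Cod C \<langle>a, b\<rangle> = Prd C ?R ?R"
      using ab by (auto simp: hom_def)
    have "(\<exists>h \<in> hom C Z (Dom C w). w \<cdot> h = \<langle>a, b\<rangle>) \<longleftrightarrow> factors r (t \<cdot> \<langle>a, b\<rangle>)"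
    proof
      assume "\<exists>h \<in> hom C Z (Dom C w). w \<cdot> h = \<langle>a, b\<rangle>"
      then obtain h where h: "h \<in> hom C Z (Dom C w)" "w \<cdot> h = \<langle>a, b\<rangle>" by blast
      have "t \<cdot> (w \<cdot> h) = (t \<cdot> w) \<cdot> h" "(r \<cdot> v) \<cdot> h = r \<cdot> (v \<cdot> h)"
        using h(1) w ar by (simp_all add: hom_def)
      then have "r \<cdot> (v \<cdot> h) = t \<cdot> \<langle>a, b\<rangle>"
        by (simp only: h(2) sq(6))
      then show "factors r (t \<cdot> \<langle>a, b\<rangle>)"
        using h(1) w ar p by (intro factorsI[of "v \<cdot> h"]) (simp_all add: hom_def)
    next
      assume "factors r (t \<cdot> \<langle>a, b\<rangle>)"
      then obtain k where k: "k \<in> Ar C" "Dom C k = Z" "Cod C k = ?R" "t \<cdot> \<langle>a, b\<rangle> = r \<cdot> k"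
        using p ar by (metis Comp_simps(2) factorsE)
      then show "\<exists>h \<in> hom C Z (Dom C w). w \<cdot> h = \<langle>a, b\<rangle>"
        using pullback_universal[OF wv p(1) k(1)] p ar by auto
    qed
    then show ?thesis
      using ab by (simp add: elem_rel_def)
  qed
  have "internal_reflexive C ?R w"
    unfolding internal_reflexive_def
  proof
    fix Z assume "Z \<in> Ob C"
    have "factors r (t \<cdot> \<langle>a, a\<rangle>)" if a: "a \<in> hom C Z ?R" for a
    proof -
      have "t \<cdot> \<langle>a, a\<rangle> = (t \<cdot> \<langle>Id C ?R, Id C ?R\<rangle>) \<cdot> a"
        using a ar by (simp add: hom_def del: t(2))
      then show ?thesis
        unfolding t(2) using a ar by (intro factorsI[of a]) (simp_all add: hom_def)
    qed
    then show "refl_on (hom C Z ?R) (elem_rel C ?R w Z)"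
      by (intro refl_onI) (simp_all add: rel)
  qed
  then have "internal_equivalence C ?R w"
    using malcev mono w ar unfolding malcev_category_def by auto
  moreover have "X \<in> Ob C"
    using xy(1) hom_Ob by blast
  ultimately have "sym (elem_rel C ?R w X)"
    unfolding internal_equivalence_def equiv_def by blast
  then show ?thesis
    using rel[OF xy(1,2)] rel[OF xy(2,1)] xy(3) by (auto dest: symD)
qed

text \<open>Apply \<open>malcev_swap\<close> to the elements \<open>(p, q, k)\<close> and \<open>(p', q', k')\<close> of \<open>M\<close>, where \<open>t\<close> takes \<open>p\<close>, \<open>q\<close>
  from its first and \<open>k\<close> from its second argument: \<open>(p, q, k')\<close> in \<open>M\<close> implies \<open>(p', q', k)\<close> in \<open>M\<close>.\<close>

lemma difunctional:
  assumes malcev: "malcev_category C" and M: "M \<in> hom (Rel C) P (Prd C Q K)"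
    and el: "p \<in> hom C X P" "q \<in> hom C X Q" "k \<in> hom C X K" "p' \<in> hom C X P" "q' \<in> hom C X Q" "k' \<in> hom C X K"
    and sat: "sat M X p \<langle>q, k\<rangle>" "sat M X p \<langle>q, k'\<rangle>" "sat M X p' \<langle>q', k'\<rangle>"
  shows "sat M X p' \<langle>q', k\<rangle>"
proof -
  obtain m where m: "M = (P, subobj C m, Prd C Q K)" "monic C m" "Cod C m = Prd C P (Prd C Q K)"
    using M by (rule relE)
  have ob: "P \<in> Ob C" "Q \<in> Ob C" "K \<in> Ob C" and mA: "m \<in> Ar C"
    using el hom_Ob m monic_Ar by auto
  have el': "p \<in> Ar C" "q \<in> Ar C" "k \<in> Ar C" "p' \<in> Ar C" "q' \<in> Ar C" "k' \<in> Ar C"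
    "Dom C p = X" "Dom C q = X" "Dom C k = X" "Dom C p' = X" "Dom C q' = X" "Dom C k' = X"
    "Cod C p = P" "Cod C q = Q" "Cod C k = K" "Cod C p' = P" "Cod C q' = Q" "Cod C k' = K"
    using el by (auto simp: hom_def)
  let ?a = "Pr1 C (Dom C m) (Dom C m)" and ?b = "Pr2 C (Dom C m) (Dom C m)"
  let ?P2 = "Pr2 C P (Prd C Q K)"
  let ?t = "\<langle>Pr1 C P (Prd C Q K) \<cdot> m \<cdot> ?a, \<langle>Pr1 C Q K \<cdot> ?P2 \<cdot> m \<cdot> ?a, Pr2 C Q K \<cdot> ?P2 \<cdot> m \<cdot> ?b\<rangle>\<rangle>"
  have t: "?t \<in> hom C (Prd C (Dom C m) (Dom C m)) (Cod C m)"
    using m(3) ob mA by (simp add: hom_def)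
  have tI: "?t \<cdot> \<langle>Id C (Dom C m), Id C (Dom C m)\<rangle> = m"
    using m(3) ob mA by simp
  obtain x where x: "x \<in> Ar C" "Dom C x = X" "Cod C x = Dom C m" "m \<cdot> x = \<langle>p, \<langle>q, k\<rangle>\<rangle>"
    using sat(1) el' unfolding m(1) sat_subobj[OF m(2)] by (auto elim: factorsE)
  obtain y where y: "y \<in> Ar C" "Dom C y = X" "Cod C y = Dom C m" "m \<cdot> y = \<langle>p', \<langle>q', k'\<rangle>\<rangle>"
    using sat(3) el' unfolding m(1) sat_subobj[OF m(2)] by (auto elim: factorsE)
  have "?t \<cdot> \<langle>x, y\<rangle> = \<langle>p, \<langle>q, k'\<rangle>\<rangle>" "?t \<cdot> \<langle>y, x\<rangle> = \<langle>p', \<langle>q', k\<rangle>\<rangle>"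
    using x y el' m(3) ob mA by simp_all
  moreover have "factors m \<langle>p, \<langle>q, k'\<rangle>\<rangle>"
    using sat(2) unfolding m(1) sat_subobj[OF m(2)] by simp
  ultimately have "factors m \<langle>p', \<langle>q', k\<rangle>\<rangle>"
    using malcev_swap[OF malcev m(2) t tI, of x X y] x y by (simp add: hom_def)
  then show ?thesis
    unfolding m(1) sat_subobj[OF m(2)] using el' by (simp add: hom_def)
qed

section \<open>Units and quantum structures\<close>

text \<open>The unit laws read elementwise. The unit \<open>\<eta>\<close> is a subobject of \<open>K\<close>; locally every \<open>k\<close> has a right unit
  in it, and every product with a member of \<open>\<eta>\<close> is trivial.\<close>

lemma frobenius_units:
  fixes \<mu> \<eta> :: "('o, 'm) rel_ar"
  assumes "special_dagger_frobenius (Rel C) K \<mu> \<eta>"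
  shows mult_hom: "\<mu> \<in> hom (Rel C) (Prd C K K) K" and unit_hom: "\<eta> \<in> hom (Rel C) (One C) K"
    and right_unit: "k \<in> hom C X K \<Longrightarrow> \<exists>Y e z. cover e Y X \<and> e \<in> hom C Y X \<and> z \<in> hom C Y K \<and>
      sat \<eta> Y (Bang C Y) z \<and> sat \<mu> Y \<langle>k \<cdot> e, z\<rangle> (k \<cdot> e)"
    and right_unit_eq: "k \<in> hom C X K \<Longrightarrow> sat \<eta> X (Bang C X) z \<Longrightarrow> sat \<mu> X \<langle>k, z\<rangle> l \<Longrightarrow> k = l"
    and left_unit_eq: "k \<in> hom C X K \<Longrightarrow> sat \<eta> X (Bang C X) z \<Longrightarrow> sat \<mu> X \<langle>z, k\<rangle> l \<Longrightarrow> k = l"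
proof -
  show m: "\<mu> \<in> hom (Rel C) (Prd C K K) K" and n: "\<eta> \<in> hom (Rel C) (One C) K"
    using assms by (simp_all add: special_dagger_frobenius_def)
  have ob: "K \<in> Ob C"
    using rel_Ob[OF m] by simp
  let ?R = "rel_comp C (rel_tensor C (rel_graph C (Id C K)) \<eta>) (rel_graph C \<langle>Id C K, Bang C K\<rangle>)"
  let ?L = "rel_comp C (rel_tensor C \<eta> (rel_graph C (Id C K))) (rel_graph C \<langle>Bang C K, Id C K\<rangle>)"
  have ru: "rel_comp C \<mu> ?R = rel_graph C (Id C K)" and lu: "rel_comp C \<mu> ?L = rel_graph C (Id C K)"
    using assms by (simp_all add: special_dagger_frobenius_def dagger_graph[OF runit_inverse[OF ob]]
        dagger_graph[OF lunit_inverse[OF ob]])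
  have ins: "\<langle>Id C K, Bang C K\<rangle> \<in> hom C K (Prd C K (One C))" "\<langle>Bang C K, Id C K\<rangle> \<in> hom C K (Prd C (One C) K)"
    using ob by (simp_all add: hom_def)
  note tR = tensor_rel_hom[OF Id_rel_hom[OF ob] n] and tL = tensor_rel_hom[OF n Id_rel_hom[OF ob]]
  note R = Comp_rel_hom[OF graph_hom[OF ins(1)] tR] and L = Comp_rel_hom[OF graph_hom[OF ins(2)] tL]
  have sat_R: "sat ?R Y k \<langle>k', z\<rangle> \<longleftrightarrow> k' = k \<and> sat \<eta> Y (Bang C Y) z"
    and sat_L: "sat ?L Y k \<langle>z, k'\<rangle> \<longleftrightarrow> k' = k \<and> sat \<eta> Y (Bang C Y) z"
    if el: "k \<in> hom C Y K" "k' \<in> hom C Y K" "z \<in> hom C Y K" for Y k k' z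
  proof -
    have B: "Bang C Y \<in> hom C Y (One C)"
      using hom_Ob[OF el(1)] Bang_hom by auto
    have i: "\<langle>Id C K, Bang C K\<rangle> \<cdot> k = \<langle>k, Bang C Y\<rangle>" "\<langle>Bang C K, Id C K\<rangle> \<cdot> k = \<langle>Bang C Y, k\<rangle>"
      using el(1) ob by (auto simp: hom_def)
    show "sat ?R Y k \<langle>k', z\<rangle> \<longleftrightarrow> k' = k \<and> sat \<eta> Y (Bang C Y) z"
      unfolding sat_Comp_graph[OF ins(1) tR el(1) Pair_in_hom[OF el(2,3)]] i
        sat_tensor[OF Id_rel_hom[OF ob] n el(1) B el(2,3)] sat_Id[OF ob] using el by simp
    show "sat ?L Y k \<langle>z, k'\<rangle> \<longleftrightarrow> k' = k \<and> sat \<eta> Y (Bang C Y) z"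
      unfolding sat_Comp_graph[OF ins(2) tL el(1) Pair_in_hom[OF el(3,2)]] i
        sat_tensor[OF n Id_rel_hom[OF ob] B el(1) el(3,2)] sat_Id[OF ob] using el by auto
  qed
  show "\<exists>Y e z. cover e Y X \<and> e \<in> hom C Y X \<and> z \<in> hom C Y K \<and>
      sat \<eta> Y (Bang C Y) z \<and> sat \<mu> Y \<langle>k \<cdot> e, z\<rangle> (k \<cdot> e)" if k: "k \<in> hom C X K"
  proof -
    have "sat (rel_comp C \<mu> ?R) X k k"
      unfolding ru using k ob by (simp add: sat_Id)
    then obtain Y e w where e: "cover e Y X" "e \<in> hom C Y X" "w \<in> hom C Y (Prd C K K)"
        "sat ?R Y (k \<cdot> e) w" "sat \<mu> Y w (k \<cdot> e)"
      by (rule sat_CompE[OF _ R m])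
    obtain k' z where w: "k' \<in> hom C Y K" "z \<in> hom C Y K" "w = \<langle>k', z\<rangle>"
      using elem_Prd_cases[OF e(3) ob ob] .
    have "k' = k \<cdot> e \<and> sat \<eta> Y (Bang C Y) z"
      using e(4) sat_R[OF Comp_in_hom[OF e(2) k] w(1,2)] unfolding w(3) by simp
    then show ?thesis
      using e w by blast
  qed
  show "k = l" if "k \<in> hom C X K" "sat \<eta> X (Bang C X) z" "sat \<mu> X \<langle>k, z\<rangle> l"
  proof -
    have "z \<in> hom C X K" "l \<in> hom C X K"
      using sat_hom[OF n that(2)] sat_hom[OF m that(3)] by auto
    then have "sat (rel_comp C \<mu> ?R) X k l"
      using that by (intro sat_CompI[OF R m, of _ _ "\<langle>k, z\<rangle>"]) (simp_all add: sat_R)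
    then show ?thesis
      unfolding ru using ob by (simp add: sat_Id)
  qed
  show "k = l" if "k \<in> hom C X K" "sat \<eta> X (Bang C X) z" "sat \<mu> X \<langle>z, k\<rangle> l"
  proof -
    have "z \<in> hom C X K" "l \<in> hom C X K"
      using sat_hom[OF n that(2)] sat_hom[OF m that(3)] by auto
    then have "sat (rel_comp C \<mu> ?L) X k l"
      using that by (intro sat_CompI[OF L m, of _ _ "\<langle>z, k\<rangle>"]) (simp_all add: sat_L)
    then show ?thesis
      unfolding lu using ob by (simp add: sat_Id)
  qed
qed

lemma Bang_unique: "u \<in> hom C X (One C) \<Longrightarrow> u = Bang C X"
  using to_One_eq[of u] by (simp add: hom_def)

text \<open>Scalars are subobjects of \<open>1\<close> and composition is intersection, so scalars whose composite is \<open>1\<close> are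
  themselves \<open>1\<close>.\<close>

lemma scalar_inverse_Id:
  fixes d d' :: "('o, 'm) rel_ar"
  assumes "d \<in> hom (Rel C) (One C) (One C)" "d' \<in> hom (Rel C) (One C) (One C)"
    and "rel_comp C d d' = rel_graph C (Id C (One C))"
  shows "d = rel_graph C (Id C (One C))"
proof (rule rel_eqI[OF assms(1) Id_rel_hom[OF One_Ob]])
  fix X u v assume uv: "u \<in> hom C X (One C)" "v \<in> hom C X (One C)"
  have "u = v"
    using Bang_unique[OF uv(1)] Bang_unique[OF uv(2)] by simp
  then have "sat (rel_comp C d d') X u v"
    unfolding assms(3) using uv by (simp add: sat_Id)
  then obtain Y e b where e: "cover e Y X" "e \<in> hom C Y X" "b \<in> hom C Y (One C)" "sat d Y b (v \<cdot> e)"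
    by (rule sat_CompE[OF _ assms(2,1)])
  have "b = u \<cdot> e"
    using Bang_unique[OF e(3)] Bang_unique[OF Comp_in_hom[OF e(2) uv(1)]] by simp
  then have "sat d X u v"
    using sat_local[OF assms(1) e(1) uv] e(4) by simp
  then show "sat d X u v \<longleftrightarrow> sat (rel_graph C (Id C (One C))) X u v"
    using \<open>u = v\<close> uv by (simp add: sat_Id)
qed

lemma scalar_mult_Id:
  fixes f :: "('o, 'm) rel_ar"
  assumes f: "f \<in> hom (Rel C) A B"
  shows "scalar_mult (Rel C) (rel_graph C (Id C (One C))) f = f"
proof -
  have ob: "A \<in> Ob C" "B \<in> Ob C"
    using rel_Ob[OF f] by auto
  have dc: "Dom (Rel C) f = A" "Cod (Rel C) f = B"
    using f by (auto simp: hom_def)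
  have ins: "\<langle>Bang C A, Id C A\<rangle> \<in> hom C A (Prd C (One C) A)"
    using ob by (simp add: hom_def)
  note I = Id_rel_hom[OF One_Ob]
  note t = tensor_rel_hom[OF I f]
  note c = Comp_rel_hom[OF graph_hom[OF ins] t]
  have pr: "Pr2 C (One C) B \<in> hom C (Prd C (One C) B) B"
    using ob by (simp add: hom_def)
  have sm: "scalar_mult (Rel C) (rel_graph C (Id C (One C))) f = rel_comp C (rel_graph C (Pr2 C (One C) B))
      (rel_comp C (rel_tensor C (rel_graph C (Id C (One C))) f) (rel_graph C \<langle>Bang C A, Id C A\<rangle>))"
    by (simp add: scalar_mult_def dc dagger_graph[OF lunit_inverse[OF ob(1)]])
  show ?thesis
    unfolding sm
  proof (rule rel_eqI[OF Comp_rel_hom[OF c graph_hom[OF pr]] f])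
    fix X a b assume ab: "a \<in> hom C X A" "b \<in> hom C X B"
    have B: "Bang C X \<in> hom C X (One C)"
      using hom_Ob[OF ab(1)] Bang_hom by auto
    have i: "\<langle>Bang C A, Id C A\<rangle> \<cdot> a = \<langle>Bang C X, a\<rangle>" "\<langle>Bang C B, Id C B\<rangle> \<cdot> b = \<langle>Bang C X, b\<rangle>"
      using ab ob by (auto simp: hom_def)
    show "sat (rel_comp C (rel_graph C (Pr2 C (One C) B)) (rel_comp C (rel_tensor C (rel_graph C (Id C (One C))) f)
        (rel_graph C \<langle>Bang C A, Id C A\<rangle>))) X a b \<longleftrightarrow> sat f X a b"
      unfolding sat_graph_Comp[OF lunit_inverse[OF ob(2)] c ab] i
        sat_Comp_graph[OF ins t ab(1) Pair_in_hom[OF B ab(2)]]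
        sat_tensor[OF I f B ab(1) B ab(2)] sat_Id[OF One_Ob] using B by simp
  qed
qed

text \<open>Multiplication in the pair groupoid of \<open>A\<close>, the indiscrete groupoid with \<open>(a, b)\<close> as the unique arrow between \<open>a\<close> and \<open>b\<close>.\<close>

lemma pants_rel:
  assumes ob: "A \<in> Ob C"
  shows pants_hom: "pants (Rel C) A \<in> hom (Rel C) (Prd C (Prd C A A) (Prd C A A)) (Prd C A A)"
    and sat_pants: "a \<in> hom C X A \<Longrightarrow> b \<in> hom C X A \<Longrightarrow> b' \<in> hom C X A \<Longrightarrow> c \<in> hom C X A \<Longrightarrow> a' \<in> hom C X A \<Longrightarrow>
      c' \<in> hom C X A \<Longrightarrow>
      sat (pants (Rel C) A) X \<langle>\<langle>a, b\<rangle>, \<langle>b', c\<rangle>\<rangle> \<langle>a', c'\<rangle> \<longleftrightarrow> a' = a \<and> b = b' \<and> c' = c"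
proof -
  have sw: "\<langle>Pr2 C A A, Pr1 C A A\<rangle> \<in> hom C (Prd C A A) (Prd C A A)"
    using ob by (simp add: hom_def)
  note I = Id_rel_hom[OF ob]
  note cupd = dagger_rel_hom[OF cup_hom[OF ob]]
  have cap: "cap (Rel C) A = rel_comp C (rel_dagger C (cup (Rel C) A)) (rel_graph C \<langle>Pr2 C A A, Pr1 C A A\<rangle>)"
    by (simp add: cap_def)
  have cap_hom: "cap (Rel C) A \<in> hom (Rel C) (Prd C A A) (One C)"
    unfolding cap by (rule Comp_rel_hom[OF graph_hom[OF sw] cupd])
  have inv: "prod_assoc_inv A A A \<in> hom C (Prd C A (Prd C A A)) (Prd C (Prd C A A) A)"
      and ass: "prod_assoc C A A (Prd C A A) \<in> hom C (Prd C (Prd C A A) (Prd C A A)) (Prd C A (Prd C A (Prd C A A)))"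
      and pr: "Pr2 C (One C) A \<in> hom C (Prd C (One C) A) A"
    using prod_assoc_inverse[of A A A] prod_assoc_inverse[of A A "Prd C A A"] ob
    by (simp_all add: inverse_ar_def) (simp add: hom_def)
  let ?T = "rel_tensor C (cap (Rel C) A) (rel_graph C (Id C A))"
  let ?U = "rel_comp C ?T (rel_graph C (prod_assoc_inv A A A))"
  let ?V = "rel_comp C (rel_graph C (Pr2 C (One C) A)) ?U"
  note T = tensor_rel_hom[OF cap_hom I]
  note U = Comp_rel_hom[OF graph_hom[OF inv] T]
  note V = Comp_rel_hom[OF U graph_hom[OF pr]]
  note W = tensor_rel_hom[OF I V]
  have pants: "pants (Rel C) A = rel_comp C (rel_tensor C (rel_graph C (Id C A)) ?V) (rel_graph C (prod_assoc C A A (Prd C A A)))"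
    by (simp add: pants_def dagger_graph[OF prod_assoc_inverse[OF ob ob ob]])
  show "pants (Rel C) A \<in> hom (Rel C) (Prd C (Prd C A A) (Prd C A A)) (Prd C A A)"
    unfolding pants by (rule Comp_rel_hom[OF graph_hom[OF ass] W])
  assume el: "a \<in> hom C X A" "b \<in> hom C X A" "b' \<in> hom C X A" "c \<in> hom C X A" "a' \<in> hom C X A" "c' \<in> hom C X A"
  have B: "Bang C X \<in> hom C X (One C)"
    using hom_Ob[OF el(1)] Bang_hom by auto
  have i: "\<langle>Pr2 C A A, Pr1 C A A\<rangle> \<cdot> \<langle>b, b'\<rangle> = \<langle>b', b\<rangle>" "\<langle>Bang C A, Id C A\<rangle> \<cdot> c' = \<langle>Bang C X, c'\<rangle>"
    using el ob by (auto simp: hom_def)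
  have "sat (cap (Rel C) A) X \<langle>b, b'\<rangle> (Bang C X) \<longleftrightarrow> b' = b"
    unfolding cap sat_Comp_graph[OF sw cupd Pair_in_hom[OF el(2,3)] B] i sat_dagger[OF cup_hom[OF ob]]
      sat_cup[OF ob B el(3,2)] ..
  then have V': "sat ?V X \<langle>b, \<langle>b', c\<rangle>\<rangle> c' \<longleftrightarrow> b' = b \<and> c' = c"
    unfolding sat_graph_Comp[OF lunit_inverse[OF ob] U Pair_in_hom[OF el(2) Pair_in_hom[OF el(3,4)]] el(6)] i
      sat_Comp_graph[OF inv T Pair_in_hom[OF el(2) Pair_in_hom[OF el(3,4)]] Pair_in_hom[OF B el(6)]]
      prod_assoc_app(2)[OF el(2,3,4)]
      sat_tensor[OF cap_hom I Pair_in_hom[OF el(2,3)] el(4) B el(6)] sat_Id[OF ob] using el by simp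
  show "sat (pants (Rel C) A) X \<langle>\<langle>a, b\<rangle>, \<langle>b', c\<rangle>\<rangle> \<langle>a', c'\<rangle> \<longleftrightarrow> a' = a \<and> b = b' \<and> c' = c"
    unfolding pants sat_Comp_graph[OF ass W Pair_in_hom[OF Pair_in_hom[OF el(1,2)] Pair_in_hom[OF el(3,4)]] Pair_in_hom[OF el(5,6)]]
      prod_assoc_app(1)[OF el(1,2) Pair_in_hom[OF el(3,4)]]
      sat_tensor[OF I V el(1) Pair_in_hom[OF el(2) Pair_in_hom[OF el(3,4)]] el(5,6)] V' sat_Id[OF ob]
    using el by auto
qed

lemma quantum_structure_pair_groupoid:
  assumes "quantum_structure (Rel C) B \<mu> \<eta>"
  obtains A where "A \<in> Ob C" "B = Prd C A A" "\<mu> = pants (Rel C) A" "\<eta> = cup (Rel C) A"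
proof -
  obtain A d d' where A: "A \<in> Ob C" "d \<in> hom (Rel C) (One C) (One C)" "d' \<in> hom (Rel C) (One C) (One C)"
    "rel_comp C d d' = rel_graph C (Id C (One C))" "rel_comp C d' d = rel_graph C (Id C (One C))"
    "B = Prd C A A" "\<mu> = scalar_mult (Rel C) d (pants (Rel C) A)" "\<eta> = scalar_mult (Rel C) d' (cup (Rel C) A)"
    using assms by (auto simp: quantum_structure_def)
  have "d = rel_graph C (Id C (One C))" "d' = rel_graph C (Id C (One C))"
    using scalar_inverse_Id A by blast+
  then show ?thesis
    using that A scalar_mult_Id[OF pants_hom[OF A(1)]] scalar_mult_Id[OF cup_hom[OF A(1)]] by simp
qed

end

section \<open>Measurements that do not disturb the system\<close>

text \<open>The situation of the uncertainty principle once the quantum structure has been identified as the pair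
  groupoid of \<open>A\<close>.\<close>

locale undisturbing = regular C for C :: "('o, 'm, 'x) category_scheme" (structure) +
  fixes A K :: 'o and \<mu> \<eta> M :: "('o, 'm) rel_ar"
  assumes malcev: "malcev_category C"
    and A_Ob: "A \<in> Ob C"
    and frobenius: "special_dagger_frobenius (Rel C) K \<mu> \<eta>"
    and cp: "completely_positive (Rel C) (Prd C A A) (pants (Rel C) A) (Prd C (Prd C A A) K)
      (tensor_mult (Rel C) (Prd C A A) (pants (Rel C) A) K \<mu>) M"
    and undisturbed: "rel_comp C (rel_graph C (Pr1 C (Prd C A A) (One C)))
      (rel_comp C (rel_tensor C (rel_graph C (Id C (Prd C A A))) (rel_dagger C \<eta>)) M)
        = rel_graph C (Id C (Prd C A A))"
begin

abbreviation "B \<equiv> Prd C A A"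

abbreviation "choi_M \<equiv> choi (Rel C) B (pants (Rel C) A) (Prd C B K) (tensor_mult (Rel C) B (pants (Rel C) A) K \<mu>) M"

lemmas mult_hom = mult_hom[OF frobenius]
  and unit_hom = unit_hom[OF frobenius]
  and right_unit = right_unit[OF frobenius]
  and right_unit_eq = right_unit_eq[OF frobenius]
  and left_unit_eq = left_unit_eq[OF frobenius]
  and pants_hom = pants_hom[OF A_Ob]
  and sat_pants = sat_pants[OF A_Ob]

lemma B_Ob: "B \<in> Ob C"
  using A_Ob by simp

lemma K_Ob: "K \<in> Ob C"
  using rel_Ob[OF mult_hom] by simp

lemma M_hom: "M \<in> hom (Rel C) B (Prd C B K)"
  using cp by (simp add: completely_positive_def)

lemma choi_M_positive:
  assumes "sat choi_M X s t"
  shows "sat choi_M X s s" "sat choi_M X t t" "sat choi_M X t s"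
proof -
  obtain Z g where g: "g \<in> hom (Rel C) (Prd C B (Prd C B K)) Z" "choi_M = rel_comp C (rel_dagger C g) g"
    using cp by (auto simp: completely_positive_def)
  show "sat choi_M X s s" "sat choi_M X t t" "sat choi_M X t s"
    using positive_rel[OF g(1)] assms unfolding g(2) by blast+
qed

text \<open>The outer components \<open>a\<close> and \<open>f\<close> are arbitrary, since \<open>(b', b)\<close> and \<open>(c, d)\<close> only act on the inner ones.\<close>

lemma sat_choi_M_I:
  assumes el: "a \<in> hom C X A" "b \<in> hom C X A" "b' \<in> hom C X A" "c \<in> hom C X A" "d \<in> hom C X A" "f \<in> hom C X A"
      "k \<in> hom C X K" "k' \<in> hom C X K" "l \<in> hom C X K"
    and "sat M X \<langle>b', b\<rangle> \<langle>\<langle>c, d\<rangle>, l\<rangle>" "sat \<mu> X \<langle>l, k\<rangle> k'"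
  shows "sat choi_M X \<langle>\<langle>a, b\<rangle>, \<langle>\<langle>d, f\<rangle>, k\<rangle>\<rangle> \<langle>\<langle>a, b'\<rangle>, \<langle>\<langle>c, f\<rangle>, k'\<rangle>\<rangle>"
proof (rule sat_choiI[OF pants_hom tensor_mult_hom[OF pants_hom mult_hom] M_hom])
  show "sat (pants (Rel C) A) X \<langle>\<langle>a, b'\<rangle>, \<langle>b', b\<rangle>\<rangle> \<langle>a, b\<rangle>"
    using el by (simp add: sat_pants)
  show "sat (tensor_mult (Rel C) B (pants (Rel C) A) K \<mu>) X \<langle>\<langle>\<langle>c, d\<rangle>, l\<rangle>, \<langle>\<langle>d, f\<rangle>, k\<rangle>\<rangle> \<langle>\<langle>c, f\<rangle>, k'\<rangle>"
    using el assms(11) by (simp add: sat_tensor_mult[OF pants_hom mult_hom] sat_pants Pair_in_hom)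
qed (use el assms(10) in \<open>simp_all add: Pair_in_hom\<close>)

lemma sat_choi_M_D:
  assumes el: "a \<in> hom C X A" "b \<in> hom C X A" "b' \<in> hom C X A" "c \<in> hom C X A" "d \<in> hom C X A" "f \<in> hom C X A"
      "k \<in> hom C X K" "k' \<in> hom C X K"
    and T: "sat choi_M X \<langle>\<langle>a, b\<rangle>, \<langle>\<langle>d, f\<rangle>, k\<rangle>\<rangle> \<langle>\<langle>a, b'\<rangle>, \<langle>\<langle>c, f\<rangle>, k'\<rangle>\<rangle>"
  obtains Y e l where "cover e Y X" "e \<in> hom C Y X" "l \<in> hom C Y K"
    "sat M Y \<langle>b' \<cdot> e, b \<cdot> e\<rangle> \<langle>\<langle>c \<cdot> e, d \<cdot> e\<rangle>, l\<rangle>" "sat \<mu> Y \<langle>l, k \<cdot> e\<rangle> (k' \<cdot> e)"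
proof -
  have elB: "\<langle>a, b\<rangle> \<in> hom C X B" "\<langle>a, b'\<rangle> \<in> hom C X B" "\<langle>\<langle>d, f\<rangle>, k\<rangle> \<in> hom C X (Prd C B K)"
    "\<langle>\<langle>c, f\<rangle>, k'\<rangle> \<in> hom C X (Prd C B K)"
    using el by (auto intro!: Pair_in_hom)
  obtain Y e u n where e: "cover e Y X" "e \<in> hom C Y X" "u \<in> hom C Y B" "n \<in> hom C Y (Prd C B K)"
    and sat: "sat (pants (Rel C) A) Y \<langle>\<langle>a, b'\<rangle> \<cdot> e, u\<rangle> (\<langle>a, b\<rangle> \<cdot> e)" "sat M Y u n"
      "sat (tensor_mult (Rel C) B (pants (Rel C) A) K \<mu>) Y \<langle>n, \<langle>\<langle>d, f\<rangle>, k\<rangle> \<cdot> e\<rangle> (\<langle>\<langle>c, f\<rangle>, k'\<rangle> \<cdot> e)"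
    using sat_choiD[OF pants_hom tensor_mult_hom[OF pants_hom mult_hom] M_hom elB T] by blast
  have ele: "a \<cdot> e \<in> hom C Y A" "b \<cdot> e \<in> hom C Y A" "b' \<cdot> e \<in> hom C Y A" "c \<cdot> e \<in> hom C Y A"
    "d \<cdot> e \<in> hom C Y A" "f \<cdot> e \<in> hom C Y A" "k \<cdot> e \<in> hom C Y K" "k' \<cdot> e \<in> hom C Y K"
    using el Comp_in_hom[OF e(2)] by auto
  have dist: "\<langle>a, b\<rangle> \<cdot> e = \<langle>a \<cdot> e, b \<cdot> e\<rangle>" "\<langle>a, b'\<rangle> \<cdot> e = \<langle>a \<cdot> e, b' \<cdot> e\<rangle>"
    "\<langle>\<langle>d, f\<rangle>, k\<rangle> \<cdot> e = \<langle>\<langle>d \<cdot> e, f \<cdot> e\<rangle>, k \<cdot> e\<rangle>" "\<langle>\<langle>c, f\<rangle>, k'\<rangle> \<cdot> e = \<langle>\<langle>c \<cdot> e, f \<cdot> e\<rangle>, k' \<cdot> e\<rangle>"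
    using el e(2) by (simp_all add: hom_def)
  obtain u1 u2 where u: "u1 \<in> hom C Y A" "u2 \<in> hom C Y A" "u = \<langle>u1, u2\<rangle>"
    using elem_Prd_cases[OF e(3) A_Ob A_Ob] .
  obtain n0 l where n: "n0 \<in> hom C Y B" "l \<in> hom C Y K" "n = \<langle>n0, l\<rangle>"
    using elem_Prd_cases[OF e(4) B_Ob K_Ob] .
  obtain n1 n2 where n0: "n1 \<in> hom C Y A" "n2 \<in> hom C Y A" "n0 = \<langle>n1, n2\<rangle>"
    using elem_Prd_cases[OF n(1) A_Ob A_Ob] .
  have u12: "u1 = b' \<cdot> e" "u2 = b \<cdot> e"
    using sat(1) unfolding dist u(3) sat_pants[OF ele(1,3) u(1,2) ele(1,2)] by simp_all
  have "sat (pants (Rel C) A) Y \<langle>\<langle>n1, n2\<rangle>, \<langle>d \<cdot> e, f \<cdot> e\<rangle>\<rangle> \<langle>c \<cdot> e, f \<cdot> e\<rangle>" and mu: "sat \<mu> Y \<langle>l, k \<cdot> e\<rangle> (k' \<cdot> e)"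
    using sat(3) unfolding dist n(3) n0(3)
      sat_tensor_mult[OF pants_hom mult_hom Pair_in_hom[OF n0(1,2)] n(2) Pair_in_hom[OF ele(5,6)] ele(7)
        Pair_in_hom[OF ele(4,6)] ele(8)] by auto
  then have n12: "n1 = c \<cdot> e" "n2 = d \<cdot> e"
    unfolding sat_pants[OF n0(1,2) ele(5,6) ele(4,6)] by simp_all
  show ?thesis
    using that[OF e(1,2) n(2) _ mu] sat(2) unfolding u(3) n(3) n0(3) u12 n12 .
qed

text \<open>The two halves of the assumption on \<open>M\<close>: with a unit as outcome, \<open>M\<close> relates each \<open>b\<close> to itself and to
  nothing else.\<close>

lemma undisturbed_M:
  assumes b: "b \<in> hom C X B"
  shows undisturbed_exists: "\<exists>Y e z. cover e Y X \<and> e \<in> hom C Y X \<and> z \<in> hom C Y K \<and> sat \<eta> Y (Bang C Y) z \<and>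
      sat M Y (b \<cdot> e) \<langle>b \<cdot> e, z\<rangle>"
    and undisturbed_eq: "b' \<in> hom C X B \<Longrightarrow> z \<in> hom C X K \<Longrightarrow> sat M X b \<langle>b', z\<rangle> \<Longrightarrow> sat \<eta> X (Bang C X) z \<Longrightarrow> b' = b"
proof -
  let ?V = "rel_tensor C (rel_graph C (Id C B)) (rel_dagger C \<eta>)"
  note V = tensor_rel_hom[OF Id_rel_hom[OF B_Ob] dagger_rel_hom[OF unit_hom]]
  note VM = Comp_rel_hom[OF M_hom V]
  have sat_V: "sat ?V Y \<langle>b, z\<rangle> \<langle>b', Bang C Y\<rangle> \<longleftrightarrow> b' = b \<and> sat \<eta> Y (Bang C Y) z"
    if "b \<in> hom C Y B" "b' \<in> hom C Y B" "z \<in> hom C Y K" for b b' z Y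
    using that hom_Ob[OF that(1)] Bang_hom[of Y]
    by (simp add: sat_tensor[OF Id_rel_hom[OF B_Ob] dagger_rel_hom[OF unit_hom]] sat_Id B_Ob
      sat_dagger[OF unit_hom])
  have X: "X \<in> Ob C"
    using hom_Ob[OF b] by simp
  have total: "sat (rel_comp C ?V M) X b \<langle>b', Bang C X\<rangle> \<longleftrightarrow> b' = b" if b': "b' \<in> hom C X B" for b'
  proof -
    have "\<langle>Id C B, Bang C B\<rangle> \<cdot> b' = \<langle>b', Bang C X\<rangle>"
      using b' B_Ob by (auto simp: hom_def)
    then show ?thesis
      using sat_graph_Comp[OF runit_inverse[OF B_Ob] VM b b'] b unfolding undisturbed sat_Id[OF B_Ob] by simp
  qed
  show "b' = b" if "b' \<in> hom C X B" "z \<in> hom C X K" "sat M X b \<langle>b', z\<rangle>" "sat \<eta> X (Bang C X) z"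
    using total[OF that(1)] sat_CompI[OF M_hom V that(3), of "\<langle>b', Bang C X\<rangle>"] that by (simp add: sat_V)
  have "sat (rel_comp C ?V M) X b \<langle>b, Bang C X\<rangle>"
    using total[OF b] by simp
  then obtain Y e w where e: "cover e Y X" "e \<in> hom C Y X" "w \<in> hom C Y (Prd C B K)"
      "sat M Y (b \<cdot> e) w" "sat ?V Y w (\<langle>b, Bang C X\<rangle> \<cdot> e)"
    by (rule sat_CompE[OF _ M_hom V])
  obtain b' z where w: "b' \<in> hom C Y B" "z \<in> hom C Y K" "w = \<langle>b', z\<rangle>"
    using elem_Prd_cases[OF e(3) B_Ob K_Ob] .
  have "\<langle>b, Bang C X\<rangle> \<cdot> e = \<langle>b \<cdot> e, Bang C Y\<rangle>"
    using b e(2) X by (simp add: hom_def)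
  then have "b \<cdot> e = b' \<and> sat \<eta> Y (Bang C Y) z"
    using e(5) sat_V[OF w(1) Comp_in_hom[OF e(2) b] w(2)] unfolding w(3) by simp
  then show "\<exists>Y e z. cover e Y X \<and> e \<in> hom C Y X \<and> z \<in> hom C Y K \<and> sat \<eta> Y (Bang C Y) z \<and>
      sat M Y (b \<cdot> e) \<langle>b \<cdot> e, z\<rangle>"
    using e w by metis
qed

lemma unit_restrict:
  assumes "sat \<eta> X (Bang C X) z" "e \<in> hom C Y X"
  shows "sat \<eta> Y (Bang C Y) (z \<cdot> e)"
proof -
  have "Bang C X \<cdot> e = Bang C Y"
    using assms(2) by (auto simp: hom_def)
  then show ?thesis
    using sat_restrict[OF unit_hom assms] by simp
qed

text \<open>The case in which a right unit \<open>z\<close> of \<open>l\<close> is given at the present stage. The Choi matrix relates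
  \<open>((b, b), (d, b), z)\<close> to another element and hence to itself; the resulting outcome \<open>i\<close> satisfies
  \<open>i z = z\<close>, so it is the unit \<open>z\<close>.\<close>

lemma sat_M_snd_aux:
  assumes el: "b' \<in> hom C X A" "b \<in> hom C X A" "c \<in> hom C X A" "d \<in> hom C X A" "l \<in> hom C X K" "z \<in> hom C X K"
    and M: "sat M X \<langle>b', b\<rangle> \<langle>\<langle>c, d\<rangle>, l\<rangle>" and z: "sat \<eta> X (Bang C X) z" "sat \<mu> X \<langle>l, z\<rangle> l"
  shows "d = b"
proof -
  have "sat choi_M X \<langle>\<langle>b, b\<rangle>, \<langle>\<langle>d, b\<rangle>, z\<rangle>\<rangle> \<langle>\<langle>b, b'\<rangle>, \<langle>\<langle>c, b\<rangle>, l\<rangle>\<rangle>"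
    by (rule sat_choi_M_I) (use el M z in simp_all)
  then have "sat choi_M X \<langle>\<langle>b, b\<rangle>, \<langle>\<langle>d, b\<rangle>, z\<rangle>\<rangle> \<langle>\<langle>b, b\<rangle>, \<langle>\<langle>d, b\<rangle>, z\<rangle>\<rangle>"
    by (rule choi_M_positive)
  then obtain Y e i where e: "cover e Y X" "e \<in> hom C Y X" "i \<in> hom C Y K"
      "sat M Y \<langle>b \<cdot> e, b \<cdot> e\<rangle> \<langle>\<langle>d \<cdot> e, d \<cdot> e\<rangle>, i\<rangle>" "sat \<mu> Y \<langle>i, z \<cdot> e\<rangle> (z \<cdot> e)"
    by (rule sat_choi_M_D[OF el(2,2,2,4,4,2,6,6)])
  have ele: "b \<cdot> e \<in> hom C Y A" "d \<cdot> e \<in> hom C Y A"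
    using el Comp_in_hom[OF e(2)] by auto
  have ze: "sat \<eta> Y (Bang C Y) (z \<cdot> e)"
    using unit_restrict[OF z(1) e(2)] .
  then have "i = z \<cdot> e"
    using right_unit_eq[OF e(3) _ e(5)] by simp
  then have "\<langle>d \<cdot> e, d \<cdot> e\<rangle> = \<langle>b \<cdot> e, b \<cdot> e\<rangle>"
    using undisturbed_eq[OF Pair_in_hom Pair_in_hom e(3,4)] ele ze by simp
  then have "d \<cdot> e = b \<cdot> e"
    using Pair_hom_eq_iff ele by blast
  then show ?thesis
    using cover_cancel[OF e(1) el(4,2)] by simp
qed

lemma sat_M_snd:
  assumes el: "b' \<in> hom C X A" "b \<in> hom C X A" "c \<in> hom C X A" "d \<in> hom C X A" "l \<in> hom C X K"
    and M: "sat M X \<langle>b', b\<rangle> \<langle>\<langle>c, d\<rangle>, l\<rangle>"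
  shows "d = b"
proof -
  obtain Y e z where e: "cover e Y X" "e \<in> hom C Y X" "z \<in> hom C Y K" "sat \<eta> Y (Bang C Y) z"
      "sat \<mu> Y \<langle>l \<cdot> e, z\<rangle> (l \<cdot> e)"
    using right_unit[OF el(5)] by blast
  have ele: "b' \<cdot> e \<in> hom C Y A" "b \<cdot> e \<in> hom C Y A" "c \<cdot> e \<in> hom C Y A" "d \<cdot> e \<in> hom C Y A" "l \<cdot> e \<in> hom C Y K"
    using el Comp_in_hom[OF e(2)] by auto
  have "sat M Y (\<langle>b', b\<rangle> \<cdot> e) (\<langle>\<langle>c, d\<rangle>, l\<rangle> \<cdot> e)"
    using sat_restrict[OF M_hom M e(2)] .
  moreover have "\<langle>b', b\<rangle> \<cdot> e = \<langle>b' \<cdot> e, b \<cdot> e\<rangle>" "\<langle>\<langle>c, d\<rangle>, l\<rangle> \<cdot> e = \<langle>\<langle>c \<cdot> e, d \<cdot> e\<rangle>, l \<cdot> e\<rangle>"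
    using el e(2) by (simp_all add: hom_def)
  ultimately have "d \<cdot> e = b \<cdot> e"
    using sat_M_snd_aux[OF ele e(3) _ e(4,5)] by simp
  then show ?thesis
    using cover_cancel[OF e(1) el(4,2)] by simp
qed

text \<open>Symmetry of the Choi matrix exchanges the roles of the two components, so that \<open>sat_M_snd\<close> applies
  to \<open>M (b, b') ((d, c), i)\<close>.\<close>

lemma sat_M_fst:
  assumes el: "b' \<in> hom C X A" "b \<in> hom C X A" "c \<in> hom C X A" "d \<in> hom C X A" "l \<in> hom C X K"
    and M: "sat M X \<langle>b', b\<rangle> \<langle>\<langle>c, d\<rangle>, l\<rangle>"
  shows "c = b'"
proof -
  obtain Y e z where e: "cover e Y X" "e \<in> hom C Y X" "z \<in> hom C Y K" "sat \<mu> Y \<langle>l \<cdot> e, z\<rangle> (l \<cdot> e)"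
    using right_unit[OF el(5)] by blast
  have ele: "b' \<cdot> e \<in> hom C Y A" "b \<cdot> e \<in> hom C Y A" "c \<cdot> e \<in> hom C Y A" "d \<cdot> e \<in> hom C Y A" "l \<cdot> e \<in> hom C Y K"
    using el Comp_in_hom[OF e(2)] by auto
  have "sat M Y (\<langle>b', b\<rangle> \<cdot> e) (\<langle>\<langle>c, d\<rangle>, l\<rangle> \<cdot> e)"
    using sat_restrict[OF M_hom M e(2)] .
  moreover have "\<langle>b', b\<rangle> \<cdot> e = \<langle>b' \<cdot> e, b \<cdot> e\<rangle>" "\<langle>\<langle>c, d\<rangle>, l\<rangle> \<cdot> e = \<langle>\<langle>c \<cdot> e, d \<cdot> e\<rangle>, l \<cdot> e\<rangle>"
    using el e(2) by (simp_all add: hom_def)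
  ultimately have "sat choi_M Y \<langle>\<langle>b \<cdot> e, b \<cdot> e\<rangle>, \<langle>\<langle>d \<cdot> e, b \<cdot> e\<rangle>, z\<rangle>\<rangle> \<langle>\<langle>b \<cdot> e, b' \<cdot> e\<rangle>, \<langle>\<langle>c \<cdot> e, b \<cdot> e\<rangle>, l \<cdot> e\<rangle>\<rangle>"
    using sat_choi_M_I[OF ele(2,2,1,3,4,2) e(3) ele(5,5) _ e(4)] by simp
  then have "sat choi_M Y \<langle>\<langle>b \<cdot> e, b' \<cdot> e\<rangle>, \<langle>\<langle>c \<cdot> e, b \<cdot> e\<rangle>, l \<cdot> e\<rangle>\<rangle> \<langle>\<langle>b \<cdot> e, b \<cdot> e\<rangle>, \<langle>\<langle>d \<cdot> e, b \<cdot> e\<rangle>, z\<rangle>\<rangle>"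
    by (rule choi_M_positive)
  then obtain Z e' i where e': "cover e' Z Y" "e' \<in> hom C Z Y" "i \<in> hom C Z K"
      "sat M Z \<langle>(b \<cdot> e) \<cdot> e', (b' \<cdot> e) \<cdot> e'\<rangle> \<langle>\<langle>(d \<cdot> e) \<cdot> e', (c \<cdot> e) \<cdot> e'\<rangle>, i\<rangle>"
    by (rule sat_choi_M_D[OF ele(2,1,2,4,3,2,5) e(3)])
  have "(c \<cdot> e) \<cdot> e' = (b' \<cdot> e) \<cdot> e'"
    using sat_M_snd[OF _ _ _ _ e'(3,4)] ele Comp_in_hom[OF e'(2)] by blast
  then have "c \<cdot> e = b' \<cdot> e"
    using cover_cancel[OF e'(1) ele(3,1)] by simp
  then show ?thesis
    using cover_cancel[OF e(1) el(3,1)] by simp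
qed

text \<open>The right unit of a unit \<open>z\<close> is \<open>z\<close> itself, because \<open>z\<close> is also a left unit.\<close>

lemma unit_idempotent:
  assumes z: "sat \<eta> X (Bang C X) z"
  shows "sat \<mu> X \<langle>z, z\<rangle> z"
proof -
  have zK: "z \<in> hom C X K"
    using sat_hom[OF unit_hom z] by simp
  obtain Y e y where e: "cover e Y X" "e \<in> hom C Y X" "y \<in> hom C Y K" "sat \<eta> Y (Bang C Y) y"
      "sat \<mu> Y \<langle>z \<cdot> e, y\<rangle> (z \<cdot> e)"
    using right_unit[OF zK] by blast
  have "y = z \<cdot> e"
    using left_unit_eq[OF e(3) unit_restrict[OF z e(2)] e(5)] .
  then have "sat \<mu> Y (\<langle>z, z\<rangle> \<cdot> e) (z \<cdot> e)"
    using e(5) Pair_hom_Comp[OF zK zK e(2)] by simp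
  then show ?thesis
    using sat_local[OF mult_hom e(1) Pair_in_hom[OF zK zK] zK] by simp
qed

lemma sat_M_diagonal_local:
  assumes el: "a \<in> hom C X A" "k \<in> hom C X K" and e: "cover e Y X"
    and M: "sat M Y \<langle>a \<cdot> e, a \<cdot> e\<rangle> \<langle>\<langle>a \<cdot> e, a \<cdot> e\<rangle>, k \<cdot> e\<rangle>"
  shows "sat M X \<langle>a, a\<rangle> \<langle>\<langle>a, a\<rangle>, k\<rangle>"
proof -
  have "\<langle>a, a\<rangle> \<cdot> e = \<langle>a \<cdot> e, a \<cdot> e\<rangle>" "\<langle>\<langle>a, a\<rangle>, k\<rangle> \<cdot> e = \<langle>\<langle>a \<cdot> e, a \<cdot> e\<rangle>, k \<cdot> e\<rangle>"
    using el e by (simp_all add: hom_def cover_def)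
  then show ?thesis
    using sat_local[OF M_hom e Pair_in_hom[OF el(1,1)] Pair_in_hom[OF Pair_in_hom[OF el(1,1)] el(2)]] M by simp
qed

text \<open>The Choi matrix relates \<open>((a, b), (b, a), z)\<close> to \<open>((a, a), (a, a), z)\<close>. It is reflexive at both, and
  reflexivity at \<open>((a, c), (c, a), z)\<close> says that \<open>M (c, c) ((c, c), i)\<close> with \<open>i z = z\<close>, that is, \<open>i = z\<close>.\<close>

lemma sat_M_endpoints:
  assumes el: "a \<in> hom C X A" "b \<in> hom C X A" "z \<in> hom C X K"
    and M: "sat M X \<langle>a, b\<rangle> \<langle>\<langle>a, b\<rangle>, z\<rangle>" and z: "sat \<eta> X (Bang C X) z"
  shows "sat M X \<langle>a, a\<rangle> \<langle>\<langle>a, a\<rangle>, z\<rangle>" "sat M X \<langle>b, b\<rangle> \<langle>\<langle>b, b\<rangle>, z\<rangle>"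
proof -
  have T: "sat choi_M X \<langle>\<langle>a, b\<rangle>, \<langle>\<langle>b, a\<rangle>, z\<rangle>\<rangle> \<langle>\<langle>a, a\<rangle>, \<langle>\<langle>a, a\<rangle>, z\<rangle>\<rangle>"
    by (rule sat_choi_M_I) (use el M unit_idempotent[OF z] in simp_all)
  have endpoint: "sat M X \<langle>c, c\<rangle> \<langle>\<langle>c, c\<rangle>, z\<rangle>"
    if c: "c \<in> hom C X A" and Tc: "sat choi_M X \<langle>\<langle>a, c\<rangle>, \<langle>\<langle>c, a\<rangle>, z\<rangle>\<rangle> \<langle>\<langle>a, c\<rangle>, \<langle>\<langle>c, a\<rangle>, z\<rangle>\<rangle>" for c
  proof -
    obtain Y e i where e: "cover e Y X" "e \<in> hom C Y X" "i \<in> hom C Y K"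
        "sat M Y \<langle>c \<cdot> e, c \<cdot> e\<rangle> \<langle>\<langle>c \<cdot> e, c \<cdot> e\<rangle>, i\<rangle>" "sat \<mu> Y \<langle>i, z \<cdot> e\<rangle> (z \<cdot> e)"
      using sat_choi_M_D[OF el(1) c c c c el(1,3,3) Tc] .
    have "i = z \<cdot> e"
      using right_unit_eq[OF e(3) unit_restrict[OF z e(2)] e(5)] .
    then show ?thesis
      using sat_M_diagonal_local[OF c el(3) e(1)] e(4) by simp
  qed
  show "sat M X \<langle>a, a\<rangle> \<langle>\<langle>a, a\<rangle>, z\<rangle>" "sat M X \<langle>b, b\<rangle> \<langle>\<langle>b, b\<rangle>, z\<rangle>"
    using endpoint[OF el(1) choi_M_positive(2)[OF T]] endpoint[OF el(2) choi_M_positive(1)[OF T]] by auto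
qed

text \<open>Measuring \<open>(a, b)\<close> gives a unit \<open>z\<close> that is a common outcome at \<open>(a, a)\<close> and \<open>(b, b)\<close>; difunctionality
  then carries every other outcome \<open>k\<close> from \<open>(a, a)\<close> to \<open>(b, b)\<close>.\<close>

lemma sat_M_transport:
  assumes el: "a \<in> hom C X A" "b \<in> hom C X A" "k \<in> hom C X K" and M: "sat M X \<langle>a, a\<rangle> \<langle>\<langle>a, a\<rangle>, k\<rangle>"
  shows "sat M X \<langle>b, b\<rangle> \<langle>\<langle>b, b\<rangle>, k\<rangle>"
proof -
  obtain Y e z where e: "cover e Y X" "e \<in> hom C Y X" "z \<in> hom C Y K" "sat \<eta> Y (Bang C Y) z"
      "sat M Y (\<langle>a, b\<rangle> \<cdot> e) \<langle>\<langle>a, b\<rangle> \<cdot> e, z\<rangle>"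
    using undisturbed_exists[OF Pair_in_hom[OF el(1,2)]] by blast
  have ele: "a \<cdot> e \<in> hom C Y A" "b \<cdot> e \<in> hom C Y A" "k \<cdot> e \<in> hom C Y K"
    using el Comp_in_hom[OF e(2)] by auto
  have "sat M Y (\<langle>a, a\<rangle> \<cdot> e) (\<langle>\<langle>a, a\<rangle>, k\<rangle> \<cdot> e)"
    using sat_restrict[OF M_hom M e(2)] .
  moreover have "\<langle>a, a\<rangle> \<cdot> e = \<langle>a \<cdot> e, a \<cdot> e\<rangle>" "\<langle>\<langle>a, a\<rangle>, k\<rangle> \<cdot> e = \<langle>\<langle>a \<cdot> e, a \<cdot> e\<rangle>, k \<cdot> e\<rangle>"
    using el e(2) by (simp_all add: hom_def)
  ultimately have k: "sat M Y \<langle>a \<cdot> e, a \<cdot> e\<rangle> \<langle>\<langle>a \<cdot> e, a \<cdot> e\<rangle>, k \<cdot> e\<rangle>"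
    by simp
  have ab: "sat M Y \<langle>a \<cdot> e, b \<cdot> e\<rangle> \<langle>\<langle>a \<cdot> e, b \<cdot> e\<rangle>, z\<rangle>"
    using e(5) Pair_hom_Comp[OF el(1,2) e(2)] by simp
  have "sat M Y \<langle>b \<cdot> e, b \<cdot> e\<rangle> \<langle>\<langle>b \<cdot> e, b \<cdot> e\<rangle>, k \<cdot> e\<rangle>"
    using difunctional[OF malcev M_hom Pair_in_hom[OF ele(1,1)] Pair_in_hom[OF ele(1,1)] ele(3)
        Pair_in_hom[OF ele(2,2)] Pair_in_hom[OF ele(2,2)] e(3) k]
      sat_M_endpoints[OF ele(1,2) e(3) ab e(4)] by blast
  then show ?thesis
    using sat_M_diagonal_local[OF el(2,3) e(1)] by simp
qed

text \<open>The measurement outcome after discarding the system.\<close>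

definition readout :: "('o, 'm) rel_ar" where
  "readout = rel_comp C (rel_graph C (Pr2 C (One C) K))
     (rel_comp C (rel_tensor C (rel_dagger C (cup (Rel C) A)) (rel_graph C (Id C K))) M)"

lemma readout_rel:
  shows readout_hom: "readout \<in> hom (Rel C) B K"
    and sat_readout: "a \<in> hom C X A \<Longrightarrow> b \<in> hom C X A \<Longrightarrow> k \<in> hom C X K \<Longrightarrow>
      sat readout X \<langle>a, b\<rangle> k \<longleftrightarrow> a = b \<and> sat M X \<langle>a, a\<rangle> \<langle>\<langle>a, a\<rangle>, k\<rangle>"
proof -
  let ?V = "rel_tensor C (rel_dagger C (cup (Rel C) A)) (rel_graph C (Id C K))"
  note cupd = dagger_rel_hom[OF cup_hom[OF A_Ob]]
  note V = tensor_rel_hom[OF cupd Id_rel_hom[OF K_Ob]]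
  note VM = Comp_rel_hom[OF M_hom V]
  have pr: "Pr2 C (One C) K \<in> hom C (Prd C (One C) K) K"
    using K_Ob by (simp add: hom_def)
  show "readout \<in> hom (Rel C) B K"
    unfolding readout_def by (rule Comp_rel_hom[OF VM graph_hom[OF pr]])
  have sat_V: "sat ?V Y \<langle>\<langle>c, d\<rangle>, l\<rangle> \<langle>u, k\<rangle> \<longleftrightarrow> c = d \<and> k = l"
    if "c \<in> hom C Y A" "d \<in> hom C Y A" "l \<in> hom C Y K" "u \<in> hom C Y (One C)" "k \<in> hom C Y K" for Y c d l u k
    using that by (simp add: sat_tensor[OF cupd Id_rel_hom[OF K_Ob]] Pair_in_hom sat_dagger[OF cup_hom[OF A_Ob]]
        sat_cup[OF A_Ob] sat_Id K_Ob)
  assume el: "a \<in> hom C X A" "b \<in> hom C X A" "k \<in> hom C X K"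
  have u: "Bang C X \<in> hom C X (One C)"
    using hom_Ob[OF el(1)] Bang_hom by auto
  have "\<langle>Bang C K, Id C K\<rangle> \<cdot> k = \<langle>Bang C X, k\<rangle>"
    using el(3) K_Ob by (auto simp: hom_def)
  then have N: "sat readout X \<langle>a, b\<rangle> k \<longleftrightarrow> sat (rel_comp C ?V M) X \<langle>a, b\<rangle> \<langle>Bang C X, k\<rangle>"
    unfolding readout_def using sat_graph_Comp[OF lunit_inverse[OF K_Ob] VM Pair_in_hom[OF el(1,2)] el(3)] by simp
  show "sat readout X \<langle>a, b\<rangle> k \<longleftrightarrow> a = b \<and> sat M X \<langle>a, a\<rangle> \<langle>\<langle>a, a\<rangle>, k\<rangle>"
    unfolding N
  proof
    assume "sat (rel_comp C ?V M) X \<langle>a, b\<rangle> \<langle>Bang C X, k\<rangle>"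
    then obtain Y e n where e: "cover e Y X" "e \<in> hom C Y X" "n \<in> hom C Y (Prd C B K)"
        "sat M Y (\<langle>a, b\<rangle> \<cdot> e) n" "sat ?V Y n (\<langle>Bang C X, k\<rangle> \<cdot> e)"
      by (rule sat_CompE[OF _ M_hom V])
    obtain n0 l where n: "n0 \<in> hom C Y B" "l \<in> hom C Y K" "n = \<langle>n0, l\<rangle>"
      using elem_Prd_cases[OF e(3) B_Ob K_Ob] .
    obtain c d where cd: "c \<in> hom C Y A" "d \<in> hom C Y A" "n0 = \<langle>c, d\<rangle>"
      using elem_Prd_cases[OF n(1) A_Ob A_Ob] .
    have ele: "a \<cdot> e \<in> hom C Y A" "b \<cdot> e \<in> hom C Y A" "k \<cdot> e \<in> hom C Y K" "Bang C X \<cdot> e \<in> hom C Y (One C)"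
      using el u Comp_in_hom[OF e(2)] by auto
    have cdk: "c = d" "k \<cdot> e = l"
      using e(5) sat_V[OF cd(1,2) n(2) ele(4,3)] unfolding n(3) cd(3) Pair_hom_Comp[OF u el(3) e(2)] by auto
    have M: "sat M Y \<langle>a \<cdot> e, b \<cdot> e\<rangle> \<langle>\<langle>c, d\<rangle>, l\<rangle>"
      using e(4) unfolding n(3) cd(3) Pair_hom_Comp[OF el(1,2) e(2)] .
    have "d = b \<cdot> e" "c = a \<cdot> e"
      using sat_M_snd[OF ele(1,2) cd(1,2) n(2) M] sat_M_fst[OF ele(1,2) cd(1,2) n(2) M] by auto
    then have ab: "a \<cdot> e = b \<cdot> e" "sat M Y \<langle>a \<cdot> e, a \<cdot> e\<rangle> \<langle>\<langle>a \<cdot> e, a \<cdot> e\<rangle>, k \<cdot> e\<rangle>"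
      using M cdk by simp_all
    show "a = b \<and> sat M X \<langle>a, a\<rangle> \<langle>\<langle>a, a\<rangle>, k\<rangle>"
      using cover_cancel[OF e(1) el(1,2) ab(1)] sat_M_diagonal_local[OF el(1,3) e(1) ab(2)] by simp
  next
    assume M: "a = b \<and> sat M X \<langle>a, a\<rangle> \<langle>\<langle>a, a\<rangle>, k\<rangle>"
    have "sat ?V X \<langle>\<langle>a, a\<rangle>, k\<rangle> \<langle>Bang C X, k\<rangle>"
      using sat_V[OF el(1,1,3) u el(3)] by simp
    then show "sat (rel_comp C ?V M) X \<langle>a, b\<rangle> \<langle>Bang C X, k\<rangle>"
      using sat_CompI[OF M_hom V] M by blast
  qed
qed

text \<open>The state \<open>\<psi>\<close> collects the outcomes that occur at \<open>(a, a)\<close> for some \<open>a\<close>; by \<open>sat_M_transport\<close> each of them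
  occurs at \<open>(a, a)\<close> for every \<open>a\<close>.\<close>

lemma readout_factorization:
  "\<exists>\<psi> \<in> hom (Rel C) (One C) K. readout = rel_comp C \<psi> (rel_dagger C (cup (Rel C) A))"
proof
  let ?cup = "cup (Rel C) A"
  let ?\<psi> = "rel_comp C readout ?cup"
  note cup = cup_hom[OF A_Ob] and cupd = dagger_rel_hom[OF cup_hom[OF A_Ob]]
  show \<psi>: "?\<psi> \<in> hom (Rel C) (One C) K"
    by (rule Comp_rel_hom[OF cup readout_hom])
  have sat_cupd: "sat (rel_dagger C ?cup) Y \<langle>a, b\<rangle> u \<longleftrightarrow> a = b"
    if "a \<in> hom C Y A" "b \<in> hom C Y A" "u \<in> hom C Y (One C)" for Y a b u
    using that by (simp add: sat_dagger[OF cup] sat_cup[OF A_Ob])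
  show "readout = rel_comp C ?\<psi> (rel_dagger C ?cup)"
  proof (rule rel_eqI[OF readout_hom Comp_rel_hom[OF cupd \<psi>]])
    fix X w k assume w: "w \<in> hom C X B" and k: "k \<in> hom C X K"
    obtain a b where ab: "a \<in> hom C X A" "b \<in> hom C X A" "w = \<langle>a, b\<rangle>"
      using elem_Prd_cases[OF w A_Ob A_Ob] .
    have u: "Bang C X \<in> hom C X (One C)"
      using hom_Ob[OF w] Bang_hom by auto
    show "sat readout X w k \<longleftrightarrow> sat (rel_comp C ?\<psi> (rel_dagger C ?cup)) X w k"
    proof
      assume N: "sat readout X w k"
      then have eq: "a = b"
        using sat_readout[OF ab(1,2) k] ab(3) by simp
      have "sat ?\<psi> X (Bang C X) k"
        by (rule sat_CompI[OF cup readout_hom _ N]) (use ab eq u in \<open>simp add: sat_cup[OF A_Ob]\<close>)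
      then show "sat (rel_comp C ?\<psi> (rel_dagger C ?cup)) X w k"
        by (rule sat_CompI[OF cupd \<psi>, rotated]) (use ab eq u in \<open>simp add: sat_cupd\<close>)
    next
      assume "sat (rel_comp C ?\<psi> (rel_dagger C ?cup)) X w k"
      then obtain Y e u where e: "cover e Y X" "e \<in> hom C Y X" "u \<in> hom C Y (One C)"
          "sat (rel_dagger C ?cup) Y (w \<cdot> e) u" "sat ?\<psi> Y u (k \<cdot> e)"
        by (rule sat_CompE[OF _ cupd \<psi>])
      have "a \<cdot> e = b \<cdot> e"
        using e(4) sat_cupd[OF Comp_in_hom[OF e(2) ab(1)] Comp_in_hom[OF e(2) ab(2)] e(3)]
        unfolding ab(3) Pair_hom_Comp[OF ab(1,2) e(2)] by simp
      then have eq: "a = b"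
        using cover_cancel[OF e(1) ab(1,2)] by simp
      obtain Z d v where d: "cover d Z Y" "d \<in> hom C Z Y" "v \<in> hom C Z B" "sat readout Z v ((k \<cdot> e) \<cdot> d)"
        using sat_CompE[OF e(5) cup readout_hom] .
      have ked: "(k \<cdot> e) \<cdot> d = k \<cdot> (e \<cdot> d)" and ed: "e \<cdot> d \<in> hom C Z X" "cover (e \<cdot> d) Z X"
        using Comp_assoc[OF d(2) e(2) k] Comp_in_hom[OF d(2) e(2)] cover_Comp[OF e(1) d(1)] by auto
      obtain c c' where v: "c \<in> hom C Z A" "c' \<in> hom C Z A" "v = \<langle>c, c'\<rangle>"
        using elem_Prd_cases[OF d(3) A_Ob A_Ob] .
      note ke = Comp_in_hom[OF ed(1) k] and ae = Comp_in_hom[OF ed(1) ab(1)]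
      have "sat M Z \<langle>c, c\<rangle> \<langle>\<langle>c, c\<rangle>, k \<cdot> (e \<cdot> d)\<rangle>"
        using d(4) sat_readout[OF v(1,2) ke] unfolding v(3) ked by blast
      then have "sat M X \<langle>a, a\<rangle> \<langle>\<langle>a, a\<rangle>, k\<rangle>"
        using sat_M_transport[OF v(1) ae ke] sat_M_diagonal_local[OF ab(1) k ed(2)] by simp
      then show "sat readout X w k"
        using sat_readout[OF ab(1,2) k] eq ab(3) by simp
    qed
  qed
qed

end

theorem proposition5p3:
  fixes C :: "('o, 'm) category"
  assumes "regular_category C"
    and "malcev_category C"
    and "quantum_structure (Rel C) B \<mu>\<^sub>B \<eta>\<^sub>B"
    and "special_dagger_frobenius (Rel C) K \<mu>\<^sub>K \<eta>\<^sub>K"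
    and "completely_positive (Rel C) B \<mu>\<^sub>B
           (B \<boxtimes>\<^bsub>Rel C\<^esub> K) (tensor_mult (Rel C) B \<mu>\<^sub>B K \<mu>\<^sub>K) M"
    and "runit (Rel C) B \<cdot>\<^bsub>Rel C\<^esub> (Id (Rel C) B \<otimes>\<^bsub>Rel C\<^esub> \<eta>\<^sub>K\<dagger>\<^bsub>Rel C\<^esub>) \<cdot>\<^bsub>Rel C\<^esub> M = Id (Rel C) B"
  shows "\<exists>\<psi> \<in> hom (Rel C) (\<one>\<^bsub>Rel C\<^esub>) K.
           lunit (Rel C) K \<cdot>\<^bsub>Rel C\<^esub> (\<eta>\<^sub>B\<dagger>\<^bsub>Rel C\<^esub> \<otimes>\<^bsub>Rel C\<^esub> Id (Rel C) K) \<cdot>\<^bsub>Rel C\<^esub> M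
             = \<psi> \<cdot>\<^bsub>Rel C\<^esub> \<eta>\<^sub>B\<dagger>\<^bsub>Rel C\<^esub>"
proof -
  interpret regular C
    by unfold_locales (fact assms(1))
  obtain A where A: "A \<in> Ob C" "B = Prd C A A" "\<mu>\<^sub>B = pants (Rel C) A" "\<eta>\<^sub>B = cup (Rel C) A"
    using quantum_structure_pair_groupoid[OF assms(3)] .
  interpret undisturbing C A K \<mu>\<^sub>K \<eta>\<^sub>K M
    by unfold_locales (use assms A in simp_all)
  show ?thesis
    using readout_factorization by (simp add: A readout_def)
qed

end
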